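(* Let $G$ be a rayless graph. Then the following hold, both when "twin" means "weak twin" and when it means "strong twin": (i) Either there are infinitely many pairwise non-isomorphic graphs that are twins of $G$, or $G$ has no twin at all. (ii) If $G$ is connected, then either there are infinitely many pairwise non-isomorphic connected graphs that are twins of $G$, or $G$ has no connected twin at all.
   Context: All graphs are simple and may be infinite. A graph is rayless if it contains no ray (one-way infinite path). Two non-isomorphic graphs $G$ and $H$ are weak twins if $G$ is isomorphic to a subgraph of $H$ and $H$ is isomorphic to a subgraph of $G$; they are strong twins if $G$ is isomorphic to an induced subgraph of $H$ and $H$ is isomorphic to an induced subgraph of $G$. *)

theory Defs
  imports Main
begin

record 'a graph =
  verts :: "'a set"
  edges :: "'a set set"

definition simple_graph :: "'a graph \<Rightarrow> bool" where
  "simple_graph G \<longleftrightarrow>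
     edges G \<subseteq> {{u, v} | u v. u \<in> verts G \<and> v \<in> verts G \<and> u \<noteq> v}"

definition subgraph :: "'a graph \<Rightarrow> 'a graph \<Rightarrow> bool" where
  "subgraph H G \<longleftrightarrow>
     simple_graph H \<and> simple_graph G \<and> verts H \<subseteq> verts G \<and> edges H \<subseteq> edges G"

definition induced_subgraph :: "'a graph \<Rightarrow> 'a graph \<Rightarrow> bool" where
  "induced_subgraph H G \<longleftrightarrow>
     subgraph H G \<and> edges H = {e \<in> edges G. e \<subseteq> verts H}"

definition isomorphic :: "'a graph \<Rightarrow> 'b graph \<Rightarrow> bool" where
  "isomorphic G H \<longleftrightarrow>
     (\<exists>f. bij_betw f (verts G) (verts H) \<and>
          (\<forall>u\<in>verts G. \<forall>v\<in>verts G. {u, v} \<in> edges G \<longleftrightarrow> {f u, f v} \<in> edges H))"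

definition rayless :: "'a graph \<Rightarrow> bool" where
  "rayless G \<longleftrightarrow> \<not> (\<exists>r :: nat \<Rightarrow> 'a. inj r \<and> range r \<subseteq> verts G \<and>
                          (\<forall>n. {r n, r (Suc n)} \<in> edges G))"

definition connected_graph :: "'a graph \<Rightarrow> bool" where
  "connected_graph G \<longleftrightarrow> verts G \<noteq> {} \<and>
     (\<forall>u\<in>verts G. \<forall>v\<in>verts G. (\<lambda>x y. {x, y} \<in> edges G)\<^sup>*\<^sup>* u v)"

definition weak_twins :: "'a graph \<Rightarrow> 'b graph \<Rightarrow> bool" where
  "weak_twins G H \<longleftrightarrow> simple_graph G \<and> simple_graph H \<and> \<not> isomorphic G H \<and>
     (\<exists>H'. subgraph H' H \<and> isomorphic G H') \<and>
     (\<exists>G'. subgraph G' G \<and> isomorphic H G')"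

definition strong_twins :: "'a graph \<Rightarrow> 'b graph \<Rightarrow> bool" where
  "strong_twins G H \<longleftrightarrow> simple_graph G \<and> simple_graph H \<and> \<not> isomorphic G H \<and>
     (\<exists>H'. induced_subgraph H' H \<and> isomorphic G H') \<and>
     (\<exists>G'. induced_subgraph G' G \<and> isomorphic H G')"

text \<open>
  A graph isomorphic to a subgraph of \<open>G :: 'a graph\<close> has an isomorphic copy with vertices in
  \<open>'a\<close>, so an infinite family of twins can always be taken of type \<open>'a graph set\<close>. Absence of
  twins, in contrast, is to be asserted for graphs over an arbitrary vertex type.
\<close>

definition infinitely_many_nonisomorphic :: "('a graph \<Rightarrow> bool) \<Rightarrow> bool" where
  "infinitely_many_nonisomorphic P \<longleftrightarrow>
     (\<exists>S. infinite S \<and> (\<forall>H\<in>S. P H) \<and> pairwise (\<lambda>H K. \<not> isomorphic H K) S)"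

end

theory Submission
  imports Defs
begin

text \<open>
  Work with graphs in which a finite vertex set \<open>A\<close> is fixed pointwise by all embeddings, and consider
  the components of \<open>G - A\<close>, each together with \<open>A\<close>, up to mutual embeddability.

  Let \<open>G\<close> and \<open>H\<close> embed in each other without being isomorphic. If the numbers of components in
  some equimorphism class \<open>q\<close> differ, then one of the graphs has a component of class \<open>q\<close> that is
  moved into a strictly larger class; its forward orbit avoids \<open>q\<close>, and shifting along such orbits
  shows that components of class \<open>q\<close> can be added or removed freely. If all these numbers agree, then
  some class contains two non-isomorphic pieces, so by induction a connected piece has infinitely
  many twins, and all components of its class can be replaced by any one of these.

  The induction runs along the rank of rayless graphs: a graph is on the next level if deleting
  finitely many vertices leaves only components of the current level, and a graph on no level
  contains a ray. A connected graph on the next level has a least such vertex set, its kernel, which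
  is finite, nonempty and preserved by embeddings. After passing to a power, mutual embeddings fix
  the kernel pointwise, so it can be added to \<open>A\<close>; and since the kernel has only finitely many
  permutations, infinitely many graphs that are distinct over the kernel yield infinitely many
  isomorphism types. Because kernels are preserved, a connected rayless graph has no two disjoint
  self-embeddings, which bounds how many components of one class fit into one component.
\<close>

text \<open>The finite set \<open>A\<close> is part of every statement because the pieces at a
  kernel have to be compared by embeddings that fix the kernel, and inside a piece the same
  situation recurs with a further kernel; the claim must hold for all finite \<open>A\<close> at
  once. Passing to pieces endangers connectedness, since an altered family of pieces need not hang
  together. A property \<open>P\<close> of pieces that survives embeddings, namely having an edge to
  the kernel, is therefore carried through the component argument. All graphs built on the way live
  on the vertex type of \<open>G\<close>, where disjoint copies are available only inside a host
  graph: each new graph is made by placing its pieces in a graph already at hand. The levels form a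
  least fixed point rather than an ordinal hierarchy. Three invariants have to pass to
  \<open>next_level\<close> and to unions of chains: closure properties, absence of disjoint
  self-embeddings, and the twin statement for connected graphs.\<close>

abbreviation adj :: "'a graph \<Rightarrow> 'a \<Rightarrow> 'a \<Rightarrow> bool" where
  "adj G u v \<equiv> {u, v} \<in> edges G"

lemma adj_commute: "adj G u v \<longleftrightarrow> adj G v u"
  by (simp add: insert_commute)

lemma simple_graph_adjD:
  assumes "simple_graph G" "adj G u v"
  shows "u \<in> verts G" "v \<in> verts G" "u \<noteq> v"
  using assms unfolding simple_graph_def by (auto simp: doubleton_eq_iff)

lemma graph_eqI:
  assumes "simple_graph G" "simple_graph H" "verts G = verts H" "\<And>u v. adj G u v \<longleftrightarrow> adj H u v"
  shows "G = (H :: 'a graph)"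
proof -
  have "e \<in> edges G \<longleftrightarrow> e \<in> edges H" for e
    using assms unfolding simple_graph_def by blast
  then have "edges G = edges H" by blast
  with assms(3) show ?thesis by simp
qed

text \<open>The flag \<open>s\<close> selects strong (induced) rather than weak embeddings.\<close>

definition graph_emb :: "bool \<Rightarrow> 'a graph \<Rightarrow> 'b graph \<Rightarrow> ('a \<Rightarrow> 'b) \<Rightarrow> bool" where
  "graph_emb s G H f \<longleftrightarrow> inj_on f (verts G) \<and> f ` verts G \<subseteq> verts H \<and>
     (\<forall>u\<in>verts G. \<forall>v\<in>verts G. adj G u v \<longrightarrow> adj H (f u) (f v)) \<and>
     (s \<longrightarrow> (\<forall>u\<in>verts G. \<forall>v\<in>verts G. adj H (f u) (f v) \<longrightarrow> adj G u v))"

text \<open>Fixing \<open>A\<close> is a condition on the total function, independent of whether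
  \<open>A\<close> lies in \<open>verts G\<close>, so that embeddings over \<open>A\<close> compose
  and restrict freely.\<close>

definition emb_over :: "bool \<Rightarrow> 'a set \<Rightarrow> 'a graph \<Rightarrow> 'a graph \<Rightarrow> ('a \<Rightarrow> 'a) \<Rightarrow> bool" where
  "emb_over s A G H f \<longleftrightarrow> graph_emb s G H f \<and> (\<forall>a\<in>A. f a = a)"

definition embeds :: "bool \<Rightarrow> 'a set \<Rightarrow> 'a graph \<Rightarrow> 'a graph \<Rightarrow> bool" where
  "embeds s A G H \<longleftrightarrow> (\<exists>f. emb_over s A G H f)"

definition equimorphic :: "bool \<Rightarrow> 'a set \<Rightarrow> 'a graph \<Rightarrow> 'a graph \<Rightarrow> bool" where
  "equimorphic s A G H \<longleftrightarrow> embeds s A G H \<and> embeds s A H G"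

definition iso_over :: "'a set \<Rightarrow> 'a graph \<Rightarrow> 'a graph \<Rightarrow> bool" where
  "iso_over A G H \<longleftrightarrow> (\<exists>f. emb_over True A G H f \<and> f ` verts G = verts H)"

definition rooted :: "'a set \<Rightarrow> 'a graph \<Rightarrow> bool" where
  "rooted A G \<longleftrightarrow> simple_graph G \<and> A \<subseteq> verts G"

definition induced :: "'a graph \<Rightarrow> 'a set \<Rightarrow> 'a graph" where
  "induced G U = \<lparr>verts = U, edges = {e \<in> edges G. e \<subseteq> U}\<rparr>"

text \<open>Every vertex reaches itself, even one in \<open>A\<close> or outside the graph;
  \<open>comps_off\<close> therefore starts from vertices of \<open>verts G - A\<close>.\<close>

definition reach_off :: "'a set \<Rightarrow> 'a graph \<Rightarrow> 'a \<Rightarrow> 'a \<Rightarrow> bool" where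
  "reach_off A G = (\<lambda>x y. adj G x y \<and> x \<notin> A \<and> y \<notin> A)\<^sup>*\<^sup>*"

definition comp_off :: "'a set \<Rightarrow> 'a graph \<Rightarrow> 'a \<Rightarrow> 'a set" where
  "comp_off A G v = {u. reach_off A G v u}"

definition comps_off :: "'a set \<Rightarrow> 'a graph \<Rightarrow> 'a set set" where
  "comps_off A G = comp_off A G ` (verts G - A)"

text \<open>Components are nonempty, so equality with a singleton also excludes a graph without
  vertices off \<open>A\<close>.\<close>

definition connected_off :: "'a set \<Rightarrow> 'a graph \<Rightarrow> bool" where
  "connected_off A G \<longleftrightarrow> comps_off A G = {verts G - A}"

abbreviation piece :: "'a set \<Rightarrow> 'a graph \<Rightarrow> 'a set \<Rightarrow> 'a graph" where
  "piece A G C \<equiv> induced G (C \<union> A)"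

lemma verts_induced [simp]: "verts (induced G U) = U"
  by (simp add: induced_def)

lemma adj_induced [simp]: "adj (induced G U) u v \<longleftrightarrow> adj G u v \<and> u \<in> U \<and> v \<in> U"
  by (auto simp: induced_def)

lemma simple_induced [simp]: "simple_graph G \<Longrightarrow> simple_graph (induced G U)"
proof -
  assume G: "simple_graph G"
  have "e \<in> {{u, v} | u v. u \<in> U \<and> v \<in> U \<and> u \<noteq> v}" if "e \<in> edges G" "e \<subseteq> U" for e
  proof -
    obtain u v where "e = {u, v}" "u \<noteq> v" using G \<open>e \<in> edges G\<close> unfolding simple_graph_def by blast
    with that show ?thesis by blast
  qed
  then show ?thesis unfolding simple_graph_def induced_def by auto
qed

lemma induced_induced: "W \<subseteq> U \<Longrightarrow> induced (induced G U) W = induced G W"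
  unfolding induced_def by auto

lemma induced_verts: "simple_graph G \<Longrightarrow> induced G (verts G) = G"
  by (rule graph_eqI) (auto dest: simple_graph_adjD)

lemma rooted_piece: "rooted A G \<Longrightarrow> rooted A (piece A G C)"
  by (simp add: rooted_def)

section \<open>Calculus of embeddings over a fixed vertex set\<close>

lemma graph_embD:
  assumes "graph_emb s G H f"
  shows "inj_on f (verts G)" "\<And>x. x \<in> verts G \<Longrightarrow> f x \<in> verts H"
    "\<And>u v. u \<in> verts G \<Longrightarrow> v \<in> verts G \<Longrightarrow> adj G u v \<Longrightarrow> adj H (f u) (f v)"
    "\<And>u v. s \<Longrightarrow> u \<in> verts G \<Longrightarrow> v \<in> verts G \<Longrightarrow> adj H (f u) (f v) \<Longrightarrow> adj G u v"
  using assms unfolding graph_emb_def by blast+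

lemma graph_embI:
  assumes "inj_on f (verts G)" "\<And>x. x \<in> verts G \<Longrightarrow> f x \<in> verts H"
    "\<And>u v. u \<in> verts G \<Longrightarrow> v \<in> verts G \<Longrightarrow> adj G u v \<Longrightarrow> adj H (f u) (f v)"
    "\<And>u v. s \<Longrightarrow> u \<in> verts G \<Longrightarrow> v \<in> verts G \<Longrightarrow> adj H (f u) (f v) \<Longrightarrow> adj G u v"
  shows "graph_emb s G H f"
  using assms unfolding graph_emb_def by blast

lemma emb_overD:
  assumes "emb_over s A G H f"
  shows "inj_on f (verts G)" "\<And>x. x \<in> verts G \<Longrightarrow> f x \<in> verts H" "\<And>a. a \<in> A \<Longrightarrow> f a = a"
    "\<And>u v. u \<in> verts G \<Longrightarrow> v \<in> verts G \<Longrightarrow> adj G u v \<Longrightarrow> adj H (f u) (f v)"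
    "\<And>u v. s \<Longrightarrow> u \<in> verts G \<Longrightarrow> v \<in> verts G \<Longrightarrow> adj H (f u) (f v) \<Longrightarrow> adj G u v"
  using assms unfolding emb_over_def graph_emb_def by blast+

lemma emb_overI:
  assumes "inj_on f (verts G)" "\<And>x. x \<in> verts G \<Longrightarrow> f x \<in> verts H" "\<And>a. a \<in> A \<Longrightarrow> f a = a"
    "\<And>u v. u \<in> verts G \<Longrightarrow> v \<in> verts G \<Longrightarrow> adj G u v \<Longrightarrow> adj H (f u) (f v)"
    "\<And>u v. s \<Longrightarrow> u \<in> verts G \<Longrightarrow> v \<in> verts G \<Longrightarrow> adj H (f u) (f v) \<Longrightarrow> adj G u v"
  shows "emb_over s A G H f"
  using assms unfolding emb_over_def graph_emb_def by blast

lemma graph_emb_comp: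
  assumes f: "graph_emb s G H f" and g: "graph_emb s H K g"
  shows "graph_emb s G K (g \<circ> f)"
proof (rule graph_embI)
  note F = graph_embD[OF f] and D = graph_embD[OF g]
  show "inj_on (g \<circ> f) (verts G)"
    using F(1,2) D(1) by (meson comp_inj_on image_subsetI inj_on_subset)
  fix u assume u: "u \<in> verts G"
  show "(g \<circ> f) u \<in> verts K" using F(2) D(2) u by simp
  fix v assume v: "v \<in> verts G"
  show "adj K ((g \<circ> f) u) ((g \<circ> f) v)" if "adj G u v"
    using F(3)[OF u v that] D(3) F(2) u v by (metis comp_apply)
  show "adj G u v" if s "adj K ((g \<circ> f) u) ((g \<circ> f) v)"
    using F(4)[OF _ u v] D(4)[OF that(1) F(2)[OF u] F(2)[OF v]] that by (metis comp_apply)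
qed

lemma emb_over_comp:
  assumes "emb_over s A G H f" "emb_over s A H K g"
  shows "emb_over s A G K (g \<circ> f)"
  using assms graph_emb_comp unfolding emb_over_def by fastforce

lemma emb_over_weaken:
  assumes "emb_over s A G H f" "B \<subseteq> A" "t \<Longrightarrow> s"
  shows "emb_over t B G H f"
  using assms unfolding emb_over_def graph_emb_def by blast

lemma emb_over_sub:
  assumes "U \<subseteq> verts G"
  shows "emb_over s A (induced G U) G id"
  by (rule emb_overI) (use assms in auto)

lemma emb_over_restrict:
  assumes "emb_over s A G H f" "U \<subseteq> verts G" "f ` U \<subseteq> W"
  shows "emb_over s A (induced G U) (induced H W) f"
proof (rule emb_overI)
  show "inj_on f (verts (induced G U))"
    using emb_overD(1)[OF assms(1)] assms(2) by (auto intro: inj_on_subset)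
  note D = emb_overD[OF assms(1)]
  show "adj (induced H W) (f u) (f v)"
    if "u \<in> verts (induced G U)" "v \<in> verts (induced G U)" "adj (induced G U) u v" for u v
    using D(4)[of u v] that assms(2,3) by (auto simp: subset_iff)
  show "adj (induced G U) u v"
    if s "u \<in> verts (induced G U)" "v \<in> verts (induced G U)" "adj (induced H W) (f u) (f v)" for u v
    using D(5)[of u v] that assms(2) by (auto simp: subset_iff)
qed (use assms(3) emb_overD(3)[OF assms(1)] in auto)

lemma emb_over_induced_mono:
  assumes "U \<subseteq> W"
  shows "emb_over s A (induced G U) (induced G W) id"
  by (rule emb_overI) (use assms in auto)

text \<open>Injectivity: a point of \<open>A\<close> is already the image of itself, so no vertex
  outside \<open>A\<close> can be sent there.\<close>

lemma emb_over_off_root: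
  assumes "emb_over s A G H f" "A \<subseteq> verts G" "x \<in> verts G"
  shows "f x \<in> A \<longleftrightarrow> x \<in> A"
  using emb_overD(1,3)[OF assms(1)] assms(2,3) by (metis inj_onD subsetD)

lemma emb_over_id: "emb_over s A G G id"
  by (rule emb_overI) auto

lemma embeds_refl: "embeds s A G G"
  using emb_over_id unfolding embeds_def by blast

lemma embeds_trans: "embeds s A G H \<Longrightarrow> embeds s A H K \<Longrightarrow> embeds s A G K"
  unfolding embeds_def using emb_over_comp by blast

lemma equimorphic_refl: "equimorphic s A G G"
  by (simp add: equimorphic_def embeds_refl)

lemma equimorphic_sym: "equimorphic s A G H \<Longrightarrow> equimorphic s A H G"
  by (simp add: equimorphic_def)

lemma equimorphic_trans: "equimorphic s A G H \<Longrightarrow> equimorphic s A H K \<Longrightarrow> equimorphic s A G K"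
  unfolding equimorphic_def using embeds_trans by blast

lemma emb_over_inverse:
  assumes "emb_over True A G H f" "f ` verts G = verts H" "A \<subseteq> verts G"
  shows "emb_over True A H G (inv_into (verts G) f)"
    "inv_into (verts G) f ` verts H = verts G"
proof -
  note D = emb_overD[OF assms(1)]
  have bij: "bij_betw f (verts G) (verts H)" using D(1) assms(2) by (simp add: bij_betw_def)
  show im: "inv_into (verts G) f ` verts H = verts G"
    using bij by (metis bij_betw_def bij_betw_inv_into)
  have fi: "f (inv_into (verts G) f x) = x" if "x \<in> verts H" for x
    using that assms(2) by (simp add: f_inv_into_f)
  show "emb_over True A H G (inv_into (verts G) f)"
  proof (rule emb_overI)
    show "inj_on (inv_into (verts G) f) (verts H)"
      using bij bij_betw_inv_into bij_betw_def by blast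
    show "inv_into (verts G) f a = a" if "a \<in> A" for a
      using that D(1,3) assms(3) by (metis inv_into_f_f subsetD)
    show "inv_into (verts G) f x \<in> verts G" if "x \<in> verts H" for x
      using that im by blast
    show "adj G (inv_into (verts G) f u) (inv_into (verts G) f v)"
      if "u \<in> verts H" "v \<in> verts H" "adj H u v" for u v
      using D(5)[of "inv_into (verts G) f u" "inv_into (verts G) f v"] that fi im by auto
    show "adj H u v"
      if "u \<in> verts H" "v \<in> verts H" "adj G (inv_into (verts G) f u) (inv_into (verts G) f v)" for u v
      using D(4)[of "inv_into (verts G) f u" "inv_into (verts G) f v"] that fi im by auto
  qed
qed

lemma iso_over_refl: "iso_over A G G"
  using emb_over_id[of True A G] unfolding iso_over_def by force

lemma iso_over_sym: "A \<subseteq> verts G \<Longrightarrow> iso_over A G H \<Longrightarrow> iso_over A H G"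
  unfolding iso_over_def by (metis emb_over_inverse)

lemma iso_over_trans:
  assumes "iso_over A G H" "iso_over A H K" shows "iso_over A G K"
  using assms emb_over_comp unfolding iso_over_def by (metis image_comp)

lemma iso_over_weaken: "iso_over A G H \<Longrightarrow> B \<subseteq> A \<Longrightarrow> iso_over B G H"
  unfolding iso_over_def by (metis emb_over_weaken)

lemma iso_over_equimorphic:
  assumes "iso_over A G H" "A \<subseteq> verts G" shows "equimorphic s A G H"
proof -
  have "embeds s A G H" using assms unfolding iso_over_def embeds_def
    by (metis emb_over_weaken subset_refl)
  moreover have "embeds s A H G" using iso_over_sym[OF assms(2,1)] unfolding iso_over_def embeds_def
    by (metis emb_over_weaken subset_refl)
  ultimately show ?thesis by (simp add: equimorphic_def)
qed

definition agree_on :: "'a set \<Rightarrow> 'a graph \<Rightarrow> 'a graph \<Rightarrow> bool" where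
  "agree_on A G H \<longleftrightarrow> (\<forall>a\<in>A. \<forall>b\<in>A. adj G a b \<longleftrightarrow> adj H a b)"

text \<open>Both embeddings fix \<open>A\<close> and preserve edges, so even weak embeddings in both
  directions force the same edges inside \<open>A\<close>.\<close>

lemma equimorphic_agree_on:
  assumes "equimorphic s A G H" "A \<subseteq> verts G" "A \<subseteq> verts H"
  shows "agree_on A G H"
proof -
  obtain f g where f: "emb_over s A G H f" and g: "emb_over s A H G g"
    using assms(1) unfolding equimorphic_def embeds_def by metis
  show ?thesis unfolding agree_on_def
  proof (intro ballI iffI)
    fix a b assume ab: "a \<in> A" "b \<in> A"
    show "adj H a b" if "adj G a b"
      using emb_overD(4)[OF f, of a b] emb_overD(3)[OF f] ab assms(2) that by auto
    show "adj G a b" if "adj H a b"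
      using emb_overD(4)[OF g, of a b] emb_overD(3)[OF g] ab assms(3) that by auto
  qed
qed

lemma agree_on_piece: "agree_on A (piece A G C) G"
  by (auto simp: agree_on_def)

section \<open>Components\<close>

lemma reach_off_refl [simp]: "reach_off A G x x"
  by (simp add: reach_off_def)

lemma reach_off_step: "adj G x y \<Longrightarrow> x \<notin> A \<Longrightarrow> y \<notin> A \<Longrightarrow> reach_off A G x y"
  by (simp add: reach_off_def r_into_rtranclp)

lemma reach_off_trans: "reach_off A G x y \<Longrightarrow> reach_off A G y z \<Longrightarrow> reach_off A G x z"
  unfolding reach_off_def by (rule rtranclp_trans)

lemma reach_off_induct [consumes 1, case_names refl step]:
  assumes "reach_off A G x y" "P x"
    and "\<And>u v. reach_off A G x u \<Longrightarrow> adj G u v \<Longrightarrow> u \<notin> A \<Longrightarrow> v \<notin> A \<Longrightarrow> P u \<Longrightarrow> P v"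
  shows "P y"
  using assms(1) unfolding reach_off_def
proof (induction rule: rtranclp_induct)
  case (step u v)
  then show ?case using assms(3)[of u v] unfolding reach_off_def by blast
qed fact

lemma reach_off_sym:
  assumes "reach_off A G x y" shows "reach_off A G y x"
  using assms
proof (induction rule: reach_off_induct)
  case (step u v)
  then have "reach_off A G v u" by (simp add: reach_off_step insert_commute)
  then show ?case using step.IH by (rule reach_off_trans)
qed simp

text \<open>Transports a walk into another graph with another deleted set. The invariant
  \<open>P\<close> of the visited vertices supplies what a single step needs, such as staying inside
  a vertex set.\<close>

lemma reach_off_map:
  assumes "reach_off A G x y" "P x"
    and "\<And>u v. P u \<Longrightarrow> adj G u v \<Longrightarrow> u \<notin> A \<Longrightarrow> v \<notin> A \<Longrightarrow> reach_off A G x v \<Longrightarrow>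
      P v \<and> reach_off B H (f u) (f v)"
  shows "P y \<and> reach_off B H (f x) (f y)"
  using assms(1)
proof (induction rule: reach_off_induct)
  case refl
  show ?case using assms(2) by simp
next
  case (step u v)
  have "reach_off A G x v" using step(1) reach_off_step[OF step(2-4)] by (rule reach_off_trans)
  then have "P v \<and> reach_off B H (f u) (f v)" using assms(3)[of u v] step by simp
  then show ?case using step(5) reach_off_trans by fast
qed

lemma reach_off_verts:
  assumes "simple_graph G" "reach_off A G x y" "x \<in> verts G - A"
  shows "y \<in> verts G - A"
  using reach_off_map[OF assms(2), of "\<lambda>x. x \<in> verts G - A" A G id] assms(1,3)
  by (auto dest: simple_graph_adjD intro: reach_off_step)

lemma comp_off_self [simp]: "x \<in> comp_off A G x"
  by (simp add: comp_off_def)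

lemma comp_off_eq:
  assumes "y \<in> comp_off A G x" shows "comp_off A G y = comp_off A G x"
proof -
  have xy: "reach_off A G x y" using assms by (simp add: comp_off_def)
  have "reach_off A G y z \<longleftrightarrow> reach_off A G x z" for z
    using reach_off_trans[OF xy, of z] reach_off_trans[OF reach_off_sym[OF xy], of z] by (rule iffI)
  then show ?thesis by (simp add: comp_off_def)
qed

lemma comps_offE:
  assumes "C \<in> comps_off A G"
  obtains x where "x \<in> verts G - A" "C = comp_off A G x"
  using assms by (auto simp: comps_off_def)

lemma comps_off_subset:
  assumes "simple_graph G" "C \<in> comps_off A G" shows "C \<subseteq> verts G - A"
proof
  fix y assume y: "y \<in> C"
  obtain x where x: "x \<in> verts G - A" "C = comp_off A G x" using assms(2) by (rule comps_offE)
  then have "reach_off A G x y" using y by (simp add: comp_off_def)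
  then show "y \<in> verts G - A" using assms(1) x(1) reach_off_verts by metis
qed

lemma comps_off_eq_comp_off:
  assumes "C \<in> comps_off A G" "x \<in> C" shows "C = comp_off A G x"
  using assms by (metis comps_offE comp_off_eq)

lemma comps_off_ne: "C \<in> comps_off A G \<Longrightarrow> C \<noteq> {}"
  by (metis comps_offE comp_off_self empty_iff)

lemma comp_off_in_comps: "x \<in> verts G - A \<Longrightarrow> comp_off A G x \<in> comps_off A G"
  unfolding comps_off_def by (rule imageI)

lemma Union_comps_off: "simple_graph G \<Longrightarrow> \<Union> (comps_off A G) = verts G - A"
proof
  assume G: "simple_graph G"
  show "\<Union> (comps_off A G) \<subseteq> verts G - A" using comps_off_subset[OF G] by (rule Union_least)
  show "verts G - A \<subseteq> \<Union> (comps_off A G)"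
    using comp_off_in_comps comp_off_self by (metis UnionI subsetI)
qed

lemma comps_off_disjoint:
  "C \<in> comps_off A G \<Longrightarrow> D \<in> comps_off A G \<Longrightarrow> x \<in> C \<Longrightarrow> x \<in> D \<Longrightarrow> C = D"
  by (metis comps_off_eq_comp_off)

lemma comps_off_reach:
  "C \<in> comps_off A G \<Longrightarrow> x \<in> C \<Longrightarrow> y \<in> C \<Longrightarrow> reach_off A G x y"
  by (metis comps_off_eq_comp_off comp_off_def mem_Collect_eq)

lemma comps_off_closed:
  "C \<in> comps_off A G \<Longrightarrow> x \<in> C \<Longrightarrow> reach_off A G x y \<Longrightarrow> y \<in> C"
  by (metis comps_off_eq_comp_off comp_off_def mem_Collect_eq)

lemma comps_off_adj:
  assumes "simple_graph G" "C \<in> comps_off A G" "D \<in> comps_off A G" "x \<in> C" "y \<in> D" "adj G x y"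
  shows "C = D"
proof -
  have "x \<notin> A" "y \<notin> A" using assms comps_off_subset by (metis DiffD2 subsetD)+
  then have "reach_off A G x y" using assms(6) by (metis reach_off_step)
  then have "y \<in> C" using assms(2,4) by (metis comps_off_closed)
  then show ?thesis using assms(2,3,5) by (metis comps_off_disjoint)
qed

text \<open>A block closed under neighbours off \<open>A\<close> contains whatever its points reach,
  hence is the component of each of them. The components of constructed graphs are identified in
  this way.\<close>

lemma comps_offI:
  assumes "simple_graph G" "\<Union> \<C> = verts G - A" "{} \<notin> \<C>"
    and "\<And>C x y. C \<in> \<C> \<Longrightarrow> x \<in> C \<Longrightarrow> y \<in> C \<Longrightarrow> reach_off A G x y"
    and "\<And>C x y. C \<in> \<C> \<Longrightarrow> x \<in> C \<Longrightarrow> adj G x y \<Longrightarrow> y \<notin> A \<Longrightarrow> y \<in> C"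
  shows "comps_off A G = \<C>"
proof -
  have eq: "comp_off A G x = C" if C: "C \<in> \<C>" "x \<in> C" for x C
  proof -
    have "y \<in> C" if "reach_off A G x y" for y
      using that
    proof (induction rule: reach_off_induct)
      case (step u v)
      then show ?case using assms(5)[OF C(1)] by metis
    qed fact
    moreover have "reach_off A G x y" if "y \<in> C" for y using assms(4)[OF C that] .
    ultimately show ?thesis unfolding comp_off_def by (intro set_eqI) (metis mem_Collect_eq)
  qed
  show ?thesis
  proof (intro subset_antisym subsetI)
    fix C assume "C \<in> comps_off A G"
    then obtain x where x: "x \<in> verts G - A" "C = comp_off A G x" by (rule comps_offE)
    then obtain D where "D \<in> \<C>" "x \<in> D" using assms(2) by (metis UnionE)
    then show "C \<in> \<C>" using eq x(2) by metis
  next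
    fix C assume C: "C \<in> \<C>"
    then obtain x where x: "x \<in> C" using assms(3) by (metis all_not_in_conv)
    then have "x \<in> verts G - A" using C assms(2) by (metis UnionI)
    then show "C \<in> comps_off A G" using eq[OF C x] comp_off_in_comps by metis
  qed
qed

lemma reach_off_induced:
  assumes "reach_off A G x y" "x \<in> U" "\<And>v. reach_off A G x v \<Longrightarrow> v \<in> U" "B \<inter> U \<subseteq> A"
  shows "reach_off B (induced G U) x y"
proof -
  have "y \<in> U \<and> reach_off B (induced G U) (id x) (id y)"
  proof (rule reach_off_map[OF assms(1)])
    show "x \<in> U" by fact
    fix u v assume u: "u \<in> U" "adj G u v" "u \<notin> A" "v \<notin> A" "reach_off A G x v"
    then have v: "v \<in> U" using assms(3) by metis
    have "u \<notin> B" "v \<notin> B" using u v assms(4) by auto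
    then have "reach_off B (induced G U) u v" using u v by (intro reach_off_step) auto
    then show "v \<in> U \<and> reach_off B (induced G U) (id u) (id v)" using v by simp
  qed
  then show ?thesis by simp
qed

text \<open>No edge joins different components, so discarding some of them, or keeping only a part
  \<open>B\<close> of \<open>A\<close>, does not merge the others. The choice \<open>B = A\<close>
  thins out a graph; \<open>B = {}\<close> views a single component as a graph of its own.\<close>

lemma comps_off_restrict:
  assumes G: "simple_graph G" and J: "\<C> \<subseteq> comps_off A G" and B: "B \<subseteq> A"
  shows "comps_off B (induced G (\<Union>\<C> \<union> B)) = \<C>"
proof (rule comps_offI)
  have dis: "C \<inter> A = {}" if "C \<in> \<C>" for C
  proof -
    have "C \<subseteq> verts G - A" using that J comps_off_subset[OF G] by (metis subsetD)
    then show ?thesis by auto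
  qed
  show "simple_graph (induced G (\<Union>\<C> \<union> B))" using G by simp
  show "\<Union>\<C> = verts (induced G (\<Union>\<C> \<union> B)) - B" using dis B by fastforce
  show "{} \<notin> \<C>" using J comps_off_ne by (metis subsetD)
  fix C x y assume C: "C \<in> \<C>" "x \<in> C"
  have CA: "C \<in> comps_off A G" using C J by (metis subsetD)
  show "reach_off B (induced G (\<Union>\<C> \<union> B)) x y" if "y \<in> C"
  proof -
    have "reach_off {} (induced G C) x y"
      by (rule reach_off_induced[OF comps_off_reach[OF CA C(2) that] C(2)])
        (use comps_off_closed[OF CA C(2)] in auto)
    then have "y \<in> C \<and> reach_off B (induced G (\<Union>\<C> \<union> B)) (id x) (id y)"
      by (rule reach_off_map) (use C dis[OF C(1)] B in \<open>auto intro!: reach_off_step\<close>)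
    then show ?thesis by simp
  qed
  show "y \<in> C" if y: "adj (induced G (\<Union>\<C> \<union> B)) x y" "y \<notin> B"
  proof -
    obtain D where D: "D \<in> \<C>" "y \<in> D" using y by auto
    then have "D \<in> comps_off A G" using J by (metis subsetD)
    then have "C = D" using comps_off_adj[OF G CA _ C(2) D(2)] y(1) by simp
    with D show ?thesis by simp
  qed
qed

lemma connected_off_piece:
  assumes "simple_graph G" "C \<in> comps_off A G" "B \<subseteq> A"
  shows "connected_off B (induced G (C \<union> B))"
  using comps_off_restrict[of G "{C}" A B] assms comps_off_subset[OF assms(1,2)]
  unfolding connected_off_def by auto

lemma connected_offD:
  assumes "connected_off A G"
  shows "verts G - A \<noteq> {}" "\<And>x y. x \<in> verts G - A \<Longrightarrow> y \<in> verts G - A \<Longrightarrow> reach_off A G x y"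
  using assms comps_off_ne comps_off_reach unfolding connected_off_def by (metis singletonI)+

lemma connected_offI:
  assumes "simple_graph G" "verts G - A \<noteq> {}"
    "\<And>x y. x \<in> verts G - A \<Longrightarrow> y \<in> verts G - A \<Longrightarrow> reach_off A G x y"
  shows "connected_off A G"
  unfolding connected_off_def
  by (rule comps_offI) (use assms in \<open>auto dest: simple_graph_adjD\<close>)

lemma connected_off_induced:
  assumes "simple_graph G" "A \<subseteq> verts G"
  shows "connected_off {} (induced G (verts G - A)) \<longleftrightarrow> connected_off A G"
proof
  assume c: "connected_off A G"
  then have "verts G - A \<in> comps_off A G" unfolding connected_off_def by simp
  then show "connected_off {} (induced G (verts G - A))"
    using connected_off_piece[OF assms(1), of _ A "{}"] by force
next
  assume c: "connected_off {} (induced G (verts G - A))"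
  show "connected_off A G"
  proof (rule connected_offI)
    fix x y assume xy: "x \<in> verts G - A" "y \<in> verts G - A"
    then have "reach_off {} (induced G (verts G - A)) x y" using connected_offD(2)[OF c] by simp
    then have "y \<in> verts G - A \<and> reach_off A G (id x) (id y)"
      by (rule reach_off_map) (use xy in \<open>auto intro: reach_off_step\<close>)
    then show "reach_off A G x y" by simp
  qed (use assms connected_offD(1)[OF c] in auto)
qed

text \<open>Allows a cut \<open>S\<close> of the graph off \<open>A\<close> to be read as an
  enlargement of the fixed set to \<open>A \<union> S\<close>.\<close>

lemma comps_off_Un:
  assumes G: "simple_graph G" and S: "S \<inter> A = {}" "S \<subseteq> verts G"
  shows "comps_off S (induced G (verts G - A)) = comps_off (A \<union> S) G"
proof (rule comps_offI)
  show "\<Union> (comps_off (A \<union> S) G) = verts (induced G (verts G - A)) - S"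
    using Union_comps_off[OF G] by auto
  show "{} \<notin> comps_off (A \<union> S) G" using comps_off_ne by blast
  fix C x y assume C: "C \<in> comps_off (A \<union> S) G" "x \<in> C"
  note sub = comps_off_subset[OF G C(1)]
  show "reach_off S (induced G (verts G - A)) x y" if "y \<in> C"
    by (rule reach_off_induced[of "A \<union> S"])
      (use C that sub comps_off_reach comps_off_closed in fast)+
  show "y \<in> C" if "adj (induced G (verts G - A)) x y" "y \<notin> S"
    using comps_off_closed[OF C, of y] reach_off_step[of x y G "A \<union> S"] sub C that by auto
qed (use G in simp)

section \<open>Action of embeddings on components\<close>

lemma emb_over_reach:
  assumes "emb_over s A G H f" "simple_graph G" "A \<subseteq> verts G" "reach_off A G x y" "x \<in> verts G - A"
  shows "reach_off A H (f x) (f y)"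
proof -
  have "y \<in> verts G - A \<and> reach_off A H (f x) (f y)"
    using assms(4,5)
  proof (rule reach_off_map)
    fix u v assume "u \<in> verts G - A" "adj G u v" "u \<notin> A" "v \<notin> A"
    then show "v \<in> verts G - A \<and> reach_off A H (f u) (f v)"
      using emb_over_off_root[OF assms(1,3)] emb_overD(4)[OF assms(1)] simple_graph_adjD[OF assms(2)]
      by (auto intro!: reach_off_step)
  qed
  then show ?thesis by simp
qed

text \<open>Any vertex of \<open>C\<close> gives the same value when \<open>f\<close> is an
  embedding over \<open>A\<close>, because the image of \<open>C\<close> stays within one component;
  \<open>comp_map_eq\<close> removes the choice.\<close>

definition comp_map :: "'a set \<Rightarrow> 'a graph \<Rightarrow> ('a \<Rightarrow> 'a) \<Rightarrow> 'a set \<Rightarrow> 'a set" where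
  "comp_map A H f C = comp_off A H (f (SOME x. x \<in> C))"

lemma comp_map:
  assumes f: "emb_over s A G H f" and G: "rooted A G" and C: "C \<in> comps_off A G"
  shows "comp_map A H f C \<in> comps_off A H" "f ` C \<subseteq> comp_map A H f C"
    "emb_over s A (piece A G C) (piece A H (comp_map A H f C)) f"
proof -
  have G': "simple_graph G" "A \<subseteq> verts G" using G by (auto simp: rooted_def)
  note sub = comps_off_subset[OF G'(1) C]
  define x where "x = (SOME x. x \<in> C)"
  have x: "x \<in> C" using comps_off_ne[OF C] unfolding x_def by (simp add: some_in_eq)
  have "f x \<in> verts H - A"
    using x sub emb_overD(2)[OF f] emb_over_off_root[OF f G'(2)] by blast
  then show "comp_map A H f C \<in> comps_off A H"
    unfolding comp_map_def x_def[symmetric] by (rule comp_off_in_comps)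
  show *: "f ` C \<subseteq> comp_map A H f C"
  proof
    fix z assume "z \<in> f ` C"
    then obtain y where y: "y \<in> C" "z = f y" by blast
    then have "reach_off A H (f x) (f y)"
      using emb_over_reach[OF f G' comps_off_reach[OF C x]] x sub by blast
    then show "z \<in> comp_map A H f C" using y unfolding comp_map_def comp_off_def x_def by simp
  qed
  show "emb_over s A (piece A G C) (piece A H (comp_map A H f C)) f"
    by (rule emb_over_restrict[OF f]) (use sub G'(2) * emb_overD(3)[OF f] in auto)
qed

lemma comp_map_eq:
  assumes f: "emb_over s A G H f" and G: "rooted A G" and C: "C \<in> comps_off A G"
    and D: "D \<in> comps_off A H" "x \<in> C" "f x \<in> D"
  shows "comp_map A H f C = D"
  using comp_map(1,2)[OF f G C] D comps_off_disjoint by (metis image_subset_iff)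

section \<open>Gluing along components\<close>

lemma comps_off_cases:
  assumes "rooted A G" "u \<in> verts G" "v \<in> verts G"
  obtains "u \<in> A" "v \<in> A"
  | C where "C \<in> comps_off A G" "u \<in> C \<union> A" "v \<in> C \<union> A"
  | C D where "C \<in> comps_off A G" "D \<in> comps_off A G" "C \<noteq> D" "u \<in> C" "v \<in> D"
proof (cases "u \<in> A \<or> v \<in> A")
  case True
  show ?thesis
  proof (cases "u \<in> A \<and> v \<in> A")
    case True
    then show ?thesis using that(1) by simp
  next
    case False
    then obtain w where w: "w = u \<or> w = v" "w \<notin> A" "w \<in> verts G" using assms by metis
    show ?thesis
      by (rule that(2)[of "comp_off A G w"])
        (use True w comp_off_in_comps[of w G A] comp_off_self[of w A G] in auto)
  qed
next
  case False
  then have uv: "u \<in> verts G - A" "v \<in> verts G - A" using assms by auto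
  note c = comp_off_in_comps[OF uv(1)] comp_off_in_comps[OF uv(2)]
  show ?thesis
  proof (cases "comp_off A G u = comp_off A G v")
    case True
    show ?thesis
      by (rule that(2)[OF c(1)]) (use True comp_off_self[of u A G] comp_off_self[of v A G] in auto)
  next
    case False
    then show ?thesis using that(3)[OF c] by simp
  qed
qed

text \<open>Edges run only inside pieces, so it suffices to embed each piece and to keep the images
  of different components apart. In the strong case the images must also be nonadjacent, or an edge
  would appear that \<open>G\<close> does not have.\<close>

lemma emb_over_glue:
  assumes G: "rooted A G" and H: "A \<subseteq> verts H" "agree_on A G H"
    and f: "\<And>C. C \<in> comps_off A G \<Longrightarrow> emb_over s A (piece A G C) H (f C)"
    and dis: "\<And>C D x y. C \<in> comps_off A G \<Longrightarrow> D \<in> comps_off A G \<Longrightarrow> C \<noteq> D \<Longrightarrow> x \<in> C \<Longrightarrow> y \<in> D \<Longrightarrow>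
      f C x \<noteq> f D y \<and> (s \<longrightarrow> \<not> adj H (f C x) (f D y))"
  obtains F where "emb_over s A G H F" "\<And>C x. C \<in> comps_off A G \<Longrightarrow> x \<in> C \<union> A \<Longrightarrow> F x = f C x"
proof -
  have sG: "simple_graph G" using G by (simp add: rooted_def)
  define F where "F = (\<lambda>x. if x \<in> A then x else f (comp_off A G x) x)"
  have FA: "F a = a" if "a \<in> A" for a using that by (simp add: F_def)
  have FC: "F x = f C x" if "C \<in> comps_off A G" "x \<in> C \<union> A" for C x
  proof (cases "x \<in> A")
    case True
    then show ?thesis using FA emb_overD(3)[OF f[OF that(1)]] by simp
  next
    case False
    then have "C = comp_off A G x" using that comps_off_eq_comp_off by (metis Un_iff)
    then show ?thesis using False by (simp add: F_def)
  qed
  have "emb_over s A G H F"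
  proof (rule emb_overI)
    show "F a = a" if "a \<in> A" for a using FA[OF that] .
    have inj: "F u = F v \<Longrightarrow> u = v" and ad: "adj G u v \<Longrightarrow> adj H (F u) (F v)"
      and ad': "s \<Longrightarrow> adj H (F u) (F v) \<Longrightarrow> adj G u v"
      if uv: "u \<in> verts G" "v \<in> verts G" for u v
    proof (atomize (full), cases rule: comps_off_cases[OF G uv])
      case 1
      then show "(F u = F v \<longrightarrow> u = v) \<and> (adj G u v \<longrightarrow> adj H (F u) (F v)) \<and>
        (s \<longrightarrow> adj H (F u) (F v) \<longrightarrow> adj G u v)"
        using H(2) FA by (simp add: agree_on_def)
    next
      case (2 C)
      note D = emb_overD[OF f[OF 2(1)], simplified]
      have "F u = f C u" "F v = f C v" using FC[OF 2(1)] 2 by auto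
      then show "(F u = F v \<longrightarrow> u = v) \<and> (adj G u v \<longrightarrow> adj H (F u) (F v)) \<and>
        (s \<longrightarrow> adj H (F u) (F v) \<longrightarrow> adj G u v)"
        using D(1)[THEN inj_onD, of u v] D(4)[of u v] D(5)[of u v] 2(2,3) by auto
    next
      case (3 C D)
      have "F u = f C u" "F v = f D v" using FC 3 by auto
      then show "(F u = F v \<longrightarrow> u = v) \<and> (adj G u v \<longrightarrow> adj H (F u) (F v)) \<and>
        (s \<longrightarrow> adj H (F u) (F v) \<longrightarrow> adj G u v)"
        using dis[OF 3] comps_off_adj[OF sG 3(1,2,4,5)] 3(3) by auto
    qed
    show "inj_on F (verts G)" using inj by (rule inj_onI)
    show "adj H (F u) (F v)" if "u \<in> verts G" "v \<in> verts G" "adj G u v" for u v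
      using ad that by blast
    show "adj G u v" if s "u \<in> verts G" "v \<in> verts G" "adj H (F u) (F v)" for u v
      using ad' that by blast
    show "F x \<in> verts H" if "x \<in> verts G" for x
    proof (cases "x \<in> A")
      case True
      then show ?thesis using FA H(1) by auto
    next
      case False
      then have C: "comp_off A G x \<in> comps_off A G" using that comp_off_in_comps[of x G A] by simp
      show ?thesis using FC[OF C, of x] emb_overD(2)[OF f[OF C], of x] by simp
    qed
  qed
  with FC that show ?thesis by blast
qed

text \<open>Different components of \<open>H\<close> are disjoint and nonadjacent, so an injective
  assignment of components separates the images automatically.\<close>

lemma emb_over_glue_comps:
  assumes G: "rooted A G" and H: "rooted A H" and ag: "agree_on A G H"
    and t: "inj_on t (comps_off A G)" "\<And>C. C \<in> comps_off A G \<Longrightarrow> t C \<in> comps_off A H"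
    and f: "\<And>C. C \<in> comps_off A G \<Longrightarrow> emb_over s A (piece A G C) (piece A H (t C)) (f C)"
  obtains F where "emb_over s A G H F" "\<And>C x. C \<in> comps_off A G \<Longrightarrow> x \<in> C \<union> A \<Longrightarrow> F x = f C x"
proof -
  have sG: "simple_graph G" and sH: "simple_graph H" "A \<subseteq> verts H"
    using G H by (simp_all add: rooted_def)
  have im: "f C x \<in> t C" if C: "C \<in> comps_off A G" and x: "x \<in> C" for C x
  proof -
    have "f C x \<in> t C \<union> A" using emb_overD(2)[OF f[OF C], of x] x by simp
    moreover have "f C x \<notin> A"
      using emb_over_off_root[OF f[OF C], of x] x comps_off_subset[OF sG C] by auto
    ultimately show ?thesis by simp
  qed
  have sub: "t C \<union> A \<subseteq> verts H" if "C \<in> comps_off A G" for C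
    using comps_off_subset[OF sH(1) t(2)[OF that]] sH(2) by auto
  have f': "emb_over s A (piece A G C) H (f C)" if C: "C \<in> comps_off A G" for C
    using emb_over_comp[OF f[OF C] emb_over_sub[OF sub[OF C]]] by simp
  have "f C x \<noteq> f D y \<and> (s \<longrightarrow> \<not> adj H (f C x) (f D y))"
    if "C \<in> comps_off A G" "D \<in> comps_off A G" "C \<noteq> D" "x \<in> C" "y \<in> D" for C D x y
  proof -
    have "t C \<noteq> t D" using t(1) that by (metis inj_onD)
    then show ?thesis using im that comps_off_disjoint comps_off_adj[OF sH(1)] t(2) by metis
  qed
  from emb_over_glue[OF G sH(2) ag f' this] that show ?thesis by blast
qed

lemma embeds_of_comps:
  assumes "rooted A G" "rooted A H" "agree_on A G H"
    and "inj_on t (comps_off A G)" "\<And>C. C \<in> comps_off A G \<Longrightarrow> t C \<in> comps_off A H"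
    and "\<And>C. C \<in> comps_off A G \<Longrightarrow> embeds s A (piece A G C) (piece A H (t C))"
  shows "embeds s A G H"
proof -
  define f where "f C = (SOME f. emb_over s A (piece A G C) (piece A H (t C)) f)" for C
  have "emb_over s A (piece A G C) (piece A H (t C)) (f C)" if "C \<in> comps_off A G" for C
    using assms(6)[OF that] unfolding f_def embeds_def by (rule someI_ex)
  from emb_over_glue_comps[OF assms(1-5) this] show ?thesis unfolding embeds_def by metis
qed

lemma iso_over_of_comps:
  assumes G: "rooted A G" and H: "rooted A H" and ag: "agree_on A G H"
    and t: "bij_betw t (comps_off A G) (comps_off A H)"
    and iso: "\<And>C. C \<in> comps_off A G \<Longrightarrow> iso_over A (piece A G C) (piece A H (t C))"
  shows "iso_over A G H"
proof -
  define f where "f C = (SOME f. emb_over True A (piece A G C) (piece A H (t C)) f \<and>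
    f ` (C \<union> A) = t C \<union> A)" for C
  have f: "emb_over True A (piece A G C) (piece A H (t C)) (f C) \<and> f C ` (C \<union> A) = t C \<union> A"
    if "C \<in> comps_off A G" for C
    using iso[OF that] unfolding f_def iso_over_def verts_induced by (rule someI_ex)
  have tt: "t C \<in> comps_off A H" if "C \<in> comps_off A G" for C using t that by (metis bij_betwE)
  obtain F where F: "emb_over True A G H F"
    and FC: "\<And>C x. C \<in> comps_off A G \<Longrightarrow> x \<in> C \<union> A \<Longrightarrow> F x = f C x"
    using emb_over_glue_comps[OF G H ag bij_betw_imp_inj_on[OF t] tt conjunct1[OF f]] by metis
  have "verts H \<subseteq> F ` verts G"
  proof
    fix y assume y: "y \<in> verts H"
    show "y \<in> F ` verts G"
    proof (cases "y \<in> A")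
      case True
      then show ?thesis using emb_overD(3)[OF F] G unfolding rooted_def by (metis image_eqI subsetD)
    next
      case False
      then have "comp_off A H y \<in> comps_off A H" using y comp_off_in_comps[of y H A] by simp
      then obtain C where C: "C \<in> comps_off A G" "t C = comp_off A H y"
        using t unfolding bij_betw_def by (metis imageE)
      then have "y \<in> f C ` (C \<union> A)" using f[OF C(1)] by simp
      then obtain x where x: "x \<in> C \<union> A" "y = f C x" by (rule imageE)
      then have "x \<in> verts G" using G C(1) comps_off_subset unfolding rooted_def by fast
      then show ?thesis using FC[OF C(1) x(1)] x(2) by (metis imageI)
    qed
  qed
  then have "F ` verts G = verts H" using emb_overD(2)[OF F] by auto
  with F show ?thesis unfolding iso_over_def by metis
qed

lemma iso_over_comps:
  assumes G: "rooted A G" and H: "rooted A H" and iso: "iso_over A G H"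
  obtains t where "bij_betw t (comps_off A G) (comps_off A H)"
    "\<And>C. C \<in> comps_off A G \<Longrightarrow> iso_over A (piece A G C) (piece A H (t C))"
proof -
  have sG: "simple_graph G" "A \<subseteq> verts G" and sH: "simple_graph H" "A \<subseteq> verts H"
    using G H by (simp_all add: rooted_def)
  obtain f where f: "emb_over True A G H f" and sur: "f ` verts G = verts H"
    using iso unfolding iso_over_def by metis
  note D = emb_overD[OF f]
  have sub: "C \<subseteq> verts G" if "C \<in> comps_off A G" for C using comps_off_subset[OF sG(1) that] by auto
  have "comps_off A H = image f ` comps_off A G"
  proof (rule comps_offI[OF sH(1)])
    have "\<Union> (image f ` comps_off A G) = f ` (verts G - A)"
      unfolding Union_comps_off[OF sG(1), symmetric] by blast
    also have "\<dots> = f ` verts G - f ` A"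
      using D(1) sG(2) by (simp add: inj_on_image_set_diff)
    also have "f ` A = A" using D(3) by simp
    finally show "\<Union> (image f ` comps_off A G) = verts H - A" using sur by simp
    show "{} \<notin> image f ` comps_off A G" using comps_off_ne by fastforce
    fix C' x' y' assume "C' \<in> image f ` comps_off A G" "x' \<in> C'"
    then obtain C x where C: "C \<in> comps_off A G" "C' = f ` C" "x \<in> C" "x' = f x" by blast
    have xv: "x \<in> verts G - A" using comps_off_subset[OF sG(1) C(1)] C(3) by auto
    show "reach_off A H x' y'" if y: "y' \<in> C'"
    proof -
      obtain y where "y \<in> C" "y' = f y" using y C(2) by blast
      then show ?thesis using emb_over_reach[OF f sG comps_off_reach[OF C(1,3)] xv] C(4) by simp
    qed
    show "y' \<in> C'" if y: "adj H x' y'" "y' \<notin> A"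
    proof -
      have "y' \<in> verts H" using simple_graph_adjD[OF sH(1) y(1)] by simp
      then obtain z where z: "z \<in> verts G" "y' = f z" using sur by blast
      have "z \<notin> A" using z(2) y(2) D(3) by auto
      moreover have "adj G x z" using D(5)[of x z] z xv y(1) C(4) by simp
      ultimately have "z \<in> C"
        using comps_off_closed[OF C(1,3) reach_off_step] xv by auto
      then show ?thesis using z(2) C(2) by simp
    qed
  qed
  moreover have "inj_on (image f) (comps_off A G)"
    using sub D(1) by (auto intro!: inj_onI simp: inj_on_image_eq_iff)
  ultimately have "bij_betw (image f) (comps_off A G) (comps_off A H)"
    by (simp add: bij_betw_def)
  moreover have "iso_over A (piece A G C) (piece A H (f ` C))" if C: "C \<in> comps_off A G" for C
  proof -
    have im: "f ` (C \<union> A) = f ` C \<union> A" using D(3) by (simp add: image_Un)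
    have "emb_over True A (piece A G C) (piece A H (f ` C)) f"
      by (rule emb_over_restrict[OF f]) (use sub[OF C] sG(2) im in auto)
    with im show ?thesis unfolding iso_over_def verts_induced by metis
  qed
  ultimately show ?thesis by (rule that)
qed

text \<open>Disjoint copies of a family of pieces inside \<open>H\<close> span a subgraph of \<open>H\<close> with exactly
  these pieces; this replaces disjoint unions, which need not exist inside the vertex type.\<close>

lemma realize_family:
  fixes D :: "'i \<Rightarrow> 'a graph"
  assumes H: "rooted A H"
    and D: "\<And>i. i \<in> I \<Longrightarrow> rooted A (D i)" "\<And>i. i \<in> I \<Longrightarrow> connected_off A (D i)"
      "\<And>i. i \<in> I \<Longrightarrow> agree_on A (D i) H"
    and e: "\<And>i. i \<in> I \<Longrightarrow> emb_over s A (D i) H (e i)"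
    and dis: "\<And>i j x y. i \<in> I \<Longrightarrow> j \<in> I \<Longrightarrow> i \<noteq> j \<Longrightarrow> x \<in> verts (D i) - A \<Longrightarrow> y \<in> verts (D j) - A \<Longrightarrow>
      e i x \<noteq> e j y \<and> (s \<longrightarrow> \<not> adj H (e i x) (e j y))"
  obtains R b where "rooted A R" "embeds s A R H" "agree_on A R H" "bij_betw b I (comps_off A R)"
    "\<And>i. i \<in> I \<Longrightarrow> iso_over A (D i) (piece A R (b i))"
proof -
  have sH: "simple_graph H" "A \<subseteq> verts H" using H by (simp_all add: rooted_def)
  have sD: "simple_graph (D i)" "A \<subseteq> verts (D i)" if "i \<in> I" for i
    using D(1)[OF that] by (simp_all add: rooted_def)
  \<comment> \<open>Only images of edges are taken: in the weak case \<open>H\<close> may have more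
    edges between image vertices, and these must not enter \<open>R\<close>. The edges of
    \<open>H\<close> inside \<open>A\<close> are listed separately, so that \<open>R\<close> agrees
    with \<open>H\<close> there even for an empty index set.\<close>
  define P where "P u v \<longleftrightarrow> (u \<in> A \<and> v \<in> A \<and> adj H u v) \<or>
    (\<exists>i\<in>I. \<exists>x\<in>verts (D i). \<exists>y\<in>verts (D i). adj (D i) x y \<and> u = e i x \<and> v = e i y)" for u v
  have Psym: "P v u" if "P u v" for u v
    using that unfolding P_def by (metis adj_commute)
  define R where "R = \<lparr>verts = A \<union> (\<Union>i\<in>I. e i ` verts (D i)), edges = {{u, v} | u v. P u v}\<rparr>"
  have vR: "verts R = A \<union> (\<Union>i\<in>I. e i ` verts (D i))" by (simp add: R_def)
  have aR: "adj R u v \<longleftrightarrow> P u v" for u v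
    using Psym by (auto simp: R_def doubleton_eq_iff)
  have offA: "e i x \<in> A \<longleftrightarrow> x \<in> A" if "i \<in> I" "x \<in> verts (D i)" for i x
    using emb_over_off_root[OF e sD(2)] that by simp
  have fixA: "e i a = a" if "i \<in> I" "a \<in> A" for i a using emb_overD(3)[OF e] that by simp
  have same: "i = j \<and> x = y" if "i \<in> I" "j \<in> I" "x \<in> verts (D i) - A" "y \<in> verts (D j)" "e i x = e j y" for i j x y
  proof -
    have "e j y \<notin> A" using offA[OF that(1), of x] that(3,5) by simp
    then have "y \<notin> A" using offA[OF that(2,4)] by simp
    then have "i = j" using dis[of i j x y] that by auto
    then show ?thesis using emb_overD(1)[OF e[OF that(1)]] that by (metis DiffD1 inj_onD)
  qed
  have eiR: "emb_over True A (D i) R (e i)" if i: "i \<in> I" for i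
  proof (rule emb_overI)
    note E = emb_overD[OF e[OF i]]
    show "inj_on (e i) (verts (D i))" by (rule E(1))
    show "e i x \<in> verts R" if "x \<in> verts (D i)" for x using that i vR by auto
    show "e i a = a" if "a \<in> A" for a using E(3)[OF that] .
    show "adj R (e i u) (e i v)" if "u \<in> verts (D i)" "v \<in> verts (D i)" "adj (D i) u v" for u v
      unfolding aR P_def using i that by blast
    show "adj (D i) u v" if uv: "u \<in> verts (D i)" "v \<in> verts (D i)" and a: "adj R (e i u) (e i v)" for u v
    proof (cases "u \<in> A \<and> v \<in> A")
      case True
      \<comment> \<open>An edge between two vertices of \<open>A\<close> may stem from
        \<open>H\<close> or from any other piece; all of these agree on \<open>A\<close>.\<close>
      from a consider "adj H u v" | j x y where "j \<in> I" "x \<in> verts (D j)" "y \<in> verts (D j)" "adj (D j) x y" "e i u = e j x" "e i v = e j y"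
        unfolding aR P_def using True E(3) by auto
      then show ?thesis
      proof cases
        case 1
        then show ?thesis using D(3)[OF i] True by (simp add: agree_on_def)
      next
        case 2
        have "x \<in> A" "y \<in> A" using offA 2 True E(3) by metis+
        then have "x = u" "y = v" using fixA 2 True i by metis+
        then show ?thesis using D(3)[OF i] D(3)[OF 2(1)] True 2 by (simp add: agree_on_def)
      qed
    next
      case False
      then have "e i u \<notin> A \<or> e i v \<notin> A" using offA[OF i] uv by simp
      then obtain j x y where j: "j \<in> I" "x \<in> verts (D j)" "y \<in> verts (D j)" "adj (D j) x y" "e i u = e j x" "e i v = e j y"
        using a unfolding aR P_def by auto
      have "j = i" using False uv same[OF i j(1), of u x] same[OF i j(1), of v y] j by auto
      then have "x = u" "y = v" using E(1) j uv by (metis inj_onD)+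
      then show ?thesis using j \<open>j = i\<close> by simp
    qed
  qed
  have RH: "emb_over s A R H id"
  proof (rule emb_overI)
    show "id x \<in> verts H" if "x \<in> verts R" for x
      using that sH(2) emb_overD(2)[OF e] unfolding vR by auto
    show "adj H (id u) (id v)" if "adj R u v" for u v
      using that emb_overD(4)[OF e] unfolding aR P_def by auto
    show "adj R u v" if s and uv: "u \<in> verts R" "v \<in> verts R" and a: "adj H (id u) (id v)" for u v
    proof -
      have a': "adj H u v" using a by simp
      consider "u \<in> A" "v \<in> A" | i x y where "i \<in> I" "x \<in> verts (D i)" "y \<in> verts (D i)" "u = e i x" "v = e i y"
        | i j x y where "i \<in> I" "j \<in> I" "i \<noteq> j" "x \<in> verts (D i) - A" "y \<in> verts (D j) - A" "u = e i x" "v = e j y"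
      proof (cases "u \<in> A")
        case True
        show ?thesis
        proof (cases "v \<in> A")
          case vA: False
          then obtain i y where "i \<in> I" "y \<in> verts (D i)" "v = e i y" using uv(2) vR by auto
          then show ?thesis using that(2)[of i u y] True fixA sD(2) by fastforce
        qed (use True that(1) in simp)
      next
        case False
        then obtain i x where i: "i \<in> I" "x \<in> verts (D i)" "u = e i x" using uv(1) vR by auto
        show ?thesis
        proof (cases "v \<in> A")
          case True
          then show ?thesis using that(2)[of i x v] i fixA sD(2) by fastforce
        next
          case vA: False
          then obtain j y where j: "j \<in> I" "y \<in> verts (D j)" "v = e j y" using uv(2) vR by auto
          have "x \<notin> A" "y \<notin> A" using offA i j False vA by auto
          then show ?thesis using that(2)[of i x y] that(3)[of i j x y] i j by (cases "i = j") auto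
        qed
      qed
      then show ?thesis
      proof cases
        case 1
        then show ?thesis using a' unfolding aR P_def by simp
      next
        case 2
        then have "adj (D i) x y" using emb_overD(5)[OF e[OF 2(1)] \<open>s\<close> 2(2,3)] a' by simp
        then show ?thesis using 2 unfolding aR P_def by blast
      next
        case 3
        then show ?thesis using dis[OF 3(1-5)] \<open>s\<close> a' by simp
      qed
    qed
  qed auto
  have sR: "simple_graph R"
  proof -
    have "u \<in> verts R \<and> v \<in> verts R \<and> u \<noteq> v" if "P u v" for u v
    proof -
      have "adj H u v" using that emb_overD(4)[OF e] unfolding P_def by auto
      then have "u \<noteq> v" using simple_graph_adjD[OF sH(1)] by simp
      moreover have "u \<in> verts R" "v \<in> verts R" using that unfolding P_def vR by auto
      ultimately show ?thesis by simp
    qed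
    then have "{{u, v} | u v. P u v} \<subseteq> {{u, v} | u v. u \<in> verts R \<and> v \<in> verts R \<and> u \<noteq> v}" by blast
    then show ?thesis unfolding simple_graph_def R_def by simp
  qed
  have rR: "rooted A R" using sR vR by (simp add: rooted_def)
  have agR: "agree_on A R H"
    unfolding agree_on_def
  proof (intro ballI)
    fix a b assume ab: "a \<in> A" "b \<in> A"
    have "adj H a b" if "adj R a b" using that emb_overD(4)[OF e] unfolding aR P_def by auto
    then show "adj R a b \<longleftrightarrow> adj H a b" using ab aR P_def by auto
  qed
  define b where "b i = e i ` (verts (D i) - A)" for i
  have bA: "b i \<union> A = e i ` verts (D i)" if "i \<in> I" for i
    using sD(2)[OF that] fixA[OF that] unfolding b_def by force
  have "comps_off A R = b ` I"
  proof (rule comps_offI[OF sR])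
    show "\<Union> (b ` I) = verts R - A" using offA unfolding vR b_def by auto
    show "{} \<notin> b ` I" using connected_offD(1)[OF D(2)] unfolding b_def by auto
    fix C u v assume "C \<in> b ` I" "u \<in> C"
    then obtain i x where i: "i \<in> I" "C = b i" "x \<in> verts (D i) - A" "u = e i x" unfolding b_def by auto
    show "reach_off A R u v" if v: "v \<in> C"
    proof -
      obtain y where "y \<in> verts (D i) - A" "v = e i y" using v i(2) unfolding b_def by auto
      then show ?thesis
        using emb_over_reach[OF eiR[OF i(1)] sD[OF i(1)] connected_offD(2)[OF D(2)[OF i(1)] i(3)] i(3)] i(4) by simp
    qed
    show "v \<in> C" if v: "adj R u v" "v \<notin> A"
    proof -
      have "u \<notin> A" using offA i by simp
      then obtain j x' y where j: "j \<in> I" "x' \<in> verts (D j)" "y \<in> verts (D j)" "u = e j x'" "v = e j y"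
        using v(1) unfolding aR P_def by auto
      have "j = i" using same[OF i(1) j(1) i(3) j(2)] i(4) j(4) by simp
      moreover have "y \<notin> A" using offA[OF j(1,3)] v(2) j(5) by simp
      ultimately show ?thesis using j i unfolding b_def by simp
    qed
  qed
  moreover have "inj_on b I"
  proof (rule inj_onI)
    fix i j assume ij: "i \<in> I" "j \<in> I" "b i = b j"
    obtain x where x: "x \<in> verts (D i) - A" using connected_offD(1)[OF D(2)[OF ij(1)]] by blast
    then have "e i x \<in> b j" using ij(3) unfolding b_def by blast
    then obtain y where "y \<in> verts (D j)" "e i x = e j y" unfolding b_def by blast
    then show "i = j" using same[OF ij(1,2) x] by simp
  qed
  ultimately have bij: "bij_betw b I (comps_off A R)" by (simp add: bij_betw_def)
  have "iso_over A (D i) (piece A R (b i))" if i: "i \<in> I" for i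
  proof -
    have "emb_over True A (induced (D i) (verts (D i))) (piece A R (b i)) (e i)"
      by (rule emb_over_restrict[OF eiR[OF i]]) (use bA[OF i] in auto)
    then have "emb_over True A (D i) (piece A R (b i)) (e i)" using induced_verts[OF sD(1)[OF i]] by simp
    then show ?thesis using bA[OF i] unfolding iso_over_def verts_induced by metis
  qed
  moreover have "embeds s A R H" using RH unfolding embeds_def by metis
  ultimately show ?thesis using that[OF rR _ agR bij] by simp
qed

section \<open>Graphs whose components are understood\<close>

text \<open>Turns equimorphism into equality of sets, so that components can be sorted by the value
  of a function.\<close>

definition equi_class :: "bool \<Rightarrow> 'a set \<Rightarrow> 'a graph \<Rightarrow> 'a graph set" where
  "equi_class s A T = {T'. equimorphic s A T T'}"

definition class_comps :: "bool \<Rightarrow> 'a set \<Rightarrow> 'a graph \<Rightarrow> 'a graph set \<Rightarrow> 'a set set" where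
  "class_comps s A G q = {C \<in> comps_off A G. equi_class s A (piece A G C) = q}"

text \<open>One term may be isomorphic to \<open>G\<close> itself; it is discarded only at the end.
  Unlike being a twin of \<open>G\<close>, the property depends only on the equimorphism class of
  \<open>G\<close>, so it can be moved between \<open>G\<close> and \<open>H\<close>.\<close>

definition many_equimorphic :: "bool \<Rightarrow> 'a set \<Rightarrow> 'a graph \<Rightarrow> ('a graph \<Rightarrow> bool) \<Rightarrow> bool" where
  "many_equimorphic s A G Q \<longleftrightarrow> (\<exists>R :: nat \<Rightarrow> 'a graph.
     (\<forall>n. rooted A (R n) \<and> equimorphic s A G (R n) \<and> Q (R n)) \<and>
     (\<forall>m n. m \<noteq> n \<longrightarrow> \<not> iso_over A (R m) (R n)))"

text \<open>\<open>P\<close> will express attachment to the kernel, from which connectedness of the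
  whole graph is recovered; where connectedness is not at stake, \<open>P\<close> is trivially
  true.\<close>

definition all_pieces :: "'a set \<Rightarrow> ('a graph \<Rightarrow> bool) \<Rightarrow> 'a graph \<Rightarrow> bool" where
  "all_pieces A P G \<longleftrightarrow> (\<forall>C\<in>comps_off A G. P (piece A G C))"

text \<open>Weak embeddings without fixed vertices are the most permissive kind, so excluding
  disjoint ones excludes them for both values of \<open>s\<close> and every
  \<open>A\<close>.\<close>

definition disjoint_self_embs :: "'a graph \<Rightarrow> bool" where
  "disjoint_self_embs G \<longleftrightarrow> (\<exists>f g. emb_over False {} G G f \<and> emb_over False {} G G g \<and>
     f ` verts G \<inter> g ` verts G = {})"

section \<open>Equimorphism classes of pieces\<close>

lemma equi_class_eq_iff: "equi_class s A T = equi_class s A T' \<longleftrightarrow> equimorphic s A T T'"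
proof
  assume "equi_class s A T = equi_class s A T'"
  then have "T' \<in> equi_class s A T" by (simp add: equi_class_def equimorphic_refl)
  then show "equimorphic s A T T'" by (simp add: equi_class_def)
next
  assume e: "equimorphic s A T T'"
  have "equimorphic s A T X \<longleftrightarrow> equimorphic s A T' X" for X
    using equimorphic_trans[OF e, of X] equimorphic_trans[OF equimorphic_sym[OF e], of X] by (rule iffI[rotated])
  then show "equi_class s A T = equi_class s A T'" by (simp add: equi_class_def)
qed

lemma iso_over_equi_class:
  "iso_over A T T' \<Longrightarrow> A \<subseteq> verts T \<Longrightarrow> equi_class s A T = equi_class s A T'"
  by (simp add: equi_class_eq_iff iso_over_equimorphic)

lemma many_equimorphic_cong:
  assumes "equimorphic s A G H" "many_equimorphic s A H Q"
  shows "many_equimorphic s A G Q"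
  using assms equimorphic_trans unfolding many_equimorphic_def by metis

lemma class_comps_iso:
  assumes G: "rooted A G" and H: "rooted A H" and iso: "iso_over A G H"
  obtains t where "bij_betw t (class_comps s A G q) (class_comps s A H q)"
proof -
  obtain t where t: "bij_betw t (comps_off A G) (comps_off A H)"
    and i: "\<And>C. C \<in> comps_off A G \<Longrightarrow> iso_over A (piece A G C) (piece A H (t C))"
    using iso_over_comps[OF assms] by blast
  have c: "equi_class s A (piece A G C) = equi_class s A (piece A H (t C))" if "C \<in> comps_off A G" for C
    using iso_over_equi_class[OF i[OF that]] by simp
  have "t ` class_comps s A G q = class_comps s A H q"
  proof (intro subset_antisym subsetI)
    fix D assume "D \<in> t ` class_comps s A G q"
    then show "D \<in> class_comps s A H q"
      using c bij_betwE[OF t] unfolding class_comps_def by auto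
  next
    fix D assume D: "D \<in> class_comps s A H q"
    then obtain C where "C \<in> comps_off A G" "D = t C"
      using t unfolding class_comps_def bij_betw_def by auto
    then show "D \<in> t ` class_comps s A G q" using D c unfolding class_comps_def by auto
  qed
  moreover have "inj_on t (class_comps s A G q)"
    using t unfolding bij_betw_def class_comps_def by (auto intro: inj_on_subset)
  ultimately show ?thesis using that unfolding bij_betw_def by blast
qed

text \<open>Class sizes are the invariant by which the graphs obtained from adding or removing
  components are told apart.\<close>

lemma class_comps_card_iso:
  assumes "rooted A G" "rooted A H" "iso_over A G H"
  shows "card (class_comps s A G q) = card (class_comps s A H q)"
  using class_comps_iso[OF assms] bij_betw_same_card by metis

lemma bij_betw_classwise:
  assumes "\<And>q. \<exists>b. bij_betw b {x \<in> I. k x = q} {y \<in> J. l y = q}"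
  obtains b where "bij_betw b I J" "\<And>x. x \<in> I \<Longrightarrow> l (b x) = k x"
proof -
  obtain B where B: "\<And>q. bij_betw (B q) {x \<in> I. k x = q} {y \<in> J. l y = q}" using assms by metis
  define b where "b x = B (k x) x" for x
  have b: "b x \<in> J \<and> l (b x) = k x" if "x \<in> I" for x
    using bij_betwE[OF B[of "k x"]] that unfolding b_def by auto
  have "inj_on b I"
  proof (rule inj_onI)
    fix x y assume xy: "x \<in> I" "y \<in> I" "b x = b y"
    then have "k x = k y" using b by metis
    then show "x = y" using xy bij_betw_imp_inj_on[OF B[of "k x"]] unfolding b_def inj_on_def by auto
  qed
  moreover have "b ` I = J"
  proof (intro subset_antisym subsetI)
    fix y assume "y \<in> J"
    then have "y \<in> B (l y) ` {x \<in> I. k x = l y}" using B[of "l y"] unfolding bij_betw_def by simp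
    then obtain x where x: "x \<in> I" "k x = l y" "y = B (l y) x" by auto
    then have "y = b x" by (simp add: b_def)
    with x(1) show "y \<in> b ` I" by simp
  qed (use b in auto)
  ultimately show ?thesis using that b unfolding bij_betw_def by blast
qed

text \<open>\<open>F\<close> sends a component in \<open>M\<close> into \<open>S\<close> by \<beta>
  and onward by \<psi>, moves components in \<open>Y\<close> by \<psi>, and leaves all others in
  place. Whatever moves lands in \<open>Y\<close>, and whatever stays lies outside
  \<open>M \<union> Y\<close>; so the two kinds do not collide and \<open>M\<close> is
  vacated.\<close>

lemma shift_along_orbits:
  assumes H: "rooted A H" and psi: "emb_over s A H H \<psi>"
    and S: "S \<subseteq> comps_off A H" and Y: "Y \<subseteq> comps_off A H"
    and pS: "\<And>C. C \<in> S \<Longrightarrow> comp_map A H \<psi> C \<in> Y" and pY: "\<And>C. C \<in> Y \<Longrightarrow> comp_map A H \<psi> C \<in> Y"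
    and dis: "S \<inter> Y = {}" "M \<inter> Y = {}"
    and \<beta>: "inj_on \<beta> M" "\<And>C. C \<in> M \<Longrightarrow> \<beta> C \<in> S"
    and emb: "\<And>C. C \<in> M \<Longrightarrow> embeds s A (piece A H C) (piece A H (\<beta> C))"
  obtains F where "emb_over s A H H F"
    "\<And>x. x \<in> verts H - A \<Longrightarrow> comp_off A H (F x) \<in> comps_off A H - M"
proof -
  have sH: "simple_graph H" "A \<subseteq> verts H" using H by (simp_all add: rooted_def)
  define e where "e C = (SOME f. emb_over s A (piece A H C) (piece A H (\<beta> C)) f)" for C
  have e: "emb_over s A (piece A H C) (piece A H (\<beta> C)) (e C)" if "C \<in> M" for C
    using emb[OF that] unfolding e_def embeds_def by (rule someI_ex)
  define src where "src C = (if C \<in> M then \<beta> C else C)" for C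
  define h where "h C = (if C \<in> M then e C else id)" for C
  define f where "f C = (if C \<in> M \<union> Y then \<psi> \<circ> h C else id)" for C
  define m where "m C = (if C \<in> M \<union> Y then comp_map A H \<psi> (src C) else C)" for C
  have src: "src C \<in> comps_off A H" if "C \<in> comps_off A H" for C
    using that \<beta>(2) S unfolding src_def by auto
  have srcSY: "src C \<in> S \<union> Y" if "C \<in> M \<union> Y" for C using that \<beta>(2) unfolding src_def by auto
  have src_inj: "C = D" if "C \<in> M \<union> Y" "D \<in> M \<union> Y" "src C = src D" for C D
    using that \<beta> dis unfolding src_def by (auto simp: inj_on_def split: if_splits)
  have h: "emb_over s A (piece A H C) (piece A H (src C)) (h C)" for C
    using e[of C] emb_over_id unfolding h_def src_def by auto
  have himg: "h C x \<in> src C" if "C \<in> comps_off A H" "x \<in> C" for C x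
  proof -
    have "h C x \<in> src C \<union> A" using emb_overD(2)[OF h, of x C] that by simp
    moreover have "h C x \<notin> A"
      using emb_over_off_root[OF h, of C x] that comps_off_subset[OF sH(1) that(1)] by auto
    ultimately show ?thesis by simp
  qed
  have sub: "src C \<union> A \<subseteq> verts H" if "C \<in> comps_off A H" for C
    using comps_off_subset[OF sH(1) src[OF that]] sH(2) by auto
  have f: "emb_over s A (piece A H C) H (f C)" if C: "C \<in> comps_off A H" for C
  proof (cases "C \<in> M \<union> Y")
    case True
    have "emb_over s A (piece A H C) H (\<psi> \<circ> (id \<circ> h C))"
      by (rule emb_over_comp[OF emb_over_comp[OF h emb_over_sub[OF sub[OF C]]] psi])
    then show ?thesis using True unfolding f_def by simp
  next
    case False
    then have "src C = C" by (simp add: src_def)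
    then show ?thesis using False emb_over_sub[OF sub[OF C]] unfolding f_def by simp
  qed
  have fm: "f C x \<in> m C" if C: "C \<in> comps_off A H" and x: "x \<in> C" for C x
    using himg[OF that] comp_map(2)[OF psi H src[OF C]] x unfolding f_def m_def by auto
  have m: "m C \<in> comps_off A H" if C: "C \<in> comps_off A H" for C
    using comp_map(1)[OF psi H src[OF C]] C unfolding m_def by simp
  have mY: "m C \<in> Y" if "C \<in> M \<union> Y" for C using that srcSY[OF that] pS pY unfolding m_def by auto
  have mN: "m C = C" if "C \<notin> M \<union> Y" for C using that unfolding m_def by simp
  have "f C x \<noteq> f D y \<and> (s \<longrightarrow> \<not> adj H (f C x) (f D y))"
    if CD: "C \<in> comps_off A H" "D \<in> comps_off A H" "C \<noteq> D" and xy: "x \<in> C" "y \<in> D" for C D x y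
  proof (cases "m C = m D")
    case False
    then show ?thesis
      using fm CD xy m comps_off_disjoint comps_off_adj[OF sH(1)] by metis
  next
    case True
    \<comment> \<open>An unmoved component lies outside \<open>Y\<close>, so only moved ones can
      share a target. \<psi> need not be injective on components, but the sources are distinct and
      its injectivity on vertices keeps the images apart.\<close>
    have W: "C \<in> M \<union> Y" "D \<in> M \<union> Y" using True mY mN CD(3) by (metis UnCI)+
    have ne: "src C \<noteq> src D" using src_inj[OF W] CD(3) by auto
    define x' y' where "x' = h C x" and "y' = h D y"
    have x': "x' \<in> src C" "y' \<in> src D" unfolding x'_def y'_def using himg CD xy by auto
    then have v: "x' \<in> verts H" "y' \<in> verts H" using sub CD by auto
    have "x' \<noteq> y'" using ne x' comps_off_disjoint[OF src[OF CD(1)] src[OF CD(2)]] by auto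
    then have "\<psi> x' \<noteq> \<psi> y'" using emb_overD(1)[OF psi] v by (metis inj_onD)
    moreover have "\<not> adj H (\<psi> x') (\<psi> y')" if s
      using emb_overD(5)[OF psi that v] comps_off_adj[OF sH(1) src[OF CD(1)] src[OF CD(2)] x'] ne by auto
    ultimately show ?thesis using W unfolding f_def x'_def y'_def by simp
  qed
  then obtain F where F: "emb_over s A H H F" and FC: "\<And>C x. C \<in> comps_off A H \<Longrightarrow> x \<in> C \<union> A \<Longrightarrow> F x = f C x"
    using emb_over_glue[OF H sH(2) _ f] unfolding agree_on_def by metis
  have "comp_off A H (F x) \<in> comps_off A H - M" if x: "x \<in> verts H - A" for x
  proof -
    let ?C = "comp_off A H x"
    have C: "?C \<in> comps_off A H" using comp_off_in_comps[OF x] .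
    have "F x \<in> m ?C" using FC[OF C, of x] fm[OF C, of x] by simp
    then have "comp_off A H (F x) = m ?C" using comps_off_eq_comp_off[OF m[OF C]] by metis
    moreover have "m ?C \<notin> M" using mY mN dis(2) by (metis UnCI disjoint_iff)
    ultimately show ?thesis using m[OF C] by simp
  qed
  with F that show ?thesis by blast
qed

text \<open>The components in \<open>S\<close> are moved by \<open>g\<close> to a strictly larger class, so their forward orbits
  under \<open>f \<circ> g\<close> never return to \<open>q\<close>. Two components that stay in \<open>q\<close> cannot share an image, as this
  would yield disjoint self-embeddings.\<close>

lemma exits:
  fixes q :: "'a graph set"
  assumes G: "rooted A G" and H: "rooted A H"
    and f: "emb_over s A G H f" and g: "emb_over s A H G g"
    and nd: "\<And>C. C \<in> comps_off A G \<Longrightarrow> \<not> disjoint_self_embs (induced G C)"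
  defines "S \<equiv> {C \<in> class_comps s A H q. comp_map A G g C \<notin> class_comps s A G q}"
  obtains Y where "inj_on (comp_map A G g) (class_comps s A H q - S)"
    "Y \<subseteq> comps_off A H" "\<And>C. C \<in> S \<Longrightarrow> comp_map A H (f \<circ> g) C \<in> Y"
    "\<And>C. C \<in> Y \<Longrightarrow> comp_map A H (f \<circ> g) C \<in> Y" "Y \<inter> class_comps s A H q = {}"
proof -
  have sG: "simple_graph G" "A \<subseteq> verts G" and sH: "simple_graph H" "A \<subseteq> verts H"
    using G H by (simp_all add: rooted_def)
  have fg: "emb_over s A H H (f \<circ> g)" using emb_over_comp[OF g f] .
  define p where "p = comp_map A H (f \<circ> g)"
  have p: "p C \<in> comps_off A H" if "C \<in> comps_off A H" for C
    using comp_map(1)[OF fg H that] unfolding p_def .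
  have pe: "embeds s A (piece A H C) (piece A H (p C))" if "C \<in> comps_off A H" for C
    using comp_map(3)[OF fg H that] unfolding p_def embeds_def by metis
  have SH: "C \<in> comps_off A H" if "C \<in> S" for C using that unfolding S_def class_comps_def by simp
  have inj: "inj_on (comp_map A G g) (class_comps s A H q - S)"
  proof (rule inj_onI, rule ccontr)
    fix C C' assume C: "C \<in> class_comps s A H q - S" and C': "C' \<in> class_comps s A H q - S"
      and eq: "comp_map A G g C = comp_map A G g C'" and ne: "C \<noteq> C'"
    define D where "D = comp_map A G g C"
    have Cc: "C \<in> comps_off A H" "C' \<in> comps_off A H" using C C' unfolding class_comps_def by auto
    have Dq: "D \<in> class_comps s A G q" using C unfolding D_def S_def by simp
    then have D: "D \<in> comps_off A G" unfolding class_comps_def by simp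
    have "equimorphic s A (piece A G D) (piece A H C)" "equimorphic s A (piece A G D) (piece A H C')"
      using Dq C C' unfolding class_comps_def equi_class_eq_iff[symmetric] by auto
    then obtain a a' where a: "emb_over s A (piece A G D) (piece A H C) a"
      and a': "emb_over s A (piece A G D) (piece A H C') a'"
      unfolding equimorphic_def embeds_def by metis
    have DA: "D \<inter> A = {}" using comps_off_subset[OF sG(1) D] by auto
    have aC: "b x \<in> B" if b: "emb_over s A (piece A G D) (piece A H B) b" and x: "x \<in> D" for b B x
      using emb_overD(2)[OF b, of x] emb_over_off_root[OF b, of x] x DA by auto
    have self: "emb_over False {} (induced G D) (induced G D) (g \<circ> b)"
      if b: "emb_over s A (piece A G D) (piece A H B) b" and B: "B \<in> comps_off A H"
        and gB: "comp_map A G g B = D" for b B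
    proof -
      have "emb_over s A (piece A G D) (piece A G D) (g \<circ> b)"
        using emb_over_comp[OF b comp_map(3)[OF g H B]] gB by simp
      then have "emb_over s A (induced (piece A G D) D) (induced (piece A G D) D) (g \<circ> b)"
        by (rule emb_over_restrict) (use aC[OF b] comp_map(2)[OF g H B] gB in auto)
      then have "emb_over s A (induced G D) (induced G D) (g \<circ> b)" by (simp add: induced_induced)
      then show ?thesis by (rule emb_over_weaken) auto
    qed
    have "(g \<circ> a) ` D \<inter> (g \<circ> a') ` D = {}"
    proof (rule ccontr)
      assume "(g \<circ> a) ` D \<inter> (g \<circ> a') ` D \<noteq> {}"
      then obtain x y where xy: "x \<in> D" "y \<in> D" "g (a x) = g (a' y)" by auto
      have ac: "a x \<in> C" "a' y \<in> C'" using aC[OF a] aC[OF a'] xy by auto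
      then have "a x \<in> verts H" "a' y \<in> verts H" using comps_off_subset[OF sH(1)] Cc by auto
      then have "a x = a' y" using emb_overD(1)[OF g] xy(3) by (metis inj_onD)
      then show False using ac comps_off_disjoint[OF Cc] ne by simp
    qed
    then have "disjoint_self_embs (induced G D)"
      unfolding disjoint_self_embs_def verts_induced
      using self[OF a Cc(1)] self[OF a' Cc(2)] D_def eq by metis
    then show False using nd[OF D] by simp
  qed
  \<comment> \<open>\<open>Suc i\<close> starts the orbits after one step: \<open>S\<close> itself
    lies in the class \<open>q\<close>, which \<open>Y\<close> has to avoid.\<close>
  define Y where "Y = {(p ^^ Suc i) C | i C. C \<in> S}"
  have pi: "(p ^^ i) C \<in> comps_off A H \<and> embeds s A (piece A H C) (piece A H ((p ^^ i) C))"
    if "C \<in> comps_off A H" for i C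
    using that
  proof (induction i)
    case 0
    then show ?case by (simp add: embeds_refl)
  next
    case (Suc i)
    then show ?case using p pe embeds_trans by (metis funpow.simps(2) comp_apply)
  qed
  have YH: "Y \<subseteq> comps_off A H" using pi SH unfolding Y_def by blast
  have Y1: "p C \<in> Y" if "C \<in> S" for C
  proof -
    have "p C = (p ^^ Suc 0) C" by simp
    then show ?thesis using that unfolding Y_def by blast
  qed
  have Y2: "p C \<in> Y" if C: "C \<in> Y" for C
  proof -
    obtain i B where "C = (p ^^ Suc i) B" "B \<in> S" using C unfolding Y_def by blast
    then have "p C = (p ^^ Suc (Suc i)) B" by simp
    then show ?thesis using \<open>B \<in> S\<close> unfolding Y_def by blast
  qed
  have "D \<notin> class_comps s A H q" if D: "D \<in> Y" for D
  proof
    assume Dq: "D \<in> class_comps s A H q"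
    obtain i C where C: "D = (p ^^ i) (p C)" "C \<in> S"
      using D unfolding Y_def by (auto simp: funpow_swap1)
    have Cc: "C \<in> comps_off A H" and Cq: "C \<in> class_comps s A H q" using C(2) SH unfolding S_def by auto
    have gC: "comp_map A G g C \<in> comps_off A G" by (rule comp_map(1)[OF g H Cc])
    \<comment> \<open>The orbit of \<open>C\<close> passes through the component of \<open>G\<close>
      hit by \<open>g\<close>, which is thereby squeezed between \<open>C\<close> and
      \<open>D\<close>; with both of these in \<open>q\<close> it lies in \<open>q\<close> too,
      against \<open>C \<in> S\<close>.\<close>
    have "comp_map A H f (comp_map A G g C) = p C"
    proof -
      obtain x where x: "x \<in> C" using comps_off_ne[OF Cc] by auto
      then have "g x \<in> comp_map A G g C" "f (g x) \<in> p C"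
        using comp_map(2)[OF g H Cc] comp_map(2)[OF fg H Cc] unfolding p_def by auto
      then show ?thesis using comp_map_eq[OF f G gC p[OF Cc]] by simp
    qed
    then have "embeds s A (piece A G (comp_map A G g C)) (piece A H (p C))"
      using comp_map(3)[OF f G gC] unfolding embeds_def by metis
    moreover have "embeds s A (piece A H (p C)) (piece A H D)" using pi[OF p[OF Cc]] C(1) by simp
    moreover have "embeds s A (piece A H D) (piece A H C)"
      using Dq Cq unfolding class_comps_def equimorphic_def[symmetric]
      by (metis (mono_tags, lifting) equi_class_eq_iff equimorphic_def mem_Collect_eq)
    ultimately have "embeds s A (piece A G (comp_map A G g C)) (piece A H C)"
      using embeds_trans by metis
    moreover have "embeds s A (piece A H C) (piece A G (comp_map A G g C))"
      using comp_map(3)[OF g H Cc] unfolding embeds_def by metis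
    ultimately have "equimorphic s A (piece A G (comp_map A G g C)) (piece A H C)"
      by (simp add: equimorphic_def)
    then have "comp_map A G g C \<in> class_comps s A G q"
      using gC Cq unfolding class_comps_def equi_class_eq_iff[symmetric] by simp
    then show False using C(2) unfolding S_def by simp
  qed
  then have "Y \<inter> class_comps s A H q = {}" by auto
  from that[OF inj YH Y1[unfolded p_def] Y2[unfolded p_def] this] show ?thesis by blast
qed

section \<open>Changing the number of components in a class\<close>

unbundle cardinal_syntax

text \<open>Otherwise \<open>Q - N\<close> and \<open>Q \<inter> N\<close> would both have smaller
  cardinality than the infinite set \<open>Q\<close>, and so would their union, which is
  \<open>Q\<close>.\<close>

lemma infinite_split_inj:
  assumes "infinite Q" "\<not> (\<exists>i. inj_on i Q \<and> i ` Q \<subseteq> N)"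
  shows "\<exists>i. inj_on i Q \<and> i ` Q \<subseteq> Q - N"
proof (rule ccontr)
  assume "\<not> ?thesis"
  then have "|Q - N| <o |Q|"
    unfolding card_of_ordLeq by (metis card_of_Well_order not_ordLeq_iff_ordLess)
  moreover have "\<not> |Q| \<le>o |Q \<inter> N|"
    using assms(2) unfolding card_of_ordLeq[symmetric] by (metis inf.cobounded2 order_trans)
  then have "|Q \<inter> N| <o |Q|"
    by (metis card_of_Well_order not_ordLeq_iff_ordLess)
  ultimately have "|(Q - N) \<union> (Q \<inter> N)| <o |Q|"
    using card_of_Un_ordLess_infinite[OF assms(1)] by blast
  moreover have "(Q - N) \<union> (Q \<inter> N) = Q" by auto
  ultimately show False using ordLess_irreflexive by metis
qed

text \<open>The components that \<open>g\<close> keeps in \<open>q\<close> inject into the class of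
  \<open>G\<close>, so \<open>Q\<close> cannot be injected into them; by
  \<open>infinite_split_inj\<close> it injects into the leaving part \<open>S\<close>. Shifting then
  vacates all of \<open>Q\<close>, hence any part of \<open>Q\<close> may be kept, and keeping
  \<open>n\<close> components for every \<open>n\<close> gives the sequence.\<close>

lemma many_of_infinite_class:
  fixes q :: "'a graph set"
  assumes G: "rooted A G" and H: "rooted A H"
    and f: "emb_over s A G H f" and g: "emb_over s A H G g"
    and nd: "\<And>C. C \<in> comps_off A G \<Longrightarrow> \<not> disjoint_self_embs (induced G C)"
    and inf: "infinite (class_comps s A H q)"
    and noinj: "\<not> (\<exists>i. inj_on i (class_comps s A H q) \<and> i ` class_comps s A H q \<subseteq> class_comps s A G q)"
    and P: "all_pieces A P H"
  shows "many_equimorphic s A H (all_pieces A P)"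
proof -
  have sH: "simple_graph H" "A \<subseteq> verts H" using H by (simp_all add: rooted_def)
  define Q where "Q = class_comps s A H q"
  define S where "S = {C \<in> Q. comp_map A G g C \<notin> class_comps s A G q}"
  have QH: "Q \<subseteq> comps_off A H" unfolding Q_def class_comps_def by auto
  obtain Y where inj: "inj_on (comp_map A G g) (Q - S)" and Y: "Y \<subseteq> comps_off A H"
    "\<And>C. C \<in> S \<Longrightarrow> comp_map A H (f \<circ> g) C \<in> Y" "\<And>C. C \<in> Y \<Longrightarrow> comp_map A H (f \<circ> g) C \<in> Y"
    "Y \<inter> Q = {}"
    by (rule exits[OF G H f g nd, of q, folded Q_def, folded S_def]) (assumption | rule that)+
  have "\<not> (\<exists>i. inj_on i Q \<and> i ` Q \<subseteq> Q - S)"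
  proof
    assume "\<exists>i. inj_on i Q \<and> i ` Q \<subseteq> Q - S"
    then obtain i where i: "inj_on i Q" "i ` Q \<subseteq> Q - S" by auto
    have "inj_on (comp_map A G g \<circ> i) Q" using i inj by (metis comp_inj_on inj_on_subset)
    moreover have "(comp_map A G g \<circ> i) ` Q \<subseteq> class_comps s A G q" using i(2) unfolding S_def by auto
    ultimately show False using noinj unfolding Q_def by metis
  qed
  then obtain \<beta> where \<beta>: "inj_on \<beta> Q" "\<beta> ` Q \<subseteq> S"
    using infinite_split_inj[OF inf[folded Q_def], of "Q - S"] by (metis Diff_Diff_Int inf_le2 order_trans)
  have emb: "embeds s A (piece A H C) (piece A H (\<beta> C))" if C: "C \<in> Q" for C
  proof -
    have "\<beta> C \<in> Q" using \<beta>(2) C unfolding S_def by auto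
    then have "equimorphic s A (piece A H C) (piece A H (\<beta> C))"
      using C unfolding Q_def class_comps_def equi_class_eq_iff[symmetric] by simp
    then show ?thesis by (simp add: equimorphic_def)
  qed
  obtain F where F: "emb_over s A H H F"
    and Fc: "\<And>x. x \<in> verts H - A \<Longrightarrow> comp_off A H (F x) \<in> comps_off A H - Q"
    using shift_along_orbits[OF H emb_over_comp[OF g f] _ Y(1-3) _ _ \<beta>(1) _ emb, of S] Y(4) QH \<beta>(2)
    unfolding S_def by blast
  have "\<exists>N. N \<subseteq> Q \<and> finite N \<and> card N = n" for n
    using infinite_arbitrarily_large[OF inf[folded Q_def], of n] by metis
  then obtain N where N: "\<And>n. N n \<subseteq> Q" "\<And>n. card (N n) = n" by metis
  define J where "J n = comps_off A H - (Q - N n)" for n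
  define R where "R n = induced H (\<Union> (J n) \<union> A)" for n
  have JH: "J n \<subseteq> comps_off A H" for n unfolding J_def by auto
  have comps: "comps_off A (R n) = J n" for n
    unfolding R_def using comps_off_restrict[OF sH(1) JH subset_refl] .
  have pc: "piece A (R n) C = piece A H C" if "C \<in> J n" for n C
    unfolding R_def using that by (intro induced_induced) auto
  have vR: "verts (R n) \<subseteq> verts H" for n
    unfolding R_def using comps_off_subset[OF sH(1)] JH[of n] sH(2) by fastforce
  have rR: "rooted A (R n)" for n using sH(1) unfolding rooted_def R_def by simp
  have eq: "equimorphic s A H (R n)" for n
    unfolding equimorphic_def
  proof
    have "F x \<in> verts (R n)" if x: "x \<in> verts H" for x
    proof (cases "x \<in> A")
      case True
      then show ?thesis using emb_overD(3)[OF F] unfolding R_def by simp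
    next
      case False
      then have "comp_off A H (F x) \<in> J n" using Fc x unfolding J_def by auto
      then show ?thesis using comp_off_self[of "F x" A H] unfolding R_def verts_induced by blast
    qed
    then have "emb_over s A (induced H (verts H)) (induced H (verts (R n))) F"
      by (intro emb_over_restrict[OF F]) auto
    then have "emb_over s A H (R n) F" using induced_verts[OF sH(1)] unfolding R_def by simp
    then show "embeds s A H (R n)" unfolding embeds_def by metis
    show "embeds s A (R n) H"
      using emb_over_sub[OF vR, of s A n] unfolding embeds_def R_def by auto
  qed
  have pR: "all_pieces A P (R n)" for n
    using P pc JH[of n] unfolding all_pieces_def comps by (auto simp: subset_iff)
  have "class_comps s A (R n) q = {C \<in> J n. equi_class s A (piece A H C) = q}" for n
    unfolding class_comps_def comps using pc by auto
  then have "class_comps s A (R n) q = N n" for n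
    using N(1)[of n] unfolding J_def Q_def class_comps_def by auto
  then have "\<not> iso_over A (R m) (R n)" if "m \<noteq> n" for m n
    using class_comps_card_iso[OF rR rR, of m n s q] N(2) that by auto
  then show ?thesis unfolding many_equimorphic_def using rR eq pR by blast
qed

text \<open>By counting, \<open>g\<close> moves some component \<open>K\<close> of class
  \<open>q\<close> out of \<open>q\<close>. Shifting vacates \<open>K\<close>, so \<open>H\<close>
  embeds into itself beside an untouched \<open>K\<close>, which serves as one more component of the
  class.\<close>

lemma grow_finite_class:
  fixes q :: "'a graph set"
  assumes G: "rooted A G" and H: "rooted A H" and eq: "equimorphic s A G H"
    and nd: "\<And>C. C \<in> comps_off A G \<Longrightarrow> \<not> disjoint_self_embs (induced G C)"
    and fin: "finite (class_comps s A G q)" "finite (class_comps s A H q)"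
    and less: "card (class_comps s A G q) < card (class_comps s A H q)"
    and P: "all_pieces A P H" and up: "\<And>T T'. P T \<Longrightarrow> embeds s A T T' \<Longrightarrow> P T'"
  obtains R where "rooted A R" "equimorphic s A H R" "all_pieces A P R"
    "finite (class_comps s A R q)" "card (class_comps s A R q) = Suc (card (class_comps s A H q))"
proof -
  have sH: "simple_graph H" "A \<subseteq> verts H" using H by (simp_all add: rooted_def)
  obtain f g where f: "emb_over s A G H f" and g: "emb_over s A H G g"
    using eq unfolding equimorphic_def embeds_def by metis
  define Q where "Q = class_comps s A H q"
  define S where "S = {C \<in> Q. comp_map A G g C \<notin> class_comps s A G q}"
  have QH: "Q \<subseteq> comps_off A H" unfolding Q_def class_comps_def by auto
  obtain Y where inj: "inj_on (comp_map A G g) (Q - S)" and Y: "Y \<subseteq> comps_off A H"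
    "\<And>C. C \<in> S \<Longrightarrow> comp_map A H (f \<circ> g) C \<in> Y" "\<And>C. C \<in> Y \<Longrightarrow> comp_map A H (f \<circ> g) C \<in> Y"
    "Y \<inter> Q = {}"
    by (rule exits[OF G H f g nd, of q, folded Q_def, folded S_def]) (assumption | rule that)+
  have "S \<noteq> {}"
  proof
    assume "S = {}"
    then have "inj_on (comp_map A G g) Q" using inj by simp
    moreover have "comp_map A G g ` Q \<subseteq> class_comps s A G q" using \<open>S = {}\<close> unfolding S_def by auto
    ultimately have "card Q \<le> card (class_comps s A G q)" using card_inj_on_le fin(1) by metis
    then show False using less unfolding Q_def by simp
  qed
  then obtain K where K: "K \<in> S" by auto
  then have KQ: "K \<in> Q" and KH: "K \<in> comps_off A H" using QH unfolding S_def by auto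
  obtain F where F: "emb_over s A H H F"
    and Fc: "\<And>x. x \<in> verts H - A \<Longrightarrow> comp_off A H (F x) \<in> comps_off A H - {K}"
  proof (rule shift_along_orbits[OF H emb_over_comp[OF g f], of "{K}" Y "{K}" id])
    show "{K} \<inter> Y = {}" using KQ Y(4) by auto
  qed (use KH Y K KQ embeds_refl in auto)
  \<comment> \<open>\<open>None\<close> indexes the additional copy of \<open>K\<close>, placed by
    the identity; \<open>Some C\<close> indexes the component \<open>C\<close>, placed by
    \<open>F\<close>, which stays away from \<open>K\<close>.\<close>
  define D where "D i = (case i of None \<Rightarrow> piece A H K | Some C \<Rightarrow> piece A H C)" for i
  define e where "e i = (case i of None \<Rightarrow> id | Some C \<Rightarrow> F)" for i :: "'a set option"
  define I where "I = insert None (Some ` comps_off A H)"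
  have sub: "C \<union> A \<subseteq> verts H" if "C \<in> comps_off A H" for C
    using comps_off_subset[OF sH(1) that] sH(2) by auto
  have Dp: "\<exists>C\<in>comps_off A H. D i = piece A H C" if "i \<in> I" for i
    using that KH unfolding I_def D_def by auto
  have Dv: "verts (D i) \<subseteq> verts H" if i: "i \<in> I" for i
  proof -
    obtain C where "C \<in> comps_off A H" "D i = piece A H C" using Dp[OF i] by auto
    then show ?thesis using sub[of C] by simp
  qed
  have eD: "emb_over s A (D i) H (e i)" if "i \<in> I" for i
  proof (cases i)
    case None
    then show ?thesis using emb_over_sub[OF sub[OF KH]] unfolding D_def e_def by simp
  next
    case (Some C)
    then have "C \<in> comps_off A H" using that unfolding I_def by auto
    then show ?thesis using emb_over_comp[OF emb_over_sub[OF sub] F] Some unfolding D_def e_def by simp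
  qed
  have FK: "F x \<noteq> y \<and> \<not> adj H (F x) y" if x: "x \<in> verts H - A" and y: "y \<in> K" for x y
  proof -
    have c: "comp_off A H (F x) \<in> comps_off A H" "comp_off A H (F x) \<noteq> K" using Fc[OF x] by auto
    show ?thesis
      using comps_off_disjoint[OF c(1) KH comp_off_self] comps_off_adj[OF sH(1) c(1) KH comp_off_self y] c(2) y by auto
  qed
  have dis: "e i x \<noteq> e j y \<and> (s \<longrightarrow> \<not> adj H (e i x) (e j y))"
    if ij: "i \<in> I" "j \<in> I" "i \<noteq> j" and x: "x \<in> verts (D i) - A" and y: "y \<in> verts (D j) - A" for i j x y
  proof -
    have v: "x \<in> verts H - A" "y \<in> verts H - A" using Dv[OF ij(1)] Dv[OF ij(2)] x y by auto
    consider "i = None" "j \<noteq> None" | "j = None" "i \<noteq> None"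
      | B C where "i = Some B" "j = Some C" "B \<noteq> C" "B \<in> comps_off A H" "C \<in> comps_off A H"
      using ij unfolding I_def by auto
    then show ?thesis
    proof cases
      case 1
      then have "x \<in> K" using x unfolding D_def by auto
      then show ?thesis using FK[OF v(2), of x] 1 adj_commute[of x "F y" H] unfolding e_def by auto
    next
      case 2
      then have "y \<in> K" using y unfolding D_def by auto
      then show ?thesis using FK[OF v(1), of y] 2 unfolding e_def by auto
    next
      case (3 B C)
      have xy: "x \<in> B" "y \<in> C" using x y 3 unfolding D_def by auto
      have "x \<noteq> y" using comps_off_disjoint[OF 3(4,5)] xy 3(3) by auto
      then have "F x \<noteq> F y" using emb_overD(1)[OF F] v by (metis DiffD1 inj_onD)
      moreover have "\<not> adj H (F x) (F y)" if s
        using emb_overD(5)[OF F that, of x y] v comps_off_adj[OF sH(1) 3(4,5) xy] 3(3) by auto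
      ultimately show ?thesis using 3 unfolding e_def by simp
    qed
  qed
  obtain R b where R: "rooted A R" "embeds s A R H" "agree_on A R H" "bij_betw b I (comps_off A R)"
    and bi: "\<And>i. i \<in> I \<Longrightarrow> iso_over A (D i) (piece A R (b i))"
  proof (rule realize_family[OF H _ _ _ eD dis])
    fix i assume "i \<in> I"
    then obtain C where C: "C \<in> comps_off A H" "D i = piece A H C" using Dp by blast
    show "rooted A (D i)" using rooted_piece[OF H] C(2) by simp
    show "connected_off A (D i)" using connected_off_piece[OF sH(1) C(1) subset_refl] C(2) by simp
    show "agree_on A (D i) H" using agree_on_piece C(2) by simp
  qed (assumption | rule that)+
  have bemb: "embeds s A (D i) (piece A R (b i))" if "i \<in> I" for i
  proof -
    have "A \<subseteq> verts (D i)" using Dp[OF that] by auto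
    then show ?thesis using iso_over_equimorphic[OF bi[OF that]] unfolding equimorphic_def by metis
  qed
  have bcl: "equi_class s A (D i) = equi_class s A (piece A R (b i))" if "i \<in> I" for i
    using iso_over_equi_class[OF bi[OF that]] Dp[OF that] by auto
  have bI: "b i \<in> comps_off A R" if "i \<in> I" for i using bij_betwE[OF R(4)] that by auto
  have inj_b: "inj_on b I" using R(4) by (simp add: bij_betw_def)
  have "embeds s A H R"
  proof (rule embeds_of_comps[OF H R(1), of "\<lambda>C. b (Some C)"])
    show "agree_on A H R" using R(3) by (simp add: agree_on_def)
    show "inj_on (\<lambda>C. b (Some C)) (comps_off A H)"
      using inj_b unfolding I_def inj_on_def by auto
    fix C assume "C \<in> comps_off A H"
    then have C: "Some C \<in> I" by (simp add: I_def)
    show "b (Some C) \<in> comps_off A R" using bI[OF C] .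
    show "embeds s A (piece A H C) (piece A R (b (Some C)))" using bemb[OF C] unfolding D_def by simp
  qed
  then have eqR: "equimorphic s A H R" using R(2) by (simp add: equimorphic_def)
  have pR: "all_pieces A P R"
    unfolding all_pieces_def
  proof
    fix C assume "C \<in> comps_off A R"
    then obtain i where i: "i \<in> I" "C = b i" using R(4) unfolding bij_betw_def by auto
    have "P (D i)" using Dp[OF i(1)] P unfolding all_pieces_def by auto
    then show "P (piece A R C)" using up bemb[OF i(1)] i(2) by simp
  qed
  have "class_comps s A R q = b ` {i \<in> I. equi_class s A (D i) = q}"
  proof -
    have "comps_off A R = b ` I" using R(4) by (simp add: bij_betw_def)
    then show ?thesis using bcl unfolding class_comps_def by auto
  qed
  also have "{i \<in> I. equi_class s A (D i) = q} = insert None (Some ` Q)"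
  proof (rule set_eqI)
    fix i
    have "equi_class s A (D None) = q" using KQ unfolding D_def Q_def class_comps_def by simp
    moreover have "C \<in> Q \<longleftrightarrow> C \<in> comps_off A H \<and> equi_class s A (D (Some C)) = q" for C
      unfolding D_def Q_def class_comps_def by simp
    ultimately show "i \<in> {i \<in> I. equi_class s A (D i) = q} \<longleftrightarrow> i \<in> insert None (Some ` Q)"
      unfolding I_def by (cases i) auto
  qed
  finally have cl: "class_comps s A R q = b ` insert None (Some ` Q)" .
  have "inj_on b (insert None (Some ` Q))" using inj_b by (rule inj_on_subset) (use QH I_def in auto)
  then have "card (class_comps s A R q) = card (insert None (Some ` Q))"
    unfolding cl by (rule card_image)
  also have "\<dots> = Suc (card Q)" using fin(2) unfolding Q_def by (simp add: card_image)
  finally have "card (class_comps s A R q) = Suc (card (class_comps s A H q))" unfolding Q_def .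
  moreover have "finite (class_comps s A R q)" using fin(2) unfolding cl Q_def by simp
  ultimately show ?thesis using that R(1) eqR pR by blast
qed

text \<open>\<open>G\<close> is kept while the larger class grows, so the strict inequality that
  permits the next step persists.\<close>

lemma many_of_finite_class:
  fixes q :: "'a graph set"
  assumes G: "rooted A G" and H: "rooted A H" and eq: "equimorphic s A G H"
    and nd: "\<And>C. C \<in> comps_off A G \<Longrightarrow> \<not> disjoint_self_embs (induced G C)"
    and fin: "finite (class_comps s A G q)" "finite (class_comps s A H q)"
    and less: "card (class_comps s A G q) < card (class_comps s A H q)"
    and P: "all_pieces A P H" and up: "\<And>T T'. P T \<Longrightarrow> embeds s A T T' \<Longrightarrow> P T'"
  shows "many_equimorphic s A H (all_pieces A P)"
proof -
  have "\<exists>R. rooted A R \<and> equimorphic s A H R \<and> all_pieces A P R \<and> finite (class_comps s A R q) \<and>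
    card (class_comps s A R q) = card (class_comps s A H q) + n" for n
  proof (induction n)
    case 0
    show ?case using H P fin(2) equimorphic_refl[of s A H] by auto
  next
    case (Suc n)
    then obtain R where R: "rooted A R" "equimorphic s A H R" "all_pieces A P R"
      "finite (class_comps s A R q)" "card (class_comps s A R q) = card (class_comps s A H q) + n" by auto
    obtain R' where "rooted A R'" "equimorphic s A R R'" "all_pieces A P R'"
      "finite (class_comps s A R' q)" "card (class_comps s A R' q) = Suc (card (class_comps s A R q))"
    proof (rule grow_finite_class[OF G R(1) equimorphic_trans[OF eq R(2)] nd fin(1) R(4) _ R(3)])
      show "card (class_comps s A G q) < card (class_comps s A R q)" using less R(5) by simp
    qed (use up in auto)
    then show ?case using R equimorphic_trans[OF R(2)] by auto
  qed
  then obtain R where R: "\<And>n. rooted A (R n)" "\<And>n. equimorphic s A H (R n)" "\<And>n. all_pieces A P (R n)"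
    "\<And>n. card (class_comps s A (R n) q) = card (class_comps s A H q) + n" by metis
  have "\<not> iso_over A (R m) (R n)" if "m \<noteq> n" for m n
    using class_comps_card_iso[OF R(1) R(1), of m n s q] R(4) that by auto
  then show ?thesis unfolding many_equimorphic_def using R(1-3) by blast
qed

text \<open>All components of the class are replaced, not just one: an isomorphism over
  \<open>A\<close> preserves classes, so wherever it sends a copy of \<open>X m\<close>, it meets a
  copy of \<open>X n\<close>.\<close>

lemma many_by_replacement:
  fixes G :: "'a graph"
  assumes G: "rooted A G" and ne: "class_comps s A G (equi_class s A T) \<noteq> {}" and T: "rooted A T"
    and many: "many_equimorphic s A T (connected_off A)"
    and P: "all_pieces A P G" and up: "\<And>T T'. P T \<Longrightarrow> embeds s A T T' \<Longrightarrow> P T'"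
  shows "many_equimorphic s A G (all_pieces A P)"
proof -
  have sG: "simple_graph G" "A \<subseteq> verts G" using G by (simp_all add: rooted_def)
  define q where "q = equi_class s A T"
  define Q where "Q = class_comps s A G q"
  obtain X :: "nat \<Rightarrow> 'a graph" where XX: "\<forall>n. rooted A (X n) \<and> equimorphic s A T (X n) \<and> connected_off A (X n)"
    and XX': "\<forall>m n. m \<noteq> n \<longrightarrow> \<not> iso_over A (X m) (X n)"
    using many unfolding many_equimorphic_def by (elim exE conjE)
  have X: "rooted A (X n)" "equimorphic s A T (X n)" "connected_off A (X n)" for n using XX by simp_all
  have Xn: "\<not> iso_over A (X m) (X n)" if "m \<noteq> n" for m n using XX' that by simp
  have XA: "A \<subseteq> verts (X n)" for n using X(1) by (simp add: rooted_def)
  have Xq: "equi_class s A (X n) = q" for n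
    using X(2)[of n] unfolding q_def equi_class_eq_iff[symmetric] by simp
  define D where "D n C = (if C \<in> Q then X n else piece A G C)" for n C
  have Dcl: "equi_class s A (D n C) = equi_class s A (piece A G C)" if "C \<in> comps_off A G" for n C
    using Xq that unfolding D_def Q_def class_comps_def by auto
  then have Deq: "equimorphic s A (D n C) (piece A G C)" if "C \<in> comps_off A G" for n C
    using that equi_class_eq_iff by metis
  have DA: "rooted A (D n C)" for n C using X(1) rooted_piece[OF G] unfolding D_def by simp
  have DA': "A \<subseteq> verts (D n C)" for n C using DA by (simp add: rooted_def)
  have "\<exists>R b. rooted A R \<and> embeds s A R G \<and> agree_on A R G \<and> bij_betw b (comps_off A G) (comps_off A R) \<and>
    (\<forall>C\<in>comps_off A G. iso_over A (D n C) (piece A R (b C)))" for n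
  proof -
    \<comment> \<open>Each new piece is equimorphic to the component it replaces and can be placed
      inside that component together with \<open>A\<close>, so different pieces stay apart.\<close>
    define e where "e C = (SOME f. emb_over s A (D n C) (piece A G C) f)" for C
    have e: "emb_over s A (D n C) (piece A G C) (e C)" if "C \<in> comps_off A G" for C
      using Deq[OF that, of n] unfolding e_def equimorphic_def embeds_def by (metis someI_ex)
    have sub: "C \<union> A \<subseteq> verts G" if "C \<in> comps_off A G" for C
      using comps_off_subset[OF sG(1) that] sG(2) by auto
    have e': "emb_over s A (D n C) G (e C)" if C: "C \<in> comps_off A G" for C
      using emb_over_comp[OF e[OF C] emb_over_sub[OF sub[OF C]]] by simp
    have eC: "e C x \<in> C" if C: "C \<in> comps_off A G" and x: "x \<in> verts (D n C) - A" for C x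
      using emb_overD(2)[OF e[OF C], of x] emb_over_off_root[OF e[OF C] DA', of x] x by auto
    have dis: "e B x \<noteq> e C y \<and> (s \<longrightarrow> \<not> adj G (e B x) (e C y))"
      if BC: "B \<in> comps_off A G" "C \<in> comps_off A G" "B \<noteq> C"
        and x: "x \<in> verts (D n B) - A" and y: "y \<in> verts (D n C) - A" for B C x y
      using comps_off_disjoint[OF BC(1,2)] comps_off_adj[OF sG(1) BC(1,2)]
        eC[OF BC(1) x] eC[OF BC(2) y] BC(3) by auto
    show ?thesis
    proof (rule realize_family[OF G DA _ _ e' dis])
      fix C assume C: "C \<in> comps_off A G"
      show "connected_off A (D n C)"
        using X(3) connected_off_piece[OF sG(1) C subset_refl] unfolding D_def by simp
      have "agree_on A (D n C) (piece A G C)"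
        using equimorphic_agree_on[OF Deq[OF C] DA'] by simp
      then show "agree_on A (D n C) G" using agree_on_piece[of A G C] unfolding agree_on_def by blast
    qed blast+
  qed
  then obtain R b where R: "\<And>n. rooted A (R n)" "\<And>n. embeds s A (R n) G" "\<And>n. agree_on A (R n) G"
    "\<And>n. bij_betw (b n) (comps_off A G) (comps_off A (R n))"
    and bi: "\<And>n C. C \<in> comps_off A G \<Longrightarrow> iso_over A (D n C) (piece A (R n) (b n C))" by metis
  have bcl: "equi_class s A (piece A (R n) (b n C)) = equi_class s A (piece A G C)"
    if "C \<in> comps_off A G" for n C
    using iso_over_equi_class[OF bi[OF that] DA'] Dcl[OF that] by metis
  then have bemb: "embeds s A (piece A G C) (piece A (R n) (b n C))" if "C \<in> comps_off A G" for n C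
    using that equi_class_eq_iff unfolding equimorphic_def by metis
  have eqR: "equimorphic s A G (R n)" for n
    unfolding equimorphic_def
  proof
    show "embeds s A G (R n)"
    proof (rule embeds_of_comps[OF G R(1), of _ "b n"])
      show "agree_on A G (R n)" using R(3)[of n] by (simp add: agree_on_def)
      show "inj_on (b n) (comps_off A G)" using R(4) by (simp add: bij_betw_def)
      show "b n C \<in> comps_off A (R n)" if "C \<in> comps_off A G" for C
        using bij_betwE[OF R(4)] that by auto
    qed (rule bemb)
  qed (rule R(2))
  have pR: "all_pieces A P (R n)" for n
    unfolding all_pieces_def
  proof
    fix C assume "C \<in> comps_off A (R n)"
    then obtain B where B: "B \<in> comps_off A G" "C = b n B" using R(4)[of n] unfolding bij_betw_def by auto
    then have "P (piece A G B)" using P unfolding all_pieces_def by auto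
    then show "P (piece A (R n) C)" using up bemb[OF B(1)] B(2) by simp
  qed
  have "m = n" if iso: "iso_over A (R m) (R n)" for m n
  proof -
    obtain t where t: "bij_betw t (comps_off A (R m)) (comps_off A (R n))"
      and ti: "\<And>C. C \<in> comps_off A (R m) \<Longrightarrow> iso_over A (piece A (R m) C) (piece A (R n) (t C))"
      using iso_over_comps[OF R(1) R(1) iso] by blast
    obtain C where CQ: "C \<in> Q" using ne unfolding Q_def q_def by auto
    then have C: "C \<in> comps_off A G" unfolding Q_def class_comps_def by simp
    have bC: "b m C \<in> comps_off A (R m)" using bij_betwE[OF R(4)] C by auto
    then have "t (b m C) \<in> comps_off A (R n)" using bij_betwE[OF t] by auto
    then obtain C' where C': "C' \<in> comps_off A G" "t (b m C) = b n C'"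
      using R(4)[of n] unfolding bij_betw_def by auto
    have i2: "iso_over A (piece A (R m) (b m C)) (piece A (R n) (b n C'))" using ti[OF bC] C'(2) by simp
    then have "equi_class s A (piece A G C) = equi_class s A (piece A G C')"
      using iso_over_equi_class[OF i2, of s] bcl[OF C, of m] bcl[OF C'(1), of n] by simp
    then have C'Q: "C' \<in> Q" using CQ C'(1) unfolding Q_def class_comps_def by simp
    have "iso_over A (X m) (piece A (R m) (b m C))" using bi[OF C, of m] CQ unfolding D_def by simp
    moreover have "iso_over A (X n) (piece A (R n) (b n C'))" using bi[OF C'(1), of n] C'Q unfolding D_def by simp
    ultimately have "iso_over A (X m) (X n)"
      using i2 iso_over_trans iso_over_sym[OF XA] by metis
    then show ?thesis using Xn by metis
  qed
  then show ?thesis unfolding many_equimorphic_def using R(1) eqR pR by metis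
qed

text \<open>\<open>nd\<close> serves the case of unequal class sizes, while \<open>conn\<close>, the
  induction hypothesis for connected pieces, serves the case of equal ones. Sizes are compared by
  injections: by Schroeder-Bernstein, a missing bijection means that an injection is missing in one
  direction.\<close>

lemma many_of_components:
  assumes G: "rooted A G" and H: "rooted A H" and eq: "equimorphic s A G H" and ni: "\<not> iso_over A G H"
    and nd: "\<And>K C. K \<in> {G, H} \<Longrightarrow> C \<in> comps_off A K \<Longrightarrow> \<not> disjoint_self_embs (induced K C)"
    and conn: "\<And>K C T. K \<in> {G, H} \<Longrightarrow> C \<in> comps_off A K \<Longrightarrow> rooted A T \<Longrightarrow> connected_off A T \<Longrightarrow>
      equimorphic s A (piece A K C) T \<Longrightarrow> \<not> iso_over A (piece A K C) T \<Longrightarrow>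
      many_equimorphic s A (piece A K C) (connected_off A)"
    and P: "all_pieces A P G" "all_pieces A P H" and up: "\<And>T T'. P T \<Longrightarrow> embeds s A T T' \<Longrightarrow> P T'"
  shows "many_equimorphic s A G (all_pieces A P)"
proof -
  \<comment> \<open>The ordered pair \<open>K\<close>, \<open>K'\<close> lets the argument run in
    both directions; a result for \<open>H\<close> passes to \<open>G\<close> by
    equimorphism.\<close>
  have uneven: "many_equimorphic s A K' (all_pieces A P)"
    if K: "{K, K'} = {G, H}"
      and noinj: "\<not> (\<exists>i. inj_on i (class_comps s A K' q) \<and> i ` class_comps s A K' q \<subseteq> class_comps s A K q)"
    for K K' q
  proof -
    have r: "rooted A K" "rooted A K'" "all_pieces A P K'" "equimorphic s A K K'"
      using K G H P eq equimorphic_sym[OF eq] by (auto simp: doubleton_eq_iff)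
    obtain f g where f: "emb_over s A K K' f" and g: "emb_over s A K' K g"
      using r(4) unfolding equimorphic_def embeds_def by metis
    have nd': "\<not> disjoint_self_embs (induced K C)" if "C \<in> comps_off A K" for C
      using nd[of K C] K that by auto
    show ?thesis
    proof (cases "finite (class_comps s A K' q)")
      case False
      show ?thesis by (rule many_of_infinite_class[OF r(1,2) f g nd' False noinj r(3)])
    next
      case True
      \<comment> \<open>An infinite class in \<open>K\<close> would have room for the finite class
        of \<open>K'\<close>.\<close>
      have fin: "finite (class_comps s A K q)"
      proof (rule ccontr)
        assume "infinite (class_comps s A K q)"
        then obtain N where N: "N \<subseteq> class_comps s A K q" "finite N" "card N = card (class_comps s A K' q)"
          using infinite_arbitrarily_large by metis
        then show False using noinj True inj_on_iff_card_le[OF True N(2)] by (metis order_refl order_trans)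
      qed
      have "card (class_comps s A K q) < card (class_comps s A K' q)"
        using noinj inj_on_iff_card_le[OF True fin] by (meson not_le_imp_less)
      from many_of_finite_class[OF r(1,2,4) nd' fin True this r(3) up] show ?thesis .
    qed
  qed
  show ?thesis
  proof (cases "\<forall>q. \<exists>b. bij_betw b (class_comps s A G q) (class_comps s A H q)")
    case False
    then obtain q where "\<not> (\<exists>b. bij_betw b (class_comps s A G q) (class_comps s A H q))" by metis
    then have "\<not> (\<exists>i. inj_on i (class_comps s A H q) \<and> i ` class_comps s A H q \<subseteq> class_comps s A G q) \<or>
      \<not> (\<exists>i. inj_on i (class_comps s A G q) \<and> i ` class_comps s A G q \<subseteq> class_comps s A H q)"
      using Schroeder_Bernstein by metis
    then show ?thesis
      using uneven[of G H q] uneven[of H G q] many_equimorphic_cong[OF eq] by (metis insert_commute)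
  next
    case True
    obtain b where b: "bij_betw b (comps_off A G) (comps_off A H)"
      and bc: "\<And>C. C \<in> comps_off A G \<Longrightarrow> equi_class s A (piece A H (b C)) = equi_class s A (piece A G C)"
      using bij_betw_classwise[of "comps_off A G" "\<lambda>C. equi_class s A (piece A G C)"
          "comps_off A H" "\<lambda>C. equi_class s A (piece A H C)"] True
      unfolding class_comps_def by blast
    have sG: "A \<subseteq> verts G" "A \<subseteq> verts H" "simple_graph G" "simple_graph H"
      using G H by (simp_all add: rooted_def)
    have ag: "agree_on A G H" by (rule equimorphic_agree_on[OF eq sG(1,2)])
    obtain C where C: "C \<in> comps_off A G" "\<not> iso_over A (piece A G C) (piece A H (b C))"
      using iso_over_of_comps[OF G H ag b] ni by blast
    have "b C \<in> comps_off A H" using bij_betwE[OF b] C(1) by auto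
    then have "connected_off A (piece A H (b C))" using connected_off_piece[OF sG(4) _ subset_refl] by metis
    then have "many_equimorphic s A (piece A G C) (connected_off A)"
      using conn[of G C "piece A H (b C)"] C rooted_piece[OF H] bc[OF C(1)] equi_class_eq_iff by (metis insertI1)
    moreover
    have "C \<in> class_comps s A G (equi_class s A (piece A G C))" using C(1) by (simp add: class_comps_def)
    then have "class_comps s A G (equi_class s A (piece A G C)) \<noteq> {}" by auto
    ultimately show ?thesis
      using many_by_replacement[OF G _ rooted_piece[OF G] _ P(1), of s C] up by metis
  qed
qed

section \<open>Levels and kernels\<close>

definition cuts :: "'a graph set \<Rightarrow> 'a graph \<Rightarrow> 'a set \<Rightarrow> bool" where
  "cuts X G S \<longleftrightarrow> finite S \<and> S \<subseteq> verts G \<and> (\<forall>C\<in>comps_off S G. induced G C \<in> X)"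

text \<open>Applied to the empty set this yields the finite graphs, since only deleting all vertices
  leaves no component.\<close>

definition next_level :: "'a graph set \<Rightarrow> 'a graph set" where
  "next_level X = {G. simple_graph G \<and> (\<exists>S. cuts X G S)}"

text \<open>These are the closure properties from which a least cut is obtained: passing to
  subgraphs, uniting two parts without edges between them, and restoring one vertex. The empty set
  has them vacuously, which starts the induction.\<close>

definition level_like :: "'a graph set \<Rightarrow> bool" where
  "level_like X \<longleftrightarrow> (\<forall>G\<in>X. simple_graph G) \<and>
     (\<forall>G H. G \<in> X \<longrightarrow> simple_graph H \<longrightarrow> embeds False {} H G \<longrightarrow> H \<in> X) \<and>
     (\<forall>G U W. simple_graph G \<longrightarrow> verts G = U \<union> W \<longrightarrow> (\<forall>u\<in>U. \<forall>w\<in>W. \<not> adj G u w) \<longrightarrow>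
        induced G U \<in> X \<longrightarrow> induced G W \<in> X \<longrightarrow> G \<in> X) \<and>
     (\<forall>G v. simple_graph G \<longrightarrow> induced G (verts G - {v}) \<in> X \<longrightarrow> G \<in> X)"

lemma level_likeD:
  assumes "level_like X"
  shows "\<And>G. G \<in> X \<Longrightarrow> simple_graph G"
    "\<And>G H. G \<in> X \<Longrightarrow> simple_graph H \<Longrightarrow> embeds False {} H G \<Longrightarrow> H \<in> X"
    "\<And>G U W. simple_graph G \<Longrightarrow> verts G = U \<union> W \<Longrightarrow> (\<And>u w. u \<in> U \<Longrightarrow> w \<in> W \<Longrightarrow> \<not> adj G u w) \<Longrightarrow>
        induced G U \<in> X \<Longrightarrow> induced G W \<in> X \<Longrightarrow> G \<in> X"
    "\<And>G v. simple_graph G \<Longrightarrow> induced G (verts G - {v}) \<in> X \<Longrightarrow> G \<in> X"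
proof -
  note D = assms[unfolded level_like_def]
  show "\<And>G. G \<in> X \<Longrightarrow> simple_graph G" using D[THEN conjunct1] by (rule bspec)
  show "\<And>G H. G \<in> X \<Longrightarrow> simple_graph H \<Longrightarrow> embeds False {} H G \<Longrightarrow> H \<in> X"
    by (rule D[THEN conjunct2, THEN conjunct1, rule_format])
  show "\<And>G U W. simple_graph G \<Longrightarrow> verts G = U \<union> W \<Longrightarrow> (\<And>u w. u \<in> U \<Longrightarrow> w \<in> W \<Longrightarrow> \<not> adj G u w) \<Longrightarrow>
        induced G U \<in> X \<Longrightarrow> induced G W \<in> X \<Longrightarrow> G \<in> X"
    by (rule D[THEN conjunct2, THEN conjunct2, THEN conjunct1, rule_format])
  show "\<And>G v. simple_graph G \<Longrightarrow> induced G (verts G - {v}) \<in> X \<Longrightarrow> G \<in> X"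
    by (rule D[THEN conjunct2, THEN conjunct2, THEN conjunct2, rule_format])
qed

lemma level_like_induced_mono:
  assumes X: "level_like X" and G: "simple_graph G" and W: "induced G W \<in> X" "U \<subseteq> W"
  shows "induced G U \<in> X"
proof (rule level_likeD(2)[OF X W(1)])
  show "embeds False {} (induced G U) (induced G W)"
    using emb_over_induced_mono[OF W(2)] unfolding embeds_def by metis
qed (use G in simp)

text \<open>An embedding carries each component off the preimage into a single component off
  \<open>S\<close>, and injectivity keeps the preimage finite.\<close>

lemma cuts_pullback:
  assumes X: "level_like X" and H: "simple_graph H" and G: "simple_graph G"
    and f: "emb_over False {} H G f" and S: "cuts X G S"
  shows "cuts X H {x \<in> verts H. f x \<in> S}"
  unfolding cuts_def
proof (intro conjI ballI)
  note F = emb_overD[OF f]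
  let ?S = "{x \<in> verts H. f x \<in> S}"
  have "finite (f -` S \<inter> verts H)" using S F(1) unfolding cuts_def by (simp add: finite_vimage_IntI)
  moreover have "f -` S \<inter> verts H = ?S" by auto
  ultimately show "finite ?S" by simp
  show "?S \<subseteq> verts H" by auto
  fix C assume C: "C \<in> comps_off ?S H"
  obtain x where x: "x \<in> C" using comps_off_ne[OF C] by auto
  have xv: "x \<in> verts H - ?S" using comps_off_subset[OF H C] x by auto
  then have "f x \<in> verts G - S" using F(2) by auto
  then have D: "comp_off S G (f x) \<in> comps_off S G" by (rule comp_off_in_comps)
  have im: "f ` C \<subseteq> comp_off S G (f x)"
  proof
    fix z assume "z \<in> f ` C"
    then obtain y where y: "y \<in> C" "z = f y" by auto
    have "y \<in> verts H - ?S \<and> reach_off S G (f x) (f y)"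
    proof (rule reach_off_map[OF comps_off_reach[OF C x y(1)]])
      show "x \<in> verts H - ?S" by (rule xv)
      fix u v assume uv: "u \<in> verts H - ?S" "adj H u v" "u \<notin> ?S" "v \<notin> ?S"
      have v: "v \<in> verts H" using simple_graph_adjD[OF H uv(2)] by simp
      then have "reach_off S G (f u) (f v)" using uv F(4)[of u v] by (intro reach_off_step) auto
      then show "v \<in> verts H - ?S \<and> reach_off S G (f u) (f v)" using v uv(4) by simp
    qed
    then show "z \<in> comp_off S G (f x)" using y by (simp add: comp_off_def)
  qed
  have "emb_over False {} (induced H C) (induced G (comp_off S G (f x))) f"
    by (rule emb_over_restrict[OF f _ im]) (use comps_off_subset[OF H C] in auto)
  then have "embeds False {} (induced H C) (induced G (comp_off S G (f x)))"
    unfolding embeds_def by metis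
  moreover have "induced G (comp_off S G (f x)) \<in> X" using S D unfolding cuts_def by auto
  ultimately show "induced H C \<in> X" using level_likeD(2)[OF X] H by (metis simple_induced)
qed

text \<open>Cuts are pulled back to subgraphs, cuts of two separated parts are united, and a
  restored vertex is added to the cut.\<close>

lemma level_like_next_level:
  assumes X: "level_like X"
  shows "level_like (next_level X)"
  unfolding level_like_def
proof (intro conjI allI impI ballI)
  show "simple_graph G" if "G \<in> next_level X" for G using that unfolding next_level_def by simp
next
  fix G H :: "'a graph" assume G: "G \<in> next_level X" and H: "simple_graph H" "embeds False {} H G"
  obtain f where f: "emb_over False {} H G f" using H(2) unfolding embeds_def by metis
  obtain S where "simple_graph G" "cuts X G S" using G unfolding next_level_def by auto
  then show "H \<in> next_level X" using cuts_pullback[OF X H(1) _ f] H(1) unfolding next_level_def by blast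
next
  fix G :: "'a graph" and U W
  assume G: "simple_graph G" "verts G = U \<union> W" and no: "\<forall>u\<in>U. \<forall>w\<in>W. \<not> adj G u w"
    and UW: "induced G U \<in> next_level X" "induced G W \<in> next_level X"
  obtain S T where S: "cuts X (induced G U) S" and T: "cuts X (induced G W) T"
    using UW unfolding next_level_def by auto
  \<comment> \<open>\<open>V\<close> stands for either of the two sides, which is closed under
    adjacency; a component off \<open>S \<union> T\<close> meeting it lies within a component of
    that side off its own cut \<open>Z\<close>.\<close>
  have main: "induced G C \<in> X"
    if C: "C \<in> comps_off (S \<union> T) G" and V: "x \<in> C" "x \<in> V" "cuts X (induced G V) Z" "Z \<subseteq> S \<union> T"
      and cl: "\<And>u v. u \<in> V \<Longrightarrow> adj G u v \<Longrightarrow> v \<in> V" for C V Z x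
  proof -
    have "y \<in> comp_off Z (induced G V) x" if y: "y \<in> C" for y
    proof -
      have "y \<in> V \<and> reach_off Z (induced G V) (id x) (id y)"
      proof (rule reach_off_map[OF comps_off_reach[OF C V(1) y]])
        show "x \<in> V" by (rule V(2))
        fix u v assume "u \<in> V" "adj G u v" "u \<notin> S \<union> T" "v \<notin> S \<union> T"
        then show "v \<in> V \<and> reach_off Z (induced G V) (id u) (id v)"
          using cl[of u v] V(4) by (auto intro!: reach_off_step)
      qed
      then show ?thesis by (simp add: comp_off_def)
    qed
    moreover have xZ: "x \<in> verts (induced G V) - Z"
      using V comps_off_subset[OF G(1) C] by auto
    then have D: "comp_off Z (induced G V) x \<in> comps_off Z (induced G V)" by (rule comp_off_in_comps)
    have "comp_off Z (induced G V) x \<subseteq> V" using comps_off_subset[OF _ D] G(1) by auto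
    then have "induced G (comp_off Z (induced G V) x) \<in> X"
      using V(3) D induced_induced unfolding cuts_def by metis
    ultimately show ?thesis using level_like_induced_mono[OF X G(1)] by blast
  qed
  have "cuts X G (S \<union> T)"
    unfolding cuts_def
  proof (intro conjI ballI)
    show "finite (S \<union> T)" "S \<union> T \<subseteq> verts G" using S T G(2) unfolding cuts_def by auto
    fix C assume C: "C \<in> comps_off (S \<union> T) G"
    obtain x where x: "x \<in> C" using comps_off_ne[OF C] by auto
    then have "x \<in> U \<or> x \<in> W" using comps_off_subset[OF G(1) C] G(2) by auto
    then show "induced G C \<in> X"
    proof
      assume "x \<in> U"
      then show ?thesis
      proof (rule main[OF C x _ S])
        fix u v assume uv: "u \<in> U" "adj G u v"
        then have "v \<in> verts G" "v \<notin> W" using no simple_graph_adjD[OF G(1) uv(2)] by auto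
        then show "v \<in> U" using G(2) by simp
      qed auto
    next
      assume "x \<in> W"
      then show ?thesis
      proof (rule main[OF C x _ T])
        fix u v assume uv: "u \<in> W" "adj G u v"
        then have "v \<in> verts G" "v \<notin> U"
          using no simple_graph_adjD[OF G(1) uv(2)] adj_commute[of u v G] by auto
        then show "v \<in> W" using G(2) by simp
      qed auto
    qed
  qed
  then show "G \<in> next_level X" using G(1) unfolding next_level_def by auto
next
  fix G :: "'a graph" and v assume G: "simple_graph G" and v: "induced G (verts G - {v}) \<in> next_level X"
  show "G \<in> next_level X"
  proof (cases "v \<in> verts G")
    case False
    then show ?thesis using v induced_verts[OF G] by simp
  next
    case True
    obtain S where S: "cuts X (induced G (verts G - {v})) S" using v unfolding next_level_def by auto
    then have Sv: "S \<inter> {v} = {}" "S \<subseteq> verts G" "finite S" unfolding cuts_def by auto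
    have comps: "comps_off S (induced G (verts G - {v})) = comps_off ({v} \<union> S) G"
      by (rule comps_off_Un[OF G Sv(1,2)])
    have "cuts X G ({v} \<union> S)"
      unfolding cuts_def
    proof (intro conjI ballI)
      fix C assume C: "C \<in> comps_off ({v} \<union> S) G"
      then have "induced (induced G (verts G - {v})) C \<in> X" using S comps unfolding cuts_def by simp
      moreover have "C \<subseteq> verts G - {v}" using comps_off_subset[OF G C] by auto
      ultimately show "induced G C \<in> X" by (simp add: induced_induced)
    qed (use Sv True in auto)
    then show ?thesis using G unfolding next_level_def by blast
  qed
qed

text \<open>If a vertex \<open>t\<close> of a smallest cut \<open>S\<close> were outside another cut \<open>S'\<close>, then all but finitely many
  of the components attached to \<open>t\<close> would lie in the component of \<open>t\<close> off \<open>S'\<close>, so that \<open>S - {t}\<close>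
  would still be a cut.\<close>

lemma least_cut:
  assumes X: "level_like X" and G: "simple_graph G" and S0: "cuts X G S0"
  obtains K where "cuts X G K" "\<And>S. cuts X G S \<Longrightarrow> K \<subseteq> S"
proof -
  obtain S where S: "cuts X G S" and min: "\<And>S'. cuts X G S' \<Longrightarrow> card S \<le> card S'"
    using ex_has_least_nat[of "cuts X G" S0 card] S0 by metis
  have fS: "finite S" "S \<subseteq> verts G" using S by (simp_all add: cuts_def)
  have "t \<in> S'" if S': "cuts X G S'" and t: "t \<in> S" for S' t
  proof (rule ccontr)
    assume tS': "t \<notin> S'"
    have "card (S - {t}) < card S" using t fS(1) by (meson card_Diff1_less)
    then have "\<not> cuts X G (S - {t})" using min[of "S - {t}"] by auto
    \<comment> \<open>As \<open>S\<close> has least size, dropping \<open>t\<close> leaves a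
      component outside \<open>X\<close>. It must contain \<open>t\<close>, or it would lie within a
      component off \<open>S\<close>.\<close>
    then obtain B where B: "B \<in> comps_off (S - {t}) G" "induced G B \<notin> X"
      using fS unfolding cuts_def by auto
    have SX: "induced G D \<in> X" if "D \<in> comps_off S G" for D using S that unfolding cuts_def by simp
    have Bsub: "B \<subseteq> verts G - (S - {t})" by (rule comps_off_subset[OF G B(1)])
    have tB: "t \<in> B"
    proof (rule ccontr)
      assume nt: "t \<notin> B"
      obtain x where x: "x \<in> B" using comps_off_ne[OF B(1)] by auto
      have "B \<subseteq> comp_off S G x"
      proof
        fix y assume y: "y \<in> B"
        have "y \<in> B \<and> reach_off S G (id x) (id y)"
        proof (rule reach_off_map[OF comps_off_reach[OF B(1) x y]])
          show "x \<in> B" by (rule x)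
          fix u v assume uv: "u \<in> B" "adj G u v" "u \<notin> S - {t}" "v \<notin> S - {t}"
          then have v: "v \<in> B" using comps_off_closed[OF B(1)] reach_off_step by metis
          then have "u \<notin> S" "v \<notin> S" using uv nt by auto
          then show "v \<in> B \<and> reach_off S G (id u) (id v)" using v uv(2) by (simp add: reach_off_step)
        qed
        then show "y \<in> comp_off S G x" by (simp add: comp_off_def)
      qed
      moreover have "x \<in> verts G - S" using x nt Bsub by auto
      ultimately show False
        using level_like_induced_mono[OF X G SX[OF comp_off_in_comps]] B(2) by metis
    qed
    have tv: "t \<in> verts G - S'" using t fS(2) tS' by auto
    define B' where "B' = comp_off S' G t"
    have B'X: "induced G B' \<in> X"
      using S' comp_off_in_comps[OF tv] unfolding cuts_def B'_def by simp
    have comp_in_B: "comp_off S G u \<subseteq> B - {t}" if u: "u \<in> B - {t}" for u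
    proof
      fix y assume "y \<in> comp_off S G u"
      then have "reach_off S G u y" by (simp add: comp_off_def)
      then have "y \<notin> S \<and> reach_off (S - {t}) G (id u) (id y)"
      proof (rule reach_off_map)
        show "u \<notin> S" using u Bsub by auto
      qed (auto intro: reach_off_step)
      then show "y \<in> B - {t}" using comps_off_closed[OF B(1), of u y] u t by auto
    qed
    have toB': "u \<in> B'" if u: "u \<in> B - {t}" and no: "comp_off S G u \<inter> S' = {}" for u
    proof -
      have "reach_off (S - {t}) G t u" using comps_off_reach[OF B(1) tB] u by auto
      \<comment> \<open>After its last visit to \<open>t\<close>, a walk off \<open>S - {t}\<close>
        stays in one component off \<open>S\<close>; if that component misses \<open>S'\<close>,
        this part of the walk runs off \<open>S'\<close>. The disjunct \<open>u = t\<close> allows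
        for returns to \<open>t\<close>.\<close>
      then have "u = t \<or> (comp_off S G u \<inter> S' = {} \<longrightarrow> reach_off S' G t u)"
      proof (induction rule: reach_off_induct)
        case (step y z)
        show ?case
        proof (cases "z = t \<or> comp_off S G z \<inter> S' \<noteq> {}")
          case False
          have zS': "z \<notin> S'" using False by (metis comp_off_self disjoint_iff)
          show ?thesis
          proof (cases "y = t")
            case True
            then show ?thesis using step(2) tS' zS' by (simp add: reach_off_step)
          next
            case yt: False
            have "y \<notin> S" "z \<notin> S" using step(3,4) yt False by auto
            then have "z \<in> comp_off S G y" using step(2) by (simp add: comp_off_def reach_off_step)
            then have eq: "comp_off S G y = comp_off S G z" by (simp add: comp_off_eq)
            then have "y \<notin> S'" using False by (metis comp_off_self disjoint_iff)
            then have "reach_off S' G y z" using step(2) zS' by (simp add: reach_off_step)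
            moreover have "reach_off S' G t y" using step(5) yt eq False by simp
            ultimately show ?thesis using reach_off_trans by metis
          qed
        qed auto
      qed simp
      then show ?thesis using u no by (simp add: B'_def comp_off_def)
    qed
    \<comment> \<open>\<open>B - {t}\<close> consists of \<open>W\<close>, which lies in the
      component of \<open>t\<close> off \<open>S'\<close>, and of the components off
      \<open>S\<close> that meet the finite set \<open>S'\<close>. Adding these finitely many
      components one by one, and then \<open>t\<close>, would put \<open>B\<close> on the
      level.\<close>
    define W where "W = {u \<in> B - {t}. comp_off S G u \<inter> S' = {}}"
    define \<D> where "\<D> = comp_off S G ` (S' \<inter> (B - {t}))"
    have fD: "finite \<D>" using S' unfolding \<D>_def cuts_def by simp
    have Dcomp: "D \<in> comps_off S G" if D: "D \<in> \<D>" for D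
    proof -
      obtain x where "x \<in> B - {t}" "D = comp_off S G x" using D unfolding \<D>_def by auto
      moreover from this have "x \<in> verts G - S" using Bsub by auto
      ultimately show ?thesis using comp_off_in_comps by metis
    qed
    have "induced G (W \<union> \<Union>\<F>) \<in> X" if "finite \<F>" "\<F> \<subseteq> \<D>" for \<F>
      using that
    proof (induction \<F> rule: finite_induct)
      case empty
      have "W \<subseteq> B'" using toB' unfolding W_def by auto
      then show ?case using level_like_induced_mono[OF X G B'X] by simp
    next
      case (insert D \<F>)
      have D: "D \<in> comps_off S G" "D \<in> \<D>" using insert.prems Dcomp by auto
      have sub: "W \<union> \<Union> (insert D \<F>) = (W \<union> \<Union>\<F>) \<union> D" by auto
      show ?case
        unfolding sub
      proof (rule level_likeD(3)[OF X, of _ "W \<union> \<Union>\<F>" D])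
        show "induced (induced G (W \<union> \<Union> \<F> \<union> D)) (W \<union> \<Union> \<F>) \<in> X"
          using insert by (simp add: induced_induced)
        show "induced (induced G (W \<union> \<Union> \<F> \<union> D)) D \<in> X"
          using SX[OF D(1)] by (simp add: induced_induced)
        fix u w assume u: "u \<in> W \<union> \<Union> \<F>" and w: "w \<in> D"
        have "\<not> adj G u w"
        proof
          assume a: "adj G u w"
          from u show False
          proof
            assume uW: "u \<in> W"
            then have "u \<in> verts G - S" using Bsub unfolding W_def by auto
            then have "comp_off S G u = D"
              using comps_off_adj[OF G comp_off_in_comps D(1) comp_off_self w a] by simp
            then show False using uW D(2) comp_off_self unfolding W_def \<D>_def by fastforce
          next
            assume "u \<in> \<Union> \<F>"
            then obtain E where E: "E \<in> \<F>" "u \<in> E" by auto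
            then have "E \<in> comps_off S G" using insert.prems Dcomp by auto
            then have "E = D" using comps_off_adj[OF G _ D(1) E(2) w a] by simp
            then show False using E insert.hyps by simp
          qed
        qed
        then show "\<not> adj (induced G (W \<union> \<Union> \<F> \<union> D)) u w" by simp
      qed (use G in auto)
    qed
    from this[OF fD subset_refl] have "induced G (W \<union> \<Union>\<D>) \<in> X" .
    moreover have "W \<union> \<Union>\<D> = B - {t}"
    proof (intro subset_antisym subsetI)
      fix u assume "u \<in> W \<union> \<Union>\<D>"
      then show "u \<in> B - {t}"
      proof
        assume "u \<in> \<Union>\<D>"
        then obtain x where x: "x \<in> B - {t}" "u \<in> comp_off S G x" unfolding \<D>_def by auto
        then show ?thesis using comp_in_B[OF x(1)] by (rule_tac subsetD)
      qed (simp add: W_def)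
    next
      fix u assume u: "u \<in> B - {t}"
      show "u \<in> W \<union> \<Union>\<D>"
      proof (cases "comp_off S G u \<inter> S' = {}")
        case True
        then show ?thesis using u by (simp add: W_def)
      next
        case False
        then obtain x where x: "x \<in> comp_off S G u" "x \<in> S'" by auto
        then have "x \<in> S' \<inter> (B - {t})" using comp_in_B[OF u] by auto
        moreover have "u \<in> comp_off S G x" using comp_off_eq[OF x(1)] by simp
        ultimately show ?thesis unfolding \<D>_def by blast
      qed
    qed
    ultimately have "induced (induced G B) (verts (induced G B) - {t}) \<in> X" by (simp add: induced_induced)
    then show False using level_likeD(4)[OF X, of "induced G B" t] G B(2) by simp
  qed
  then show ?thesis using that[OF S] by auto
qed

section \<open>Kernels and their preservation by embeddings\<close>

definition kernel :: "'a graph set \<Rightarrow> 'a graph \<Rightarrow> 'a set" where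
  "kernel X G = \<Inter> {S. cuts X G S}"

lemma kernel_least: "cuts X G S \<Longrightarrow> kernel X G \<subseteq> S"
  unfolding kernel_def by auto

lemma kernel_cuts:
  assumes "level_like X" "G \<in> next_level X"
  shows "cuts X G (kernel X G)"
proof -
  have G: "simple_graph G" using assms(2) by (simp add: next_level_def)
  obtain S0 where "cuts X G S0" using assms(2) unfolding next_level_def by auto
  then obtain K where K: "cuts X G K" "\<And>S. cuts X G S \<Longrightarrow> K \<subseteq> S"
    using least_cut[OF assms(1) G] by metis
  have "kernel X G = K"
  proof (rule subset_antisym)
    show "kernel X G \<subseteq> K" by (rule kernel_least[OF K(1)])
    show "K \<subseteq> kernel X G" unfolding kernel_def by (rule Inter_greatest) (use K(2) in simp)
  qed
  with K(1) show ?thesis by simp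
qed

text \<open>The preimage of the kernel of \<open>H\<close> is a cut of \<open>G\<close>, so it
  contains the least one.\<close>

lemma kernel_map:
  assumes X: "level_like X" and G: "simple_graph G" and H: "H \<in> next_level X"
    and f: "emb_over False {} G H f"
  shows "f ` kernel X G \<subseteq> kernel X H"
proof -
  have "simple_graph H" using H by (simp add: next_level_def)
  from kernel_least[OF cuts_pullback[OF X G this f kernel_cuts[OF X H]]] show ?thesis by auto
qed

text \<open>With the empty set as a cut, the only component would be \<open>G\<close> itself, which
  is not in \<open>X\<close>.\<close>

lemma kernel_nonempty:
  assumes X: "level_like X" and G: "G \<in> next_level X" "G \<notin> X" "connected_off {} G"
  shows "kernel X G \<noteq> {}"
proof
  assume "kernel X G = {}"
  then have "\<forall>C\<in>comps_off {} G. induced G C \<in> X" using kernel_cuts[OF X G(1)] unfolding cuts_def by simp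
  then have "induced G (verts G) \<in> X" using G(3) unfolding connected_off_def by simp
  moreover have "simple_graph G" using G(1) by (simp add: next_level_def)
  ultimately show False using G(2) induced_verts by metis
qed

text \<open>Every self-embedding maps the finite kernel into itself and hence onto itself, so the
  images of any two of them share the nonempty kernel.\<close>

lemma no_disjoint_self_embs:
  assumes X: "level_like X" and G: "G \<in> next_level X" "G \<notin> X" "connected_off {} G"
  shows "\<not> disjoint_self_embs G"
proof
  assume "disjoint_self_embs G"
  then obtain f g where f: "emb_over False {} G G f" and g: "emb_over False {} G G g"
    and dis: "f ` verts G \<inter> g ` verts G = {}" unfolding disjoint_self_embs_def by metis
  have sG: "simple_graph G" using G(1) by (simp add: next_level_def)
  let ?K = "kernel X G"
  have K: "finite ?K" "?K \<subseteq> verts G" using kernel_cuts[OF X G(1)] by (simp_all add: cuts_def)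
  have im: "h ` ?K = ?K" if h: "emb_over False {} G G h" for h
  proof -
    have "inj_on h ?K" using emb_overD(1)[OF h] K(2) by (metis inj_on_subset)
    then show ?thesis using kernel_map[OF X sG G(1) h] K(1) by (meson endo_inj_surj)
  qed
  have "?K \<subseteq> f ` verts G \<inter> g ` verts G" using im[OF f] im[OF g] K(2) by (metis image_mono le_inf_iff)
  then show False using dis kernel_nonempty[OF X G] by simp
qed

text \<open>A walk off \<open>A\<close> from \<open>C\<close> to \<open>k\<close> has to leave
  \<open>C\<close>, and only a step into \<open>K\<close> can do so.\<close>

lemma comp_attached:
  assumes G: "simple_graph G" and conn: "connected_off A G"
    and C: "C \<in> comps_off (A \<union> K) G" and k: "k \<in> K" "k \<in> verts G - A"
  shows "\<exists>x\<in>C. \<exists>b\<in>K. adj G x b"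
proof (rule ccontr)
  assume no: "\<not> ?thesis"
  obtain x where x: "x \<in> C" using comps_off_ne[OF C] by auto
  have sub: "C \<subseteq> verts G - (A \<union> K)" by (rule comps_off_subset[OF G C])
  have "reach_off A G x k" using connected_offD(2)[OF conn] x sub k(2) by auto
  then have "k \<in> C"
  proof (induction rule: reach_off_induct)
    case (step u v)
    have "v \<notin> K" using step no by auto
    then have "reach_off (A \<union> K) G u v" using step sub by (intro reach_off_step) auto
    then show ?case using comps_off_closed[OF C step(5)] by simp
  qed (rule x)
  then show False using sub k(1) by auto
qed

text \<open>For a graph outside a set closed under \<open>next_level\<close>, deleting finitely many
  vertices always leaves a component outside that set. Deleting the current vertex and moving to a
  neighbour in such a component, again and again, traces a ray.\<close>

lemma rayless_in_level:
  assumes G: "simple_graph G" and ray: "rayless G" and X: "next_level X \<subseteq> X"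
  shows "G \<in> X"
proof (rule ccontr)
  assume GX: "G \<notin> X"
  \<comment> \<open>A state is a connected vertex set not on the level together with the current
    vertex in it. The next set omits the current vertex, so the resulting walk never repeats a
    vertex.\<close>
  define Q where "Q p \<longleftrightarrow> fst p \<subseteq> verts G \<and> snd p \<in> fst p \<and> connected_off {} (induced G (fst p)) \<and>
    induced G (fst p) \<notin> X" for p :: "'a set \<times> 'a"
  have uncut: "\<exists>C\<in>comps_off S H. induced H C \<notin> X"
    if "H \<notin> X" "simple_graph H" "finite S" "S \<subseteq> verts H" for H S
    using that X unfolding next_level_def cuts_def by blast
  have "\<exists>p. Q p"
  proof -
    obtain C where C: "C \<in> comps_off {} G" "induced G C \<notin> X" using uncut[OF GX G, of "{}"] by auto
    obtain x where "x \<in> C" using comps_off_ne[OF C(1)] by auto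
    then have "Q (C, x)"
      using C comps_off_subset[OF G C(1)] connected_off_piece[OF G C(1), of "{}"] unfolding Q_def by auto
    then show ?thesis ..
  qed
  moreover have "\<exists>p'. Q p' \<and> fst p' \<subseteq> fst p - {snd p} \<and> adj G (snd p) (snd p')" if p: "Q p" for p
  proof -
    obtain W v where pW: "p = (W, v)" by (cases p)
    have W: "W \<subseteq> verts G" "v \<in> W" "connected_off {} (induced G W)" "induced G W \<notin> X"
      using p unfolding Q_def pW by auto
    have sW: "simple_graph (induced G W)" using G by simp
    obtain C where C: "C \<in> comps_off {v} (induced G W)" "induced (induced G W) C \<notin> X"
      using uncut[OF W(4) sW, of "{v}"] W(2) by auto
    have CW: "C \<subseteq> W - {v}" using comps_off_subset[OF sW C(1)] by simp
    then have "C \<subseteq> W" by auto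
    then have CX: "induced G C \<notin> X" using C(2) by (simp add: induced_induced)
    obtain x where x: "x \<in> C" "adj G x v"
      using comp_attached[OF sW W(3), of C "{v}" v] C(1) W(2) by auto
    have "connected_off {} (induced (induced G W) (C \<union> {}))" by (rule connected_off_piece[OF sW C(1)]) simp
    moreover have "induced (induced G W) (C \<union> {}) = induced G C" using \<open>C \<subseteq> W\<close> by (simp add: induced_induced)
    ultimately have "connected_off {} (induced G C)" by simp
    then have "Q (C, x)" using CW W(1) x(1) CX unfolding Q_def by auto
    then show ?thesis using CW x(2) adj_commute[of x v G] unfolding pW by (intro exI[of _ "(C, x)"]) auto
  qed
  ultimately obtain w where w: "\<And>n. Q (w n)"
    "\<And>n. fst (w (Suc n)) \<subseteq> fst (w n) - {snd (w n)} \<and> adj G (snd (w n)) (snd (w (Suc n)))"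
    using dependent_nat_choice[of "\<lambda>_. Q" "\<lambda>_ p p'. fst p' \<subseteq> fst p - {snd p} \<and> adj G (snd p) (snd p')"] by metis
  define r where "r n = snd (w n)" for n
  have dec: "fst (w n) \<subseteq> fst (w m)" if "m \<le> n" for m n
    by (rule lift_Suc_antimono_le[OF _ that]) (use w(2) in blast)
  have "r m \<noteq> r n" if "m < n" for m n
  proof -
    have "r n \<in> fst (w n)" using w(1)[of n] unfolding Q_def r_def by simp
    then have "r n \<in> fst (w (Suc m))" using dec[of "Suc m" n] that by auto
    then show ?thesis using w(2)[of m] unfolding r_def by auto
  qed
  then have "inj r" by (metis injI linorder_neqE_nat)
  moreover have "range r \<subseteq> verts G" using w(1) unfolding Q_def r_def by auto
  moreover have "\<forall>n. adj G (r n) (r (Suc n))" using w(2) unfolding r_def by simp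
  ultimately show False using ray unfolding rayless_def by metis
qed

section \<open>The connected case\<close>

definition rigid :: "'a graph set \<Rightarrow> bool" where
  "rigid X \<longleftrightarrow> (\<forall>G\<in>X. connected_off {} G \<longrightarrow> \<not> disjoint_self_embs G)"

text \<open>The induction step enlarges \<open>A\<close> by a kernel, hence the quantification over
  all finite \<open>A\<close>. The level is demanded of \<open>G\<close> alone; \<open>H\<close>
  inherits it through its embedding in \<open>G\<close>.\<close>

definition twin_alternative :: "'a graph set \<Rightarrow> bool" where
  "twin_alternative X \<longleftrightarrow> (\<forall>s A G H. finite A \<longrightarrow> rooted A G \<longrightarrow> rooted A H \<longrightarrow> connected_off A G \<longrightarrow>
     connected_off A H \<longrightarrow> induced G (verts G - A) \<in> X \<longrightarrow> equimorphic s A G H \<longrightarrow> \<not> iso_over A G H \<longrightarrow>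
     many_equimorphic s A G (connected_off A))"

text \<open>An embedding of \<open>H\<close> in \<open>G\<close> carries components into components,
  so those of \<open>H\<close> lie in \<open>X\<close> as well; \<open>rigid\<close> and
  \<open>twin_alternative\<close> then supply what \<open>many_of_components\<close> asks of the
  pieces.\<close>

lemma many_of_level_components:
  assumes X: "level_like X" "rigid X" "twin_alternative X" and A: "finite A"
    and G: "rooted A G" and H: "rooted A H" and eq: "equimorphic s A G H" and ni: "\<not> iso_over A G H"
    and GX: "\<And>C. C \<in> comps_off A G \<Longrightarrow> induced G C \<in> X"
    and P: "all_pieces A P G" "all_pieces A P H" and up: "\<And>T T'. P T \<Longrightarrow> embeds s A T T' \<Longrightarrow> P T'"
  shows "many_equimorphic s A G (all_pieces A P)"
proof -
  have sG: "simple_graph G" "simple_graph H" using G H by (simp_all add: rooted_def)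
  obtain g where g: "emb_over s A H G g" using eq unfolding equimorphic_def embeds_def by metis
  have HX: "induced H C \<in> X" if C: "C \<in> comps_off A H" for C
  proof (rule level_likeD(2)[OF X(1) GX[OF comp_map(1)[OF g H C]]])
    have "emb_over s A (induced H C) (induced G (comp_map A G g C)) g"
      by (rule emb_over_restrict[OF g _ comp_map(2)[OF g H C]])
        (use comps_off_subset[OF sG(2) C] in auto)
    then show "embeds False {} (induced H C) (induced G (comp_map A G g C))"
      unfolding embeds_def by (metis emb_over_weaken empty_subsetI)
  qed (use sG in simp)
  have KX: "induced K C \<in> X" "simple_graph K" "rooted A K" if "K \<in> {G, H}" "C \<in> comps_off A K" for K C
    using that GX HX sG G H by auto
  show ?thesis
  proof (rule many_of_components[OF G H eq ni _ _ P])
    fix K C assume K: "K \<in> {G, H}" and C: "C \<in> comps_off A K"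
    show "\<not> disjoint_self_embs (induced K C)"
      using X(2) KX(1)[OF K C] connected_off_piece[OF KX(2)[OF K C] C, of "{}"] unfolding rigid_def by simp
    fix T assume T: "rooted A T" "connected_off A T" "equimorphic s A (piece A K C) T"
      "\<not> iso_over A (piece A K C) T"
    have "C \<inter> A = {}" using comps_off_subset[OF KX(2)[OF K C] C] by auto
    then have "C \<union> A - A = C" by auto
    then have "induced (piece A K C) (verts (piece A K C) - A) \<in> X"
      using KX(1)[OF K C] by (simp add: induced_induced)
    then show "many_equimorphic s A (piece A K C) (connected_off A)"
      using X(3)[unfolded twin_alternative_def, rule_format, OF A rooted_piece[OF KX(3)[OF K C]] T(1)
          connected_off_piece[OF KX(2)[OF K C] C subset_refl] T(2) _ T(3,4)] by simp
  qed (rule up)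
qed

section \<open>Isomorphic copies along injections\<close>

definition image_graph :: "('a \<Rightarrow> 'b) \<Rightarrow> 'a graph \<Rightarrow> 'b graph" where
  "image_graph f G = \<lparr>verts = f ` verts G, edges = image f ` edges G\<rparr>"

lemma verts_image_graph [simp]: "verts (image_graph f G) = f ` verts G"
  by (simp add: image_graph_def)

lemma adj_image_graph:
  assumes "simple_graph G" "inj_on f (verts G)" "u \<in> verts G" "v \<in> verts G"
  shows "adj (image_graph f G) (f u) (f v) \<longleftrightarrow> adj G u v"
proof
  assume "adj (image_graph f G) (f u) (f v)"
  then obtain e where e: "e \<in> edges G" "{f u, f v} = f ` e" unfolding image_graph_def by auto
  have "e \<subseteq> verts G" using assms(1) e(1) unfolding simple_graph_def by blast
  moreover have "f ` {u, v} = f ` e" using e(2) by simp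
  ultimately have "{u, v} = e" using inj_on_image_eq_iff[OF assms(2)] assms(3,4) by (metis empty_subsetI insert_subset)
  with e(1) show "adj G u v" by simp
next
  assume "adj G u v"
  then have "f ` {u, v} \<in> image f ` edges G" by (rule imageI)
  then show "adj (image_graph f G) (f u) (f v)" by (simp add: image_graph_def)
qed

lemma simple_image_graph:
  assumes "simple_graph G" "inj_on f (verts G)"
  shows "simple_graph (image_graph f G)"
  unfolding simple_graph_def
proof
  fix e assume "e \<in> edges (image_graph f G)"
  then obtain d where d: "d \<in> edges G" "e = f ` d" by (auto simp: image_graph_def)
  then obtain u v where uv: "d = {u, v}" "u \<in> verts G" "v \<in> verts G" "u \<noteq> v"
    using assms(1) unfolding simple_graph_def by blast
  then have "e = {f u, f v}" "f u \<noteq> f v" using d assms(2) by (auto simp: inj_on_def)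
  then show "e \<in> {{u, v} | u v. u \<in> verts (image_graph f G) \<and> v \<in> verts (image_graph f G) \<and> u \<noteq> v}"
    using uv by auto
qed

lemma image_graph_emb:
  assumes "simple_graph G" "inj_on f (verts G)"
  shows "graph_emb True G (image_graph f G) f"
  by (rule graph_embI) (use assms adj_image_graph[OF assms] in auto)

lemma image_graph_sub:
  assumes G: "simple_graph G" and f: "graph_emb s G H f"
  shows "graph_emb s (image_graph f G) H id"
proof (rule graph_embI)
  note F = graph_embD[OF f] and a = adj_image_graph[OF G graph_embD(1)[OF f]]
  show "id x \<in> verts H" if "x \<in> verts (image_graph f G)" for x using that F(2) by auto
  fix u v assume "u \<in> verts (image_graph f G)" "v \<in> verts (image_graph f G)"
  then obtain x y where xy: "x \<in> verts G" "y \<in> verts G" "u = f x" "v = f y" by auto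
  show "adj H (id u) (id v)" if "adj (image_graph f G) u v" using F(3)[of x y] a[of x y] xy that by simp
  show "adj (image_graph f G) u v" if s "adj H (id u) (id v)" using F(4)[of x y] a[of x y] xy that by simp
qed simp

lemma image_graph_into:
  assumes G: "simple_graph G" and f: "graph_emb s G H f"
    and h: "graph_emb s K G h"
  shows "graph_emb s K (image_graph f G) (f \<circ> h)"
proof -
  have "graph_emb s G (image_graph f G) f"
    using image_graph_emb[OF G graph_embD(1)[OF f]] unfolding graph_emb_def by metis
  from graph_emb_comp[OF h this] show ?thesis .
qed

lemma reach_off_antimono:
  assumes "reach_off B G x y" "A \<subseteq> B" shows "reach_off A G x y"
  using assms(1)
proof (induction rule: reach_off_induct)
  case (step u v)
  then have "reach_off A G u v" using assms(2) by (intro reach_off_step) auto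
  then show ?case using step(5) reach_off_trans by metis
qed simp

lemma connected_off_iso:
  assumes G: "rooted A G" "connected_off A G" and H: "simple_graph H" and iso: "iso_over A G H"
  shows "connected_off A H"
proof -
  have sG: "simple_graph G" "A \<subseteq> verts G" using G by (simp_all add: rooted_def)
  obtain f where f: "emb_over True A G H f" "f ` verts G = verts H" using iso unfolding iso_over_def by metis
  have pre: "\<exists>u\<in>verts G - A. x = f u" if x: "x \<in> verts H - A" for x
  proof -
    obtain u where u: "u \<in> verts G" "x = f u" using x f(2) by auto
    then have "u \<notin> A" using x emb_overD(3)[OF f(1)] by auto
    with u show ?thesis by auto
  qed
  show ?thesis
  proof (rule connected_offI[OF H])
    obtain u where "u \<in> verts G - A" using connected_offD(1)[OF G(2)] by auto
    then have "f u \<in> verts H - A" using f emb_over_off_root[OF f(1) sG(2)] by auto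
    then show "verts H - A \<noteq> {}" by auto
    fix x y assume "x \<in> verts H - A" "y \<in> verts H - A"
    then obtain u v where uv: "u \<in> verts G - A" "v \<in> verts G - A" "x = f u" "y = f v" using pre by metis
    show "reach_off A H x y"
      using emb_over_reach[OF f(1) sG connected_offD(2)[OF G(2) uv(1,2)] uv(1)] uv(3,4) by simp
  qed
qed

lemma emb_over_off:
  assumes f: "emb_over s A G H f" and G: "rooted A G"
  shows "emb_over False {} (induced G (verts G - A)) (induced H (verts H - A)) f"
proof -
  have A: "A \<subseteq> verts G" using G by (simp add: rooted_def)
  have "emb_over s A (induced G (verts G - A)) (induced H (verts H - A)) f"
    by (rule emb_over_restrict[OF f]) (use emb_overD(2)[OF f] emb_over_off_root[OF f A] in auto)
  then show ?thesis by (rule emb_over_weaken) auto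
qed

text \<open>Two powers of \<open>h\<close> agree on \<open>K\<close> by the pigeonhole principle;
  cancelling the smaller one by injectivity leaves a positive power that is the identity on
  \<open>K\<close>.\<close>

lemma funpow_id_on_finite:
  assumes "finite K" "inj_on h K" "h ` K \<subseteq> K"
  obtains m where "\<And>k. k \<in> K \<Longrightarrow> (h ^^ Suc m) k = k"
proof -
  have mem: "(h ^^ n) k \<in> K" if "k \<in> K" for n k
    by (induction n) (use that assms(3) in auto)
  \<comment> \<open>A fixed value outside \<open>K\<close> turns the restrictions into total
    functions of which there are only finitely many.\<close>
  define F where "F n k = (if k \<in> K then (h ^^ n) k else undefined)" for n k
  have "range F \<subseteq> {f. \<forall>x. (x \<in> K \<longrightarrow> f x \<in> K) \<and> (x \<notin> K \<longrightarrow> f x = undefined)}"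
    using mem by (auto simp: F_def)
  then have "finite (range F)"
    by (rule finite_subset) (rule finite_set_of_finite_funs[OF assms(1,1)])
  then have "\<not> inj F" using finite_imageD[of F UNIV] by auto
  then obtain a b where ab: "F a = F b" "a \<noteq> b" unfolding inj_def by auto
  have "\<exists>i j. F i = F j \<and> i < j" using ab by (metis linorder_neqE_nat)
  then obtain i j where ij: "F i = F j" "i < j" by auto
  obtain m where m: "j = i + Suc m" using ij(2) less_imp_Suc_add by auto
  have inj: "inj_on (h ^^ n) K" for n
  proof (induction n)
    case (Suc n)
    have "(h ^^ n) ` K \<subseteq> K" using mem by auto
    then have "inj_on (h \<circ> (h ^^ n)) K" using Suc assms(2) by (metis comp_inj_on inj_on_subset)
    then show ?case by (simp only: funpow.simps)
  qed simp
  have "(h ^^ Suc m) k = k" if k: "k \<in> K" for k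
  proof -
    have "(h ^^ i) k = (h ^^ j) k" using ij(1) k by (metis F_def)
    also have "\<dots> = (h ^^ i) ((h ^^ Suc m) k)" unfolding m funpow_add by simp
    finally show ?thesis using inj_onD[OF inj, of i k "(h ^^ Suc m) k"] k mem[OF k, of "Suc m"] by simp
  qed
  then show ?thesis by (rule that)
qed

lemma emb_over_funpow: "emb_over s A G G h \<Longrightarrow> emb_over s A G G (h ^^ n)"
proof (induction n)
  case 0
  then show ?case using emb_over_id[of s A G] by (simp add: id_def)
next
  case (Suc n)
  then show ?case using emb_over_comp[of s A G G "h ^^ n" G h] by (simp only: funpow.simps)
qed

text \<open>Finite classes that cover all natural numbers are infinite in number; their least
  members are the representatives.\<close>

lemma finite_classes_subsequence:
  fixes E :: "nat \<Rightarrow> nat \<Rightarrow> bool"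
  assumes "\<And>n. E n n" "\<And>m n. E m n \<Longrightarrow> E n m" "\<And>l m n. E l m \<Longrightarrow> E m n \<Longrightarrow> E l n"
    and fin: "\<And>m. finite {n. E m n}"
  obtains r :: "nat \<Rightarrow> nat" where "\<And>m n. m \<noteq> n \<Longrightarrow> \<not> E (r m) (r n)"
proof -
  define \<rho> where "\<rho> n = (LEAST m. E m n)" for n
  have \<rho>: "E (\<rho> n) n" for n unfolding \<rho>_def using assms(1) by (rule LeastI)
  have eq: "\<rho> m = \<rho> n" if "E m n" for m n
  proof -
    have "E k m \<longleftrightarrow> E k n" for k using that assms(2,3) by metis
    then show ?thesis by (simp add: \<rho>_def)
  qed
  have "infinite (range \<rho>)"
  proof
    assume "finite (range \<rho>)"
    then have "finite (\<Union>m\<in>range \<rho>. {n. E m n})" using fin by blast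
    moreover have "(\<Union>m\<in>range \<rho>. {n. E m n}) = UNIV" using \<rho> by blast
    ultimately show False by simp
  qed
  then obtain r :: "nat \<Rightarrow> nat" where r: "inj r" "range r \<subseteq> range \<rho>"
    using infinite_countable_subset by metis
  have fixed: "\<rho> (r n) = r n" for n
  proof -
    obtain k where "r n = \<rho> k" using r(2) by auto
    then show ?thesis using eq[OF \<rho>[of k]] by simp
  qed
  have "\<not> E (r m) (r n)" if "m \<noteq> n" for m n
    using eq[of "r m" "r n"] fixed r(1) that by (metis injD)
  then show ?thesis by (rule that)
qed

text \<open>An isomorphism from \<open>R m\<close> permutes \<open>K\<close>. If those to
  \<open>R a\<close> and \<open>R b\<close> induce the same permutation, going back along one and
  forward along the other fixes \<open>K\<close> pointwise, an isomorphism over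
  \<open>A \<union> K\<close>. So there are no more terms than permutations.\<close>

lemma finite_iso_classes_over_kernel:
  fixes R :: "nat \<Rightarrow> 'a graph"
  assumes K: "finite K" and R: "\<And>n. rooted (A \<union> K) (R n)"
    and ni: "\<And>m n. m \<noteq> n \<Longrightarrow> \<not> iso_over (A \<union> K) (R m) (R n)"
    and pres: "\<And>m n h. emb_over True A (R m) (R n) h \<Longrightarrow> h ` K \<subseteq> K"
  shows "finite {n. iso_over A (R m) (R n)}"
proof (rule ccontr)
  let ?I = "{n. iso_over A (R m) (R n)}"
  assume inf: "infinite ?I"
  have sub: "A \<union> K \<subseteq> verts (R n)" for n using R by (simp add: rooted_def)
  define h where "h n = (SOME h. emb_over True A (R m) (R n) h \<and> h ` verts (R m) = verts (R n))" for n
  have h: "emb_over True A (R m) (R n) (h n)" "h n ` verts (R m) = verts (R n)" if "n \<in> ?I" for n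
    using someI_ex[of "\<lambda>h. emb_over True A (R m) (R n) h \<and> h ` verts (R m) = verts (R n)"] that
    unfolding h_def iso_over_def by auto
  define F where "F n k = (if k \<in> K then h n k else undefined)" for n k
  have "F ` ?I \<subseteq> {f. \<forall>x. (x \<in> K \<longrightarrow> f x \<in> K) \<and> (x \<notin> K \<longrightarrow> f x = undefined)}"
    using pres[OF h(1)] by (auto simp: F_def image_subset_iff)
  then have "finite (F ` ?I)" by (rule finite_subset) (rule finite_set_of_finite_funs[OF K K])
  then obtain a where a: "a \<in> ?I" "infinite {b \<in> ?I. F b = F a}"
    using pigeonhole_infinite[OF inf] by metis
  have "infinite ({b \<in> ?I. F b = F a} - {a})" using a(2) by simp
  then obtain b where b: "b \<in> ?I" "F b = F a" "b \<noteq> a"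
    using infinite_imp_nonempty by blast
  let ?i = "inv_into (verts (R m)) (h a)"
  have A: "A \<subseteq> verts (R m)" using sub by auto
  note i = emb_over_inverse[OF h[OF a(1)] A]
  have e: "emb_over True A (R a) (R b) (h b \<circ> ?i)" by (rule emb_over_comp[OF i(1) h(1)[OF b(1)]])
  have im: "(h b \<circ> ?i) ` verts (R a) = verts (R b)" using i(2) h(2)[OF b(1)] by (simp only: image_comp[symmetric])
  have "(h b \<circ> ?i) k = k" if k: "k \<in> K" for k
  proof -
    have inj: "inj_on (h a) (verts (R m))" using emb_overD(1)[OF h(1)[OF a(1)]] .
    have "inj_on (h a) K" using inj sub by (metis inj_on_subset le_sup_iff)
    then have "h a ` K = K" using pres[OF h(1)[OF a(1)]] K by (metis endo_inj_surj)
    then obtain l where l: "l \<in> K" "k = h a l" using k by auto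
    have "?i k = l" using l inj sub by (metis UnCI inv_into_f_f subsetD)
    then show ?thesis using l b(2) by (metis F_def comp_apply)
  qed
  then have "emb_over True (A \<union> K) (R a) (R b) (h b \<circ> ?i)"
    using e unfolding emb_over_def by blast
  then have "iso_over (A \<union> K) (R a) (R b)" using im unfolding iso_over_def by metis
  then show False using ni[of a b] b(3) by simp
qed

text \<open>The comparison is moved into \<open>G\<close> and over \<open>A \<union> K\<close>,
  where the component argument applies. Its outcome is then brought back over \<open>A\<close> in
  three respects: the new graphs are connected, they have the same kernel, and infinitely many of
  them stay distinct.\<close>

lemma connected_step:
  assumes X: "level_like X" "rigid X" "twin_alternative X" and A: "finite A"
    and G: "rooted A G" "connected_off A G" and H: "rooted A H" "connected_off A H"
    and lev: "induced G (verts G - A) \<in> next_level X" "induced G (verts G - A) \<notin> X"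
    and eq: "equimorphic s A G H" and ni: "\<not> iso_over A G H"
  shows "many_equimorphic s A G (connected_off A)"
proof -
  have sG: "simple_graph G" "A \<subseteq> verts G" and sH: "simple_graph H" "A \<subseteq> verts H"
    using G H by (simp_all add: rooted_def)
  let ?off = "\<lambda>L. induced L (verts L - A)"
  define K where "K = kernel X (?off G)"
  have cK: "cuts X (?off G) K" unfolding K_def by (rule kernel_cuts[OF X(1) lev(1)])
  then have K: "finite K" "K \<subseteq> verts G - A" by (simp_all add: cuts_def)
  have "connected_off {} (?off G)" using connected_off_induced[OF sG] G(2) by simp
  then have "K \<noteq> {}" unfolding K_def by (rule kernel_nonempty[OF X(1) lev])
  then obtain k0 where k0: "k0 \<in> K" by auto
  have levL: "?off L \<in> next_level X" if L: "rooted A L" "embeds s A L G" for L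
  proof -
    obtain l where "emb_over s A L G l" using L(2) unfolding embeds_def by metis
    then have "embeds False {} (?off L) (?off G)" using emb_over_off[OF _ L(1)] unfolding embeds_def by metis
    then show ?thesis
      using level_likeD(2)[OF level_like_next_level[OF X(1)] lev(1)] L(1) unfolding rooted_def by simp
  qed
  have kmap: "f ` kernel X (?off L) \<subseteq> kernel X (?off M)"
    if "rooted A L" "rooted A M" "embeds s A M G" "emb_over t A L M f" for L M f t
    by (rule kernel_map[OF X(1) _ levL[OF that(2,3)] emb_over_off[OF that(4,1)]])
      (use that(1) in \<open>simp add: rooted_def\<close>)
  obtain f g where f: "emb_over s A G H f" and g: "emb_over s A H G g"
    using eq unfolding equimorphic_def embeds_def by metis
  define h where "h = g \<circ> f"
  have h: "emb_over s A G G h" unfolding h_def by (rule emb_over_comp[OF f g])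
  have hK: "h ` K \<subseteq> K" unfolding K_def by (rule kmap[OF G(1) G(1) embeds_refl h])
  have "inj_on h K" by (rule inj_on_subset[OF emb_overD(1)[OF h]]) (use K(2) in auto)
  then obtain m where m: "\<And>k. k \<in> K \<Longrightarrow> (h ^^ Suc m) k = k"
    using funpow_id_on_finite[OF K(1) _ hK] by metis
  \<comment> \<open>Following \<open>g\<close> by \<open>h ^^ m\<close> turns the round trip
    \<open>g' \<circ> f\<close> into the power of \<open>h\<close> that fixes \<open>K\<close>
    pointwise.\<close>
  define g' where "g' = (h ^^ m) \<circ> g"
  have g': "emb_over s A H G g'" unfolding g'_def by (rule emb_over_comp[OF g emb_over_funpow[OF h]])
  have g'f: "g' \<circ> f = h ^^ Suc m" unfolding g'_def h_def[symmetric] comp_assoc funpow_Suc_right by simp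
  \<comment> \<open>The copy of \<open>H\<close> inside \<open>G\<close> contains \<open>K\<close>
    and embeds in \<open>G\<close> by the identity, so both embeddings fix
    \<open>A \<union> K\<close>.\<close>
  define H' where "H' = image_graph g' H"
  have g'A: "g' a = a" if "a \<in> A" for a using emb_overD(3)[OF g' that] .
  have ge: "graph_emb s H G g'" using g' by (simp add: emb_over_def)
  have sH': "simple_graph H'" unfolding H'_def by (rule simple_image_graph[OF sH(1) graph_embD(1)[OF ge]])
  have KH': "A \<union> K \<subseteq> verts H'"
  proof
    fix x assume x: "x \<in> A \<union> K"
    then show "x \<in> verts H'"
    proof
      assume "x \<in> A"
      then show ?thesis using g'A sH(2) unfolding H'_def verts_image_graph by (metis image_eqI subsetD)
    next
      assume x: "x \<in> K"
      have "x = g' (f x)" using m[OF x] g'f by (metis comp_apply)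
      moreover have "f x \<in> verts H" using emb_overD(2)[OF f] x K(2) by auto
      ultimately show ?thesis unfolding H'_def verts_image_graph by (metis imageI)
    qed
  qed
  have isoH: "iso_over A H H'"
    using image_graph_emb[OF sH(1) graph_embD(1)[OF ge]] g'A
    unfolding iso_over_def emb_over_def H'_def by (metis verts_image_graph)
  have rH': "rooted (A \<union> K) H'" "rooted A H'" using sH' KH' by (simp_all add: rooted_def)
  have rG: "rooted (A \<union> K) G" using sG K(2) by (auto simp: rooted_def)
  have "emb_over s (A \<union> K) G H' (g' \<circ> f)"
    unfolding emb_over_def
  proof
    show "graph_emb s G H' (g' \<circ> f)"
      unfolding H'_def by (rule image_graph_into[OF sH(1) ge]) (use f in \<open>simp add: emb_over_def\<close>)
    show "\<forall>a\<in>A \<union> K. (g' \<circ> f) a = a"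
      using m emb_overD(3)[OF emb_over_comp[OF f g']] unfolding g'f by auto
  qed
  moreover have "emb_over s (A \<union> K) H' G id"
    using image_graph_sub[OF sH(1) ge] unfolding emb_over_def H'_def by simp
  ultimately have eq': "equimorphic s (A \<union> K) G H'" unfolding equimorphic_def embeds_def by metis
  have ni': "\<not> iso_over (A \<union> K) G H'"
  proof
    assume "iso_over (A \<union> K) G H'"
    then have "iso_over A G H'" by (rule iso_over_weaken) auto
    moreover have "iso_over A H' H" by (rule iso_over_sym[OF sH(2) isoH])
    ultimately show False using ni iso_over_trans by metis
  qed
  have conH': "connected_off A H'" by (rule connected_off_iso[OF H sH' isoH])
  \<comment> \<open>An edge from outside \<open>A \<union> K\<close> to \<open>K\<close> survives
    every embedding over \<open>A \<union> K\<close>, weak or strong; it will tie the new pieces to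
    the kernel.\<close>
  define P where "P T \<longleftrightarrow> A \<union> K \<subseteq> verts T \<and> (\<exists>x\<in>verts T - (A \<union> K). \<exists>k\<in>K. adj T x k)" for T
  have up: "P T'" if P: "P T" and T: "embeds s (A \<union> K) T T'" for T T'
  proof -
    obtain t where t: "emb_over s (A \<union> K) T T' t" using T unfolding embeds_def by metis
    note D = emb_overD[OF t]
    have sub: "A \<union> K \<subseteq> verts T" using P by (simp add: P_def)
    obtain x k where x: "x \<in> verts T - (A \<union> K)" "k \<in> K" "adj T x k" using P unfolding P_def by auto
    have "t x \<in> verts T' - (A \<union> K)" using D(2) emb_over_off_root[OF t sub, of x] x(1) by auto
    moreover have "adj T' (t x) k" using D(4)[of x k] D(3)[of k] x sub by auto
    moreover have "A \<union> K \<subseteq> verts T'"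
    proof
      fix a assume "a \<in> A \<union> K"
      then show "a \<in> verts T'" using D(2)[of a] D(3)[of a] sub by auto
    qed
    ultimately show ?thesis using x(2) unfolding P_def by blast
  qed
  have pieces: "all_pieces (A \<union> K) P L"
    if L: "rooted (A \<union> K) L" "connected_off A L" for L
    unfolding all_pieces_def
  proof
    fix C assume C: "C \<in> comps_off (A \<union> K) L"
    have sL: "simple_graph L" and k0': "k0 \<in> verts L - A" using L(1) k0 K(2) by (auto simp: rooted_def)
    obtain x k where x: "x \<in> C" "k \<in> K" "adj L x k" using comp_attached[OF sL L(2) C k0 k0'] by auto
    moreover have "x \<notin> A \<union> K" using comps_off_subset[OF sL C] x(1) by auto
    ultimately show "P (piece (A \<union> K) L C)" unfolding P_def by auto
  qed
  have compsX: "induced G C \<in> X" if C: "C \<in> comps_off (A \<union> K) G" for C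
  proof -
    have "comps_off K (?off G) = comps_off (A \<union> K) G" by (rule comps_off_Un[OF sG(1)]) (use K(2) in auto)
    then have "induced (?off G) C \<in> X" using cK C unfolding cuts_def by simp
    moreover have "C \<subseteq> verts G - A" using comps_off_subset[OF sG(1) C] by auto
    ultimately show ?thesis by (simp add: induced_induced)
  qed
  have "many_equimorphic s (A \<union> K) G (all_pieces (A \<union> K) P)"
    by (rule many_of_level_components[OF X _ rG rH'(1) eq' ni' compsX pieces[OF rG G(2)] pieces[OF rH'(1) conH'] up])
      (use A K(1) in simp_all)
  then obtain R :: "nat \<Rightarrow> 'a graph"
    where RR: "\<forall>n. rooted (A \<union> K) (R n) \<and> equimorphic s (A \<union> K) G (R n) \<and> all_pieces (A \<union> K) P (R n)"
    and RR': "\<forall>m n. m \<noteq> n \<longrightarrow> \<not> iso_over (A \<union> K) (R m) (R n)"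
    unfolding many_equimorphic_def by (elim exE conjE)
  have R: "rooted (A \<union> K) (R n)" "equimorphic s (A \<union> K) G (R n)" "all_pieces (A \<union> K) P (R n)" for n
    using RR by simp_all
  have rR: "rooted A (R n)" and sR: "simple_graph (R n)" "A \<union> K \<subseteq> verts (R n)" for n
    using R(1)[of n] by (simp_all add: rooted_def)
  have embR: "\<exists>f g. emb_over s (A \<union> K) G (R n) f \<and> emb_over s (A \<union> K) (R n) G g \<and>
      emb_over s A G (R n) f \<and> emb_over s A (R n) G g" for n
    using R(2)[of n] unfolding equimorphic_def embeds_def by (metis emb_over_weaken sup_ge1)
  have eqR: "equimorphic s A G (R n)" for n
    using embR[of n] unfolding equimorphic_def embeds_def by metis
  have conR: "connected_off A (R n)" for n
  proof -
    obtain f where f: "emb_over s (A \<union> K) G (R n) f" "emb_over s A G (R n) f" using embR[of n] by metis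
    have toK: "\<exists>k\<in>K. reach_off A (R n) x k" if x: "x \<in> verts (R n) - A" for x
    proof (cases "x \<in> K")
      case True
      then show ?thesis by (metis reach_off_refl)
    next
      case False
      then have xv: "x \<in> verts (R n) - (A \<union> K)" using x by simp
      let ?C = "comp_off (A \<union> K) (R n) x"
      have C: "?C \<in> comps_off (A \<union> K) (R n)" using comp_off_in_comps[OF xv] .
      then have "P (piece (A \<union> K) (R n) ?C)" using R(3)[of n] unfolding all_pieces_def by simp
      then obtain y k where y: "y \<in> ?C" "k \<in> K" "adj (R n) y k" "y \<notin> A \<union> K" unfolding P_def by auto
      have "reach_off (A \<union> K) (R n) x y" using y(1) by (simp add: comp_off_def)
      then have "reach_off A (R n) x y" by (rule reach_off_antimono) auto
      moreover have "reach_off A (R n) y k" using y K(2) by (intro reach_off_step) auto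
      ultimately show ?thesis using y(2) reach_off_trans by metis
    qed
    \<comment> \<open>Vertices of \<open>K\<close> are joined by walks in \<open>G\<close> off
      \<open>A\<close>; an embedding that fixes \<open>K\<close> carries these into
      \<open>R n\<close>.\<close>
    have KK: "reach_off A (R n) k k0" if k: "k \<in> K" for k
    proof -
      have kv: "k \<in> verts G - A" "k0 \<in> verts G - A" using k k0 K(2) by auto
      show ?thesis
        using emb_over_reach[OF f(2) sG connected_offD(2)[OF G(2) kv] kv(1)] emb_overD(3)[OF f(1)] k k0 by simp
    qed
    have tok0: "reach_off A (R n) x k0" if "x \<in> verts (R n) - A" for x
      using toK[OF that] KK reach_off_trans by metis
    show ?thesis
    proof (rule connected_offI[OF sR(1)])
      show "verts (R n) - A \<noteq> {}" using k0 K(2) sR(2)[of n] by auto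
      show "reach_off A (R n) x y" if "x \<in> verts (R n) - A" "y \<in> verts (R n) - A" for x y
        using tok0[OF that(1)] tok0[OF that(2)] reach_off_trans reach_off_sym by metis
    qed
  qed
  \<comment> \<open>\<open>f\<close> fixes \<open>K\<close> and maps it into the kernel of
    \<open>R n\<close>, while \<open>g\<close> maps that kernel injectively into \<open>K\<close>;
    by finiteness the two sets coincide.\<close>
  have kerR: "kernel X (?off (R n)) = K" for n
  proof -
    let ?L = "kernel X (?off (R n))"
    obtain f g where f: "emb_over s (A \<union> K) G (R n) f" "emb_over s A G (R n) f"
      and g: "emb_over s A (R n) G g" using embR[of n] by metis
    have Rle: "embeds s A (R n) G" using g unfolding embeds_def by metis
    have L: "finite ?L" "?L \<subseteq> verts (R n)"
      using kernel_cuts[OF X(1) levL[OF rR Rle]] unfolding cuts_def by auto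
    have "f ` K \<subseteq> ?L" unfolding K_def by (rule kmap[OF G(1) rR Rle f(2)])
    moreover have "f ` K = K" using emb_overD(3)[OF f(1)] by simp
    ultimately have "K \<subseteq> ?L" by simp
    moreover have "g ` ?L \<subseteq> K" unfolding K_def by (rule kmap[OF rR G(1) embeds_refl g])
    then have "card ?L \<le> card K"
      using card_inj_on_le[of g ?L K] K(1) L(2) emb_overD(1)[OF g] by (metis inj_on_subset)
    ultimately show ?thesis using card_seteq[OF L(1)] by metis
  qed
  \<comment> \<open>Isomorphisms over \<open>A\<close> need not fix \<open>K\<close> pointwise, but
    since \<open>K\<close> is the kernel of every \<open>R n\<close> they still map it into
    itself.\<close>
  have pres: "l ` K \<subseteq> K" if l: "emb_over True A (R m) (R n) l" for m n l
    using kmap[OF rR rR _ l] eqR[of n] kerR unfolding equimorphic_def by metis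
  have fin: "finite {n. iso_over A (R m) (R n)}" for m
    by (rule finite_iso_classes_over_kernel[OF K(1) R(1) _ pres]) (use RR' in simp)
  have Asub: "A \<subseteq> verts (R n)" for n using sR(2)[of n] by simp
  have "\<exists>r :: nat \<Rightarrow> nat. \<forall>m n. m \<noteq> n \<longrightarrow> \<not> iso_over A (R (r m)) (R (r n))"
  proof (rule finite_classes_subsequence[of "\<lambda>m n. iso_over A (R m) (R n)"])
    show "iso_over A (R n) (R n)" for n by (rule iso_over_refl)
    show "iso_over A (R n) (R m)" if "iso_over A (R m) (R n)" for m n by (rule iso_over_sym[OF Asub that])
    show "iso_over A (R l) (R n)" if "iso_over A (R l) (R m)" "iso_over A (R m) (R n)" for l m n
      by (rule iso_over_trans[OF that])
    show "finite {n. iso_over A (R m) (R n)}" for m by (rule fin)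
    fix r :: "nat \<Rightarrow> nat" assume r: "\<And>m n. m \<noteq> n \<Longrightarrow> \<not> iso_over A (R (r m)) (R (r n))"
    show "\<exists>r :: nat \<Rightarrow> nat. \<forall>m n. m \<noteq> n \<longrightarrow> \<not> iso_over A (R (r m)) (R (r n))"
      by (intro exI[of _ r] allI impI) (rule r)
  qed
  then obtain r :: "nat \<Rightarrow> nat" where "\<forall>m n. m \<noteq> n \<longrightarrow> \<not> iso_over A (R (r m)) (R (r n))" ..
  then show ?thesis
    unfolding many_equimorphic_def using rR eqR conR by (intro exI[of _ "\<lambda>n. R (r n)"]) simp
qed

section \<open>The twin alternative\<close>

lemma mono_next_level: "monotone (\<le>) (\<le>) next_level"
  unfolding next_level_def cuts_def by (rule monotoneI) blast

abbreviation good_level :: "'a graph set \<Rightarrow> bool" where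
  "good_level X \<equiv> level_like X \<and> rigid X \<and> twin_alternative X"

lemma good_level_next_level:
  assumes "good_level X"
  shows "good_level (next_level X)"
proof -
  have X: "level_like X" "rigid X" "twin_alternative X" using assms by simp_all
  have "rigid (next_level X)"
    unfolding rigid_def
  proof (intro ballI impI)
    fix G assume G: "G \<in> next_level X" "connected_off {} G"
    show "\<not> disjoint_self_embs G"
    proof (cases "G \<in> X")
      case True
      then show ?thesis using X(2) G(2) unfolding rigid_def by simp
    next
      case False
      show ?thesis by (rule no_disjoint_self_embs[OF X(1) G(1) False G(2)])
    qed
  qed
  moreover have "twin_alternative (next_level X)"
    unfolding twin_alternative_def
  proof (intro allI impI)
    fix s A and G H :: "'a graph"
    assume A: "finite A" and G: "rooted A G" and H: "rooted A H" and cG: "connected_off A G"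
      and cH: "connected_off A H" and lev: "induced G (verts G - A) \<in> next_level X"
      and eq: "equimorphic s A G H" and ni: "\<not> iso_over A G H"
    show "many_equimorphic s A G (connected_off A)"
    proof (cases "induced G (verts G - A) \<in> X")
      case True
      show ?thesis
        by (rule X(3)[unfolded twin_alternative_def, rule_format, OF A G H cG cH True eq ni])
    next
      case False
      show ?thesis by (rule connected_step[OF X A G cG H cH lev False eq ni])
    qed
  qed
  ultimately show ?thesis using level_like_next_level[OF X(1)] by simp
qed

text \<open>Two parts of a graph that lie on levels of a chain lie on a common one, which gives
  closure under uniting them. The other statements assume the level of a single graph and hold
  member by member.\<close>

lemma good_level_Sup:
  assumes chain: "Complete_Partial_Order.chain (\<le>) \<M>" and M: "\<And>X. X \<in> \<M> \<Longrightarrow> good_level X"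
  shows "good_level (\<Union>\<M>)"
proof (intro conjI)
  have ll: "level_like X" if "X \<in> \<M>" for X using M[OF that] by simp
  show "level_like (\<Union>\<M>)"
    unfolding level_like_def
  proof (intro conjI allI impI ballI)
    show "simple_graph G" if "G \<in> \<Union>\<M>" for G using that level_likeD(1)[OF ll] by auto
    show "H \<in> \<Union>\<M>" if "G \<in> \<Union>\<M>" "simple_graph H" "embeds False {} H G" for G H
      using that level_likeD(2)[OF ll] by auto
    show "G \<in> \<Union>\<M>" if "simple_graph G" "induced G (verts G - {v}) \<in> \<Union>\<M>" for G v
      using that level_likeD(4)[OF ll] by (metis Union_iff)
    fix G U W assume G: "simple_graph G" "verts G = U \<union> W" "\<forall>u\<in>U. \<forall>w\<in>W. \<not> adj G u w"
      "induced G U \<in> \<Union>\<M>" "induced G W \<in> \<Union>\<M>"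
    obtain X Y where XY: "X \<in> \<M>" "induced G U \<in> X" "Y \<in> \<M>" "induced G W \<in> Y" using G(4,5) by auto
    have "X \<subseteq> Y \<or> Y \<subseteq> X" using chainD[OF chain XY(1,3)] by simp
    then obtain Z where Z: "Z \<in> \<M>" "induced G U \<in> Z" "induced G W \<in> Z" using XY by blast
    have "G \<in> Z" by (rule level_likeD(3)[OF ll[OF Z(1)] G(1,2) _ Z(2,3)]) (use G(3) in simp)
    then show "G \<in> \<Union>\<M>" using Z(1) by auto
  qed
  show "rigid (\<Union>\<M>)" using M unfolding rigid_def by auto
  show "twin_alternative (\<Union>\<M>)"
    unfolding twin_alternative_def
  proof (intro allI impI)
    fix s A and G H :: "'a graph"
    assume A: "finite A" and G: "rooted A G" and H: "rooted A H" and cG: "connected_off A G"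
      and cH: "connected_off A H" and lev: "induced G (verts G - A) \<in> \<Union>\<M>"
      and eq: "equimorphic s A G H" and ni: "\<not> iso_over A G H"
    obtain X where X: "X \<in> \<M>" "induced G (verts G - A) \<in> X" using lev by auto
    have "twin_alternative X" using M[OF X(1)] by simp
    then show "many_equimorphic s A G (connected_off A)"
      by (rule twin_alternative_def[THEN iffD1, rule_format, OF _ A G H cG cH X(2) eq ni])
  qed
qed

text \<open>The limit of the transfinite iteration of \<open>next_level\<close> from the empty set;
  fixed point induction takes the place of recursion on ordinal ranks.\<close>

definition rayless_level :: "'a graph set" where
  "rayless_level = ccpo_class.fixp next_level"

lemma good_rayless_level: "good_level rayless_level"
  unfolding rayless_level_def
proof (rule ccpo_class.fixp_induct[OF _ mono_next_level])
  show "ccpo.admissible Sup (\<le>) (good_level :: 'a graph set \<Rightarrow> bool)"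
    by (rule ccpo.admissibleI) (rule good_level_Sup; simp)
  \<comment> \<open>The empty chain provides the base case, the empty level.\<close>
  show "good_level (Sup {})"
    by (rule good_level_Sup) (simp_all add: chain_empty)
qed (rule good_level_next_level)

lemma rayless_in_rayless_level:
  assumes "simple_graph G" "rayless G" shows "G \<in> rayless_level"
proof (rule rayless_in_level[OF assms])
  show "next_level rayless_level \<subseteq> rayless_level"
    unfolding rayless_level_def using ccpo_class.fixp_unfold[OF mono_next_level] by (rule equalityD2)
qed

section \<open>Application to rayless graphs\<close>

lemma connected_graph_iff:
  assumes "simple_graph G" shows "connected_graph G \<longleftrightarrow> connected_off {} G"
proof
  assume "connected_graph G"
  then show "connected_off {} G"
    by (intro connected_offI[OF assms]) (auto simp: connected_graph_def reach_off_def)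
next
  assume c: "connected_off {} G"
  show "connected_graph G"
    using connected_offD[OF c] by (auto simp: connected_graph_def reach_off_def)
qed

text \<open>The components of \<open>G\<close> are subgraphs of \<open>G\<close> and so lie on the
  level, whence the component argument applies with empty \<open>A\<close> and trivial
  \<open>P\<close>. It does not keep graphs connected; the connected case is
  \<open>twin_alternative\<close> with empty \<open>A\<close>.\<close>

lemma rayless_twin_alternative:
  fixes G H :: "'a graph"
  assumes G: "simple_graph G" "rayless G" and H: "simple_graph H"
    and eq: "equimorphic s {} G H" and ni: "\<not> iso_over {} G H"
  shows "many_equimorphic s {} G (\<lambda>_. True)"
    "connected_graph G \<Longrightarrow> connected_graph H \<Longrightarrow> many_equimorphic s {} G (connected_off {})"
proof -
  have L: "level_like (rayless_level :: 'a graph set)" "rigid (rayless_level :: 'a graph set)"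
    "twin_alternative (rayless_level :: 'a graph set)" using good_rayless_level by auto
  have GL: "G \<in> rayless_level" by (rule rayless_in_rayless_level[OF G])
  have r: "rooted {} G" "rooted {} H" using G H by (simp_all add: rooted_def)
  have "many_equimorphic s {} G (all_pieces {} (\<lambda>_. True))"
  proof (rule many_of_level_components[OF L _ r eq ni])
    fix C assume C: "C \<in> comps_off {} G"
    have "induced G (verts G) \<in> rayless_level" using GL induced_verts[OF G(1)] by simp
    then show "induced G C \<in> rayless_level"
      by (rule level_like_induced_mono[OF L(1) G(1)]) (use comps_off_subset[OF G(1) C] in auto)
  qed (simp_all add: all_pieces_def)
  then show "many_equimorphic s {} G (\<lambda>_. True)" unfolding many_equimorphic_def all_pieces_def by simp
  assume c: "connected_graph G" "connected_graph H"
  have "induced G (verts G - {}) \<in> rayless_level" using GL induced_verts[OF G(1)] by simp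
  then show "many_equimorphic s {} G (connected_off {})"
    using L(3)[unfolded twin_alternative_def, rule_format, OF _ r _ _ _ eq ni]
      connected_graph_iff[OF G(1)] connected_graph_iff[OF H] c by simp
qed

section \<open>Weak and strong twins\<close>

lemma isomorphic_iff:
  "isomorphic G H \<longleftrightarrow> (\<exists>f. graph_emb True G H f \<and> f ` verts G = verts H)"
proof
  assume "isomorphic G H"
  then obtain f where f: "bij_betw f (verts G) (verts H)"
    "\<forall>u\<in>verts G. \<forall>v\<in>verts G. adj G u v \<longleftrightarrow> adj H (f u) (f v)" unfolding isomorphic_def by auto
  have "graph_emb True G H f" by (rule graph_embI) (use f in \<open>auto simp: bij_betw_def\<close>)
  then show "\<exists>f. graph_emb True G H f \<and> f ` verts G = verts H" using f(1) unfolding bij_betw_def by blast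
next
  assume "\<exists>f. graph_emb True G H f \<and> f ` verts G = verts H"
  then obtain f where f: "graph_emb True G H f" "f ` verts G = verts H" by auto
  have "bij_betw f (verts G) (verts H)" using graph_embD(1)[OF f(1)] f(2) by (simp add: bij_betw_def)
  moreover have "adj G u v \<longleftrightarrow> adj H (f u) (f v)" if "u \<in> verts G" "v \<in> verts G" for u v
    using graph_embD(3)[OF f(1) that] graph_embD(4)[OF f(1) TrueI that] by (rule iffI)
  ultimately show "isomorphic G H" unfolding isomorphic_def by blast
qed

lemma iso_over_empty_iff: "iso_over {} G H \<longleftrightarrow> isomorphic G H"
  by (simp add: isomorphic_iff iso_over_def emb_over_def)

text \<open>An embedding yields the subgraph \<open>image_graph f G\<close>, induced if the
  embedding is strong; conversely, an isomorphism onto a subgraph is an embedding into the whole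
  graph.\<close>

lemma subgraph_embedding_iff:
  assumes G: "simple_graph G" and H: "simple_graph H"
  shows "(\<exists>H'. subgraph H' H \<and> isomorphic G H') \<longleftrightarrow> (\<exists>f. graph_emb False G H f)"
    and "(\<exists>H'. induced_subgraph H' H \<and> isomorphic G H') \<longleftrightarrow> (\<exists>f. graph_emb True G H f)"
proof -
  have sub: "graph_emb s G H f" if f: "graph_emb True G H' f" "f ` verts G = verts H'" and H': "subgraph H' H"
    and ind: "s \<Longrightarrow> induced_subgraph H' H" for s f H'
  proof (rule graph_embI)
    note F = graph_embD[OF f(1)]
    show "inj_on f (verts G)" by (rule F(1))
    show "f x \<in> verts H" if "x \<in> verts G" for x using F(2)[OF that] H' by (auto simp: subgraph_def)
    show "adj H (f u) (f v)" if "u \<in> verts G" "v \<in> verts G" "adj G u v" for u v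
      using F(3)[OF that] H' by (auto simp: subgraph_def)
    show "adj G u v" if s "u \<in> verts G" "v \<in> verts G" "adj H (f u) (f v)" for u v
      using F(4)[of u v] F(2) ind[OF that(1)] that by (auto simp: induced_subgraph_def)
  qed
  have im: "subgraph (image_graph f G) H \<and> isomorphic G (image_graph f G) \<and>
      (s \<longrightarrow> induced_subgraph (image_graph f G) H)" if f: "graph_emb s G H f" for s f
  proof -
    note inj = graph_embD(1)[OF f] and e = graph_embD[OF image_graph_sub[OF G f]]
    have s: "simple_graph (image_graph f G)" by (rule simple_image_graph[OF G inj])
    have edge: "\<exists>u v. e = {u, v} \<and> u \<in> verts K \<and> v \<in> verts K" if "simple_graph K" "e \<in> edges K"
      for e and K :: "'b graph" using that unfolding simple_graph_def by blast
    have "verts (image_graph f G) \<subseteq> verts H" using e(2) by auto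
    moreover have sub: "edges (image_graph f G) \<subseteq> edges H"
      using edge[OF s] e(3) by fastforce
    ultimately have "subgraph (image_graph f G) H" using s H by (simp add: subgraph_def)
    moreover have "isomorphic G (image_graph f G)"
      using image_graph_emb[OF G inj] unfolding isomorphic_iff by (metis verts_image_graph)
    moreover have "edges (image_graph f G) = {d \<in> edges H. d \<subseteq> verts (image_graph f G)}" if "s"
    proof (intro subset_antisym subsetI)
      fix d assume d: "d \<in> edges (image_graph f G)"
      then show "d \<in> {d \<in> edges H. d \<subseteq> verts (image_graph f G)}" using sub edge[OF s d] by auto
    next
      fix d assume d: "d \<in> {d \<in> edges H. d \<subseteq> verts (image_graph f G)}"
      then obtain u v where "d = {u, v}" using edge[OF H, of d] by auto
      then show "d \<in> edges (image_graph f G)" using e(4)[OF that, of u v] d by auto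
    qed
    ultimately show ?thesis by (simp add: induced_subgraph_def)
  qed
  show "(\<exists>H'. subgraph H' H \<and> isomorphic G H') \<longleftrightarrow> (\<exists>f. graph_emb False G H f)"
  proof
    assume "\<exists>H'. subgraph H' H \<and> isomorphic G H'"
    then obtain H' f where "subgraph H' H" "graph_emb True G H' f" "f ` verts G = verts H'"
      unfolding isomorphic_iff by auto
    then show "\<exists>f. graph_emb False G H f" using sub[of H' f False] by auto
  qed (use im in blast)
  show "(\<exists>H'. induced_subgraph H' H \<and> isomorphic G H') \<longleftrightarrow> (\<exists>f. graph_emb True G H f)"
  proof
    assume "\<exists>H'. induced_subgraph H' H \<and> isomorphic G H'"
    then obtain H' f where "induced_subgraph H' H" "graph_emb True G H' f" "f ` verts G = verts H'"
      unfolding isomorphic_iff by auto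
    then show "\<exists>f. graph_emb True G H f" using sub[of H' f True] by (auto simp: induced_subgraph_def)
  qed (use im in blast)
qed

definition twins :: "bool \<Rightarrow> 'a graph \<Rightarrow> 'b graph \<Rightarrow> bool" where
  "twins s G H \<longleftrightarrow> simple_graph G \<and> simple_graph H \<and> \<not> isomorphic G H \<and>
     (\<exists>f. graph_emb s G H f) \<and> (\<exists>g. graph_emb s H G g)"

lemma weak_twins_iff: "weak_twins G H \<longleftrightarrow> twins False G H"
  unfolding weak_twins_def twins_def using subgraph_embedding_iff(1) by metis

lemma strong_twins_iff: "strong_twins G H \<longleftrightarrow> twins True G H"
  unfolding strong_twins_def twins_def using subgraph_embedding_iff(2) by metis

text \<open>The terms are pairwise non-isomorphic, so at most one of them is isomorphic to
  \<open>G\<close>; all others are twins.\<close>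

lemma infinitely_many_twins:
  assumes G: "simple_graph G" and many: "many_equimorphic s {} G Q"
  shows "infinitely_many_nonisomorphic (\<lambda>H. Q H \<and> twins s G H)"
proof -
  obtain R :: "nat \<Rightarrow> 'a graph"
    where R: "\<forall>n. rooted {} (R n) \<and> equimorphic s {} G (R n) \<and> Q (R n)"
    and ni: "\<forall>m n. m \<noteq> n \<longrightarrow> \<not> iso_over {} (R m) (R n)"
    using many unfolding many_equimorphic_def by (elim exE conjE)
  have inj: "inj R" using ni iso_over_refl by (metis injI)
  define N where "N = {n. \<not> iso_over {} G (R n)}"
  have "- N \<subseteq> {m}" if "m \<in> - N" for m
  proof
    fix n assume "n \<in> - N"
    then have "iso_over {} (R m) (R n)"
      using that iso_over_sym[of "{}" G "R m"] iso_over_trans unfolding N_def by fastforce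
    then show "n \<in> {m}" using ni by (metis singletonI)
  qed
  then have "finite (- N)" by (metis all_not_in_conv finite.emptyI finite.insertI finite_subset)
  then have "infinite N" by (metis finite_compl infinite_UNIV_nat)
  then have "infinite (R ` N)" using inj by (metis finite_imageD inj_on_subset subset_UNIV)
  moreover have "Q H \<and> twins s G H" if "H \<in> R ` N" for H
    using that R G unfolding N_def twins_def iso_over_empty_iff rooted_def equimorphic_def embeds_def emb_over_def
    by auto
  moreover have "pairwise (\<lambda>H K. \<not> isomorphic H K) (R ` N)"
    unfolding pairwise_def using ni unfolding iso_over_empty_iff by (metis imageE)
  ultimately show ?thesis unfolding infinitely_many_nonisomorphic_def by blast
qed

text \<open>A twin on another vertex type embeds in \<open>G\<close>, and its image is a copy on the
  type of \<open>G\<close>, where equimorphism and \<open>iso_over\<close> make sense.\<close>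

lemma twin_copy:
  fixes G :: "'a graph" and H :: "'b graph"
  assumes tw: "twins s G H"
  obtains H' :: "'a graph" where "simple_graph H'" "equimorphic s {} G H'" "\<not> iso_over {} G H'"
    "connected_graph H \<Longrightarrow> connected_graph H'"
proof -
  obtain f g where f: "graph_emb s G H f" and g: "graph_emb s H G g"
    and s: "simple_graph G" "simple_graph H" and ni: "\<not> isomorphic G H" using tw unfolding twins_def by metis
  let ?H = "image_graph g H"
  note inj = graph_embD(1)[OF g]
  have sH: "simple_graph ?H" by (rule simple_image_graph[OF s(2) inj])
  have gH: "graph_emb True H ?H g" by (rule image_graph_emb[OF s(2) inj])
  have "equimorphic s {} G ?H"
    using image_graph_into[OF s(2) g f] image_graph_sub[OF s(2) g]
    unfolding equimorphic_def embeds_def emb_over_def by auto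
  moreover have "\<not> iso_over {} G ?H"
  proof
    assume "iso_over {} G ?H"
    then obtain h where h: "graph_emb True G ?H h" "h ` verts G = g ` verts H"
      unfolding iso_over_empty_iff isomorphic_iff by auto
    let ?i = "inv_into (verts H) g"
    have im: "?i ` (g ` verts H) = verts H" using inj by (simp add: image_inv_into_cancel)
    have "graph_emb True ?H H ?i"
    proof (rule graph_embI)
      show "inj_on ?i (verts ?H)" by (simp add: inj_on_inv_into)
      show "?i x \<in> verts H" if "x \<in> verts ?H" for x using that im by auto
      fix u v assume "u \<in> verts ?H" "v \<in> verts ?H"
      then obtain x y where xy: "x \<in> verts H" "y \<in> verts H" "u = g x" "v = g y" by auto
      then show "adj H (?i u) (?i v)" if "adj ?H u v"
        using adj_image_graph[OF s(2) inj xy(1,2)] inj that by simp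
      show "adj ?H u v" if "adj H (?i u) (?i v)"
        using adj_image_graph[OF s(2) inj xy(1,2)] inj that xy by simp
    qed
    from graph_emb_comp[OF h(1) this] have "graph_emb True G H (?i \<circ> h)" .
    moreover have "(?i \<circ> h) ` verts G = verts H" using h(2) im by (simp only: image_comp[symmetric])
    ultimately show False using ni unfolding isomorphic_iff by blast
  qed
  moreover have "connected_graph ?H" if c: "connected_graph H"
    unfolding connected_graph_def
  proof (intro conjI ballI)
    show "verts ?H \<noteq> {}" using c by (simp add: connected_graph_def)
    fix u v assume "u \<in> verts ?H" "v \<in> verts ?H"
    then obtain x y where xy: "x \<in> verts H" "y \<in> verts H" "u = g x" "v = g y" by auto
    have "(\<lambda>x y. adj H x y)\<^sup>*\<^sup>* x y" using c xy unfolding connected_graph_def by blast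
    then have "y \<in> verts H \<and> (\<lambda>x y. adj ?H x y)\<^sup>*\<^sup>* (g x) (g y)"
    proof (induction rule: rtranclp_induct)
      case (step w z)
      have wz: "w \<in> verts H" "z \<in> verts H" using simple_graph_adjD[OF s(2) step(2)] by simp_all
      then have "adj ?H (g w) (g z)" using adj_image_graph[OF s(2) inj wz] step(2) by simp
      then show ?case
        using wz(2) rtranclp.rtrancl_into_rtrancl[OF conjunct2[OF step(3)], of "g z"] by simp
    qed (use xy in simp)
    then show "(\<lambda>x y. adj ?H x y)\<^sup>*\<^sup>* u v" using xy by simp
  qed
  ultimately show ?thesis using that sH by blast
qed

lemma rayless_twins:
  fixes G :: "'a graph" and H :: "'b graph"
  assumes G: "simple_graph G" "rayless G" and tw: "twins s G H"
  shows "infinitely_many_nonisomorphic (\<lambda>H :: 'a graph. twins s G H)"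
    "connected_graph G \<Longrightarrow> connected_graph H \<Longrightarrow>
      infinitely_many_nonisomorphic (\<lambda>H :: 'a graph. connected_graph H \<and> twins s G H)"
proof -
  obtain H' :: "'a graph" where H': "simple_graph H'" "equimorphic s {} G H'" "\<not> iso_over {} G H'"
    and c: "connected_graph H \<Longrightarrow> connected_graph H'"
    using twin_copy[OF tw] by metis
  note alt = rayless_twin_alternative[OF G H']
  show "infinitely_many_nonisomorphic (\<lambda>H :: 'a graph. twins s G H)"
    using infinitely_many_twins[OF G(1) alt(1)] by simp
  assume cGH: "connected_graph G" "connected_graph H"
  have "infinitely_many_nonisomorphic (\<lambda>H :: 'a graph. connected_off {} H \<and> twins s G H)"
    by (rule infinitely_many_twins[OF G(1) alt(2)[OF cGH(1) c[OF cGH(2)]]])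
  moreover have "connected_off {} K \<and> twins s G K \<longleftrightarrow> connected_graph K \<and> twins s G K" for K :: "'a graph"
    using connected_graph_iff[of K] unfolding twins_def by blast
  ultimately show "infinitely_many_nonisomorphic (\<lambda>H :: 'a graph. connected_graph H \<and> twins s G H)" by simp
qed

theorem theorem1:
  fixes G :: "'a graph"
  assumes "simple_graph G" and "rayless G"
  shows
    "((infinitely_many_nonisomorphic (\<lambda>H :: 'a graph. weak_twins G H) \<or>
       \<not> (\<exists>H :: 'b graph. weak_twins G H)) \<and>
      (connected_graph G \<longrightarrow>
        infinitely_many_nonisomorphic (\<lambda>H :: 'a graph. connected_graph H \<and> weak_twins G H) \<or>
        \<not> (\<exists>H :: 'b graph. connected_graph H \<and> weak_twins G H))) \<and>
     ((infinitely_many_nonisomorphic (\<lambda>H :: 'a graph. strong_twins G H) \<or>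
       \<not> (\<exists>H :: 'b graph. strong_twins G H)) \<and>
      (connected_graph G \<longrightarrow>
        infinitely_many_nonisomorphic (\<lambda>H :: 'a graph. connected_graph H \<and> strong_twins G H) \<or>
        \<not> (\<exists>H :: 'b graph. connected_graph H \<and> strong_twins G H)))"
proof -
  \<comment> \<open>The weak and the strong statement are the two instances of
    \<open>s\<close>.\<close>
  have "(infinitely_many_nonisomorphic (\<lambda>H :: 'a graph. twins s G H) \<or> \<not> (\<exists>H :: 'b graph. twins s G H)) \<and>
    (connected_graph G \<longrightarrow>
      infinitely_many_nonisomorphic (\<lambda>H :: 'a graph. connected_graph H \<and> twins s G H) \<or>
      \<not> (\<exists>H :: 'b graph. connected_graph H \<and> twins s G H))" for s
  proof (cases "\<exists>H :: 'b graph. twins s G H")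
    case True
    then have "infinitely_many_nonisomorphic (\<lambda>H :: 'a graph. twins s G H)"
      by (elim exE) (rule rayless_twins(1)[OF assms])
    moreover have "infinitely_many_nonisomorphic (\<lambda>H :: 'a graph. connected_graph H \<and> twins s G H)"
      if "connected_graph G" "connected_graph H" "twins s G H" for H :: "'b graph"
      by (rule rayless_twins(2)[OF assms that(3,1,2)])
    ultimately show ?thesis by auto
  qed auto
  then show ?thesis unfolding weak_twins_iff strong_twins_iff by simp
qed

end
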